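(* Let $f\in\mathbb{Z}[x]$ be a polynomial of degree $d\geqslant 2$. For every real $\alpha\in(1/2,1)$, $$\dim\mathcal{F}_{f,\alpha}\leqslant\min\{U_1(d,\alpha),U_2(d,\alpha)\},$$ where $$U_1(d,\alpha)=\min_{r=1,\ldots,d}\frac{d+1-\alpha+2^r(1-\alpha)-r}{d+1-\alpha},\qquad U_2(d,\alpha)=\min_{r=1,\ldots,d}\frac{d+1-\alpha+r(r+1)(1-\alpha)-r}{d+1-\alpha},$$ and $\dim$ denotes Hausdorff dimension.
   Context: Write $\mathbf{e}(z)=\exp(2\pi i z)$ and $\mathsf{T}=[0,1]$. For a real sequence $f(n)$, $x\in\mathsf{T}$ and $N\in\mathbb{N}$ let $V_f(x;N)=\sum_{n=1}^N\mathbf{e}(xf(n))$, and for $\alpha\in(1/2,1)$ let $\mathcal{F}_{f,\alpha}=\{x\in\mathsf{T}:\ |V_f(x;N)|\geqslant N^\alpha\text{ for infinitely many }N\in\mathbb{N}\}$. *)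

theory Defs
  imports "HOL-Analysis.Analysis" "HOL-Computational_Algebra.Polynomial"
begin

section \<open>Hausdorff dimension\<close>

text \<open>
  Coverings are sequences of bounded sets; boundedness is imposed explicitly because
  \<^const>\<open>diameter\<close> is real-valued and has no meaning on unbounded sets. Members
  of a covering may be empty, so finite coverings are included. The exponent
  \<open>s\<close> is only used for \<open>s > 0\<close>, where \<open>0 powr s = 0\<close> is the intended
  contribution of empty sets and singletons.
\<close>

definition hausdorff_delta :: "real \<Rightarrow> real \<Rightarrow> 'a::metric_space set \<Rightarrow> ennreal" where
  "hausdorff_delta s \<delta> A =
    (INF U \<in> {U :: nat \<Rightarrow> 'a set.
                A \<subseteq> (\<Union>i. U i) \<and> (\<forall>i. bounded (U i) \<and> diameter (U i) \<le> \<delta>)}.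
       (\<Sum>i. ennreal (diameter (U i) powr s)))"

definition hausdorff_measure :: "real \<Rightarrow> 'a::metric_space set \<Rightarrow> ennreal" where
  "hausdorff_measure s A = (SUP \<delta> \<in> {0<..}. hausdorff_delta s \<delta> A)"

text \<open>
  The infimum is taken in \<^typ>\<open>ereal\<close>, so it is \<open>\<infinity>\<close> when no exponent
  qualifies.
\<close>

definition hausdorff_dim :: "'a::metric_space set \<Rightarrow> ereal" where
  "hausdorff_dim A = (INF s \<in> {s. s > 0 \<and> hausdorff_measure s A = 0}. ereal s)"

section \<open>Weyl sums\<close>

definition e :: "real \<Rightarrow> complex" where
  "e z = exp (2 * of_real pi * \<i> * of_real z)"

definition V :: "(nat \<Rightarrow> real) \<Rightarrow> real \<Rightarrow> nat \<Rightarrow> complex" where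
  "V f x N = (\<Sum>n = 1..N. e (x * f n))"

definition large_sums :: "(nat \<Rightarrow> real) \<Rightarrow> real \<Rightarrow> real set" where
  "large_sums f \<alpha> = {x \<in> {0..1}. infinite {N :: nat. norm (V f x N) \<ge> real N powr \<alpha>}}"

definition U1 :: "nat \<Rightarrow> real \<Rightarrow> real" where
  "U1 d \<alpha> = Min ((\<lambda>r. (real d + 1 - \<alpha> + 2 ^ r * (1 - \<alpha>) - real r) / (real d + 1 - \<alpha>)) ` {1..d})"

definition U2 :: "nat \<Rightarrow> real \<Rightarrow> real" where
  "U2 d \<alpha> = Min ((\<lambda>r. (real d + 1 - \<alpha> + real r * (real r + 1) * (1 - \<alpha>) - real r)
                        / (real d + 1 - \<alpha>)) ` {1..d})"

end

theory Submission
  imports Defs "HOL-Number_Theory.Cong"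
begin

text \<open>
  If \<open>|V\<^sub>f(x;M)| \<ge> M\<^sup>\<alpha>\<close> for some \<open>M\<close> in a dyadic block below \<open>N\<close>, then the maximal sum is large on
  an interval of length about \<open>N\<close> to the power \<open>-(d + 1 - \<alpha>)\<close> around \<open>x\<close>. Hence the number of such
  intervals, and with it the dimension, is controlled by the \<open>2s\<close>-th moment of the maximal sum, and
  this by the number of solutions of \<open>f(x\<^sub>1) + \<dots> = f(y\<^sub>1) + \<dots>\<close> in \<open>2s\<close> variables from short intervals.

  For \<open>2s = 2^r\<close> the count is Hua's lemma (Weyl differencing and the divisor bound). For
  \<open>2s = r(r+1)\<close> it follows from the sharp mean value theorem for the curve
  \<open>(n, \<dots>, n^(r-1), f(n))\<close>. The latter comes from an \<open>\<ell>\<^sup>2\<close> decoupling inequality on \<open>(\<int>/p^M)^k\<close> for one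
  fixed prime \<open>p\<close>: the argument of Guo, Li, Yung and Zorin-Kranich for the moment curve, carried out
  \<open>p\<close>-adically, where local constancy is exact. Decoupling in lower dimensions, applied along the
  fibres on which a sum over a distant residue class is constant, and Hoelder's inequality improve a
  family of asymmetric bilinear estimates again and again; rescaling turns this into a gain in the
  linear estimate, which is impossible for the infimum of the admissible exponents unless it is zero.
\<close>

section \<open>Exponential sums over boxes\<close>

text \<open>Both bounds come from one exponent count. If the \<open>2s\<close>-th mean value over an
  interval of length \<open>L\<close> is about \<open>L^\<rho>\<close>, then at scale
  \<open>2^j\<close> about \<open>2^(j(D + \<rho> - 2s\<alpha>))\<close> intervals of length
  \<open>2^(-jD)\<close> with \<open>D = d + 1 - \<alpha>\<close> suffice, so the dimension is at
  most \<open>(D + \<rho> - 2s\<alpha>)/D\<close>. Both choices of \<open>2s\<close> have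
  \<open>\<rho> = 2s - r\<close>. The obstacle in the second choice is that the curve ending in
  \<open>f\<close> may degenerate modulo \<open>p\<close>. Decoupling is applied only in residue
  classes modulo \<open>p\<close> where the \<open>r\<close>-th Taylor coefficient of
  \<open>f\<close> is a unit; the remaining classes, at most \<open>d\<close> of them, are sent to a
  shorter interval with a new polynomial. Hence \<open>p\<close> must be large in terms of
  \<open>d\<close>, and the count must be uniform in the polynomial. Decoupling is proved for all
  curves congruent to the moment curve modulo \<open>p\<close>, because this family, unlike the
  moment curve itself, survives rescaling and projection; \<open>p > k\<close> keeps the factorials
  invertible. All integrals are averages over finite groups. Integer solutions are counted modulo
  some \<open>Q\<close> so large that congruences are equalities.\<close>

definition add_char :: "int \<Rightarrow> int \<Rightarrow> complex" where
  "add_char Q t = e (of_int t / of_int Q)"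

lemma e_add: "e (x + y) = e x * e y"
  by (simp add: e_def algebra_simps exp_add)

lemma norm_e [simp]: "norm (e x) = 1"
  by (simp add: e_def norm_exp_eq_Re)

lemma e_of_int [simp]: "e (of_int n) = 1"
proof -
  have "exp (2 * of_real pi * \<i> * of_real (of_int n)) = (1::complex)"
    unfolding exp_eq_1 by (auto intro!: exI[of _ n])
  then show ?thesis by (simp add: e_def)
qed

lemma cnj_e: "cnj (e x) = e (- x)"
  by (simp add: e_def exp_cnj)

lemma add_char_add: "add_char Q (s + t) = add_char Q s * add_char Q t"
  by (simp add: add_char_def add_divide_distrib e_add)

lemma add_char_0 [simp]: "add_char Q 0 = 1"
  by (simp add: add_char_def e_def)

lemma norm_add_char [simp]: "norm (add_char Q t) = 1"
  by (simp add: add_char_def)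

lemma cnj_add_char: "cnj (add_char Q t) = add_char Q (- t)"
  by (simp add: add_char_def cnj_e)

lemma add_char_multiple [simp]: assumes "Q \<noteq> 0" shows "add_char Q (Q * t) = 1"
  using assms by (simp add: add_char_def)

lemma add_char_cong: assumes "[s = t] (mod Q)" "Q \<noteq> 0" shows "add_char Q s = add_char Q t"
proof -
  obtain k where "s = t + Q * k" using assms(1) by (metis cong_iff_lin cong_sym)
  then show ?thesis using assms by (simp add: add_char_add)
qed

lemma add_char_cancel: assumes "P \<noteq> 0" shows "add_char (P * Q) (P * t) = add_char Q t"
  using assms by (simp add: add_char_def)

lemma add_char_sum: "add_char Q (\<Sum>i\<in>A. g i) = (\<Prod>i\<in>A. add_char Q (g i))"
  by (induction A rule: infinite_finite_induct) (auto simp: add_char_add)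

lemma add_char_eq_1_iff: assumes "Q > 0" shows "add_char Q t = 1 \<longleftrightarrow> Q dvd t"
proof
  assume "add_char Q t = 1"
  then have "exp (2 * of_real pi * \<i> * of_real (of_int t / of_int Q)) = (1::complex)"
    by (simp add: add_char_def e_def)
  then obtain n :: int where "2 * pi * (of_int t / of_int Q) = of_int (2 * n) * pi"
    unfolding exp_eq_1 by auto
  then have "real_of_int t = real_of_int (n * Q)" using assms by (simp add: field_simps)
  then have "t = n * Q" by linarith
  then show "Q dvd t" by simp
next
  assume "Q dvd t"
  then show "add_char Q t = 1" using assms by (auto elim!: dvdE)
qed

lemma add_char_power: "add_char Q (int n * t) = add_char Q t ^ n"
  by (induction n) (auto simp: add_char_add algebra_simps)

lemma add_char_orth: assumes "Q > 0"
  shows "(\<Sum>x\<in>{0..<Q}. add_char Q (x * t)) = (if Q dvd t then of_int Q else 0)"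
proof -
  have "(\<Sum>x\<in>{0..<Q}. add_char Q (x * t)) = (\<Sum>x\<in>int ` {..<nat Q}. add_char Q (x * t))"
    using assms by (simp add: image_int_atLeastLessThan lessThan_atLeast0)
  also have "\<dots> = (\<Sum>n<nat Q. add_char Q t ^ n)"
    by (subst sum.reindex) (auto simp: add_char_power)
  also have "\<dots> = (if Q dvd t then of_int Q else 0)"
  proof (cases "Q dvd t")
    case True
    then have "add_char Q t = 1" using add_char_eq_1_iff assms by blast
    then show ?thesis using True assms by simp
  next
    case False
    then have ne: "add_char Q t \<noteq> 1" using add_char_eq_1_iff assms by blast
    have "add_char Q t ^ nat Q = 1" using assms by (simp flip: add_char_power)
    then show ?thesis using ne False by (simp add: sum_gp_strict)
  qed
  finally show ?thesis .
qed

section \<open>Averages over the finite groups \<open>(Z/Q)^k\<close>\<close>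

definition int_box :: "nat \<Rightarrow> int \<Rightarrow> (nat \<Rightarrow> int) set" where
  "int_box k Q = PiE {1..k} (\<lambda>_. {0..<Q})"

text \<open>The normalised sum over \<open>(Z/Q)^k\<close>, in the place of the integral over a
  torus.\<close>

definition avg :: "nat \<Rightarrow> int \<Rightarrow> ((nat \<Rightarrow> int) \<Rightarrow> real) \<Rightarrow> real" where
  "avg k Q G = (\<Sum>x\<in>int_box k Q. G x) / of_int Q ^ k"

lemma finite_int_box [simp]: "finite (int_box k Q)"
  by (simp add: int_box_def finite_PiE)

lemma card_int_box: "Q > 0 \<Longrightarrow> real (card (int_box k Q)) = of_int Q ^ k"
  by (simp add: int_box_def card_PiE)

lemma avg_const [simp]: "Q > 0 \<Longrightarrow> avg k Q (\<lambda>x. c) = c"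
  by (simp add: avg_def card_int_box)

lemma avg_mono: "Q > 0 \<Longrightarrow> (\<And>x. G x \<le> H x) \<Longrightarrow> avg k Q G \<le> avg k Q H"
  by (simp add: avg_def divide_right_mono sum_mono)

lemma avg_nonneg: "Q > 0 \<Longrightarrow> (\<And>x. 0 \<le> G x) \<Longrightarrow> 0 \<le> avg k Q G"
  by (simp add: avg_def sum_nonneg)

lemma avg_add: "avg k Q (\<lambda>x. G x + H x) = avg k Q G + avg k Q H"
  by (simp add: avg_def sum.distrib add_divide_distrib)

lemma avg_sum: "avg k Q (\<lambda>x. \<Sum>i\<in>A. G i x) = (\<Sum>i\<in>A. avg k Q (G i))"
  unfolding avg_def by (subst sum.swap) (simp add: sum_divide_distrib)

lemma avg_cmult: "avg k Q (\<lambda>x. c * G x) = c * avg k Q G"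
  by (simp add: avg_def sum_distrib_left)

lemma avg_cdiv: "avg k Q (\<lambda>x. G x / c) = avg k Q G / c"
  by (simp add: avg_def flip: sum_divide_distrib)

lemma avg_swap: "avg k Q (\<lambda>x. avg l R (\<lambda>z. G x z)) = avg l R (\<lambda>z. avg k Q (\<lambda>x. G x z))"
  unfolding avg_def by (simp add: sum_divide_distrib, subst sum.swap, simp add: mult.commute)

text \<open>Says that \<open>G\<close> is a function on \<open>(Z/Q)^k\<close>. Integrands are
  defined at all integer points, and translations leave the box, so invariance of averages rests on
  this property.\<close>

definition periodic :: "nat \<Rightarrow> int \<Rightarrow> ((nat \<Rightarrow> int) \<Rightarrow> 'a) \<Rightarrow> bool" where
  "periodic k Q G \<longleftrightarrow> (\<forall>x y. (\<forall>i\<in>{1..k}. [x i = y i] (mod Q)) \<longrightarrow> G x = G y)"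

lemma avg_translate:
  assumes "periodic k Q G" "Q > 0"
  shows "avg k Q (\<lambda>x. G (\<lambda>i. x i + h i)) = avg k Q G"
proof -
  let ?T = "\<lambda>h x. \<lambda>i\<in>{1..k}. (x i + h i) mod Q"
  have inv: "?T (\<lambda>i. - h i) (?T h x) = x" if "x \<in> int_box k Q" for x h
  proof
    fix i
    show "?T (\<lambda>i. - h i) (?T h x) i = x i"
    proof (cases "i \<in> {1..k}")
      case True
      then have "x i \<in> {0..<Q}" using that by (auto simp: int_box_def)
      with True show ?thesis by (simp add: mod_simps)
    next
      case False
      with that show ?thesis by (auto simp: int_box_def PiE_def extensional_def)
    qed
  qed
  have mem: "?T h x \<in> int_box k Q" for x h
    using assms by (auto simp: int_box_def)
  have bij: "bij_betw (?T h) (int_box k Q) (int_box k Q)"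
  proof (rule bij_betw_byWitness[where f' = "?T (\<lambda>i. - h i)"])
    show "\<forall>x\<in>int_box k Q. ?T (\<lambda>i. - h i) (?T h x) = x" using inv by blast
    show "\<forall>x\<in>int_box k Q. ?T h (?T (\<lambda>i. - h i) x) = x" using inv[of _ "\<lambda>i. - h i"] by simp
  qed (intro image_subsetI mem)+
  have "(\<Sum>x\<in>int_box k Q. G (\<lambda>i. x i + h i)) = (\<Sum>x\<in>int_box k Q. G (?T h x))"
    using assms(1) by (intro sum.cong refl) (auto simp: periodic_def cong_def)
  also have "\<dots> = (\<Sum>x\<in>int_box k Q. G x)"
    using sum.reindex_bij_betw[OF bij] by simp
  finally show ?thesis by (simp add: avg_def)
qed

text \<open>The device behind all fibrewise arguments. Each single translate has the same average,
  so \<open>h\<close> may be any family of shifts; later it parametrises a fibre on which some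
  factor of the integrand is constant.\<close>

lemma avg_average:
  assumes "periodic k Q G" "Q > 0" "R > 0"
  shows "avg k Q G = avg k Q (\<lambda>x. avg l R (\<lambda>z. G (\<lambda>i. x i + h z i)))"
  by (subst avg_swap) (simp add: avg_translate assms)

text \<open>The frequencies are the points \<open>(P 1 n, ..., P k n)\<close> of a polynomial curve.
  The coefficients \<open>co\<close> must be arbitrary: restriction to a fibre turns the remaining
  variables into phases, which are absorbed there.\<close>

definition exp_sum :: "nat \<Rightarrow> int \<Rightarrow> (nat \<Rightarrow> int poly) \<Rightarrow> (int \<Rightarrow> complex) \<Rightarrow> int set \<Rightarrow> (nat \<Rightarrow> int) \<Rightarrow> complex" where
  "exp_sum k Q P co S x = (\<Sum>n\<in>S. co n * add_char Q (\<Sum>i=1..k. x i * poly (P i) n))"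

lemma periodic_exp_sum: "Q > 0 \<Longrightarrow> periodic k Q (exp_sum k Q P co S)"
  unfolding periodic_def exp_sum_def
  by (auto intro!: sum.cong arg_cong2[where f="(*)"] add_char_cong cong_sum cong_mult)

lemma periodic_comp: "periodic k Q G \<Longrightarrow> periodic k Q (\<lambda>x. F (G x))"
  unfolding periodic_def by metis

lemma periodic_comp2: "periodic k Q G \<Longrightarrow> periodic k Q H \<Longrightarrow> periodic k Q (\<lambda>x. F (G x) (H x))"
  unfolding periodic_def by metis

text \<open>Half of the critical exponent \<open>k(k+1)\<close> of decoupling for a nondegenerate
  curve in dimension \<open>k\<close>.\<close>

definition tri :: "nat \<Rightarrow> nat" where "tri k = k * (k + 1) div 2"

lemma tri_2: "2 * tri k = k * (k + 1)"
  by (simp add: tri_def)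

lemma tri_0 [simp]: "tri 0 = 0" by (simp add: tri_def)

lemma tri_pos: "k \<ge> 1 \<Longrightarrow> tri k \<ge> 1"
  using tri_2[of k] by (cases "tri k") auto

lemma tri_mono: "l \<le> k \<Longrightarrow> tri l \<le> tri k"
  unfolding tri_def by (intro div_le_mono mult_le_mono) auto

definition res_class :: "int \<Rightarrow> nat \<Rightarrow> int \<Rightarrow> int set" where
  "res_class p b r = {n. [n = r] (mod p ^ b)}"

text \<open>Representatives of the classes modulo \<open>p^B\<close> inside one class modulo
  \<open>p^a\<close>: the \<open>p\<close>-adic form of cutting an interval of length
  \<open>p^(-a)\<close> into intervals of length \<open>p^(-B)\<close>.\<close>

definition subclasses :: "int \<Rightarrow> nat \<Rightarrow> nat \<Rightarrow> int \<Rightarrow> int set" where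
  "subclasses p a B c = {r \<in> {0..<p ^ B}. [r = c] (mod p ^ a)}"

lemma finite_subclasses [simp]: "finite (subclasses p a B c)"
  by (rule finite_subset[of _ "{0..<p ^ B}"]) (auto simp: subclasses_def)

lemma subclasses_0 [simp]: "subclasses p 0 B c = {0..<p ^ B}"
  by (auto simp: subclasses_def cong_def)

lemma subclasses_nonempty: assumes "p > 1" "a \<le> B" shows "subclasses p a B c \<noteq> {}"
proof -
  have "p ^ a dvd p ^ B" using assms by (simp add: le_imp_power_dvd)
  then have "[c mod p ^ B = c] (mod p ^ a)" by (simp add: cong_def mod_mod_cancel)
  then have "c mod p ^ B \<in> subclasses p a B c" using assms by (auto simp: subclasses_def)
  then show ?thesis by blast
qed

lemma sum_subclasses_nest:
  fixes f :: "int \<Rightarrow> 'a::comm_monoid_add"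
  assumes "p > 1" "a \<le> a'" "a' \<le> B"
  shows "(\<Sum>r\<in>subclasses p a a' c. \<Sum>s\<in>subclasses p a' B r. f s) = (\<Sum>s\<in>subclasses p a B c. f s)"
proof -
  have d: "p ^ a dvd p ^ a'" using assms by (simp add: le_imp_power_dvd)
  have "(\<Sum>r\<in>subclasses p a a' c. sum f {s \<in> subclasses p a B c. s mod p ^ a' = r}) = sum f (subclasses p a B c)"
  proof (rule sum.group)
    show "(\<lambda>s. s mod p ^ a') ` subclasses p a B c \<subseteq> subclasses p a a' c"
      using assms d by (auto simp: subclasses_def cong_def mod_mod_cancel)
  qed auto
  moreover have "{s \<in> subclasses p a B c. s mod p ^ a' = r} = subclasses p a' B r" if "r \<in> subclasses p a a' c" for r
  proof -
    have r: "r mod p ^ a' = r" "[r = c] (mod p ^ a)" using that by (auto simp: subclasses_def)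
    have "[s = c] (mod p ^ a)" if "[s = r] (mod p ^ a')" for s
      using that r(2) d by (meson cong_dvd_modulus cong_trans)
    then show ?thesis using r(1) by (auto simp: subclasses_def cong_def)
  qed
  ultimately show ?thesis by (simp cong: sum.cong)
qed

lemma sum_res_class_split:
  fixes f :: "int \<Rightarrow> 'a::comm_monoid_add"
  assumes "p > 1" "a \<le> B" "finite S"
  shows "(\<Sum>r\<in>subclasses p a B c. \<Sum>n\<in>S \<inter> res_class p B r. f n) = (\<Sum>n\<in>S \<inter> res_class p a c. f n)"
proof -
  have d: "p ^ a dvd p ^ B" using assms by (simp add: le_imp_power_dvd)
  have "(\<Sum>r\<in>subclasses p a B c. sum f {n \<in> S \<inter> res_class p a c. n mod p ^ B = r}) = sum f (S \<inter> res_class p a c)"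
  proof (rule sum.group)
    show "(\<lambda>s. s mod p ^ B) ` (S \<inter> res_class p a c) \<subseteq> subclasses p a B c"
      using assms d by (auto simp: subclasses_def res_class_def cong_def mod_mod_cancel)
  qed (use assms in auto)
  moreover have "{n \<in> S \<inter> res_class p a c. n mod p ^ B = r} = S \<inter> res_class p B r" if "r \<in> subclasses p a B c" for r
  proof -
    have r: "r mod p ^ B = r" "[r = c] (mod p ^ a)" using that by (auto simp: subclasses_def)
    have "[s = c] (mod p ^ a)" if "[s = r] (mod p ^ B)" for s
      using that r(2) d by (meson cong_dvd_modulus cong_trans)
    then show ?thesis using r(1) by (auto simp: res_class_def cong_def)
  qed
  ultimately show ?thesis by (simp cong: sum.cong)
qed

lemma exp_sum_split:
  assumes "p > 1" "a \<le> B" "finite S"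
  shows "exp_sum k Q P co (S \<inter> res_class p a c) x = (\<Sum>r\<in>subclasses p a B c. exp_sum k Q P co (S \<inter> res_class p B r) x)"
  by (simp only: exp_sum_def sum_res_class_split[OF assms])

lemma res_class_0 [simp]: "res_class p 0 c = UNIV" by (auto simp: res_class_def cong_def)

section \<open>Projections of curves close to the moment curve\<close>

text \<open>The moment curve up to multiples of \<open>p\<close>. Taylor expansion on a class modulo
  \<open>p^a\<close> with \<open>a \<ge> 1\<close> leaves a spare factor \<open>p\<close> in the
  error terms, which is why rescaling and projection lead back to this family.\<close>

definition moment_like :: "int \<Rightarrow> nat \<Rightarrow> (nat \<Rightarrow> int poly) \<Rightarrow> bool" where
  "moment_like p k P \<longleftrightarrow> (\<forall>i\<in>{1..k}. \<exists>C. P i = monom 1 i + smult p C)"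

text \<open>The \<open>j\<close>-th derivative at \<open>c\<close> divided by \<open>j!\<close>. It
  is an integer, so Taylor expansion makes sense modulo prime powers.\<close>

definition taylor_coeff :: "int \<Rightarrow> int poly \<Rightarrow> nat \<Rightarrow> int" where
  "taylor_coeff c A j = coeff (pcompose A [:c, 1:]) j"

lemma taylor_coeff_add: "taylor_coeff c (A + B) j = taylor_coeff c A j + taylor_coeff c B j"
  by (simp add: taylor_coeff_def pcompose_add)

lemma taylor_coeff_smult: "taylor_coeff c (smult s A) j = s * taylor_coeff c A j"
  by (simp add: taylor_coeff_def pcompose_smult)

lemma taylor_coeff_sum: "taylor_coeff c (\<Sum>i\<in>I. A i) j = (\<Sum>i\<in>I. taylor_coeff c (A i) j)"
  by (simp add: taylor_coeff_def pcompose_sum coeff_sum)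

lemma taylor_coeff_pderiv: "taylor_coeff c (pderiv A) j = of_nat (Suc j) * taylor_coeff c A (Suc j)"
proof -
  have "pderiv (pcompose A [:c, 1:]) = pcompose (pderiv A) [:c, 1:]"
    by (simp add: pderiv_pcompose pderiv_pCons)
  then show ?thesis by (metis taylor_coeff_def coeff_pderiv)
qed

lemma poly_shift_decomp:
  fixes A :: "int poly"
  shows "poly A v = (\<Sum>i\<le>l. coeff A i * v ^ i) + v ^ Suc l * poly (poly_shift (Suc l) A) v"
proof -
  have eq: "A = poly_cutoff (Suc l) A + monom 1 (Suc l) * poly_shift (Suc l) A"
    by (auto simp: poly_eq_iff coeff_poly_cutoff coeff_monom_mult coeff_poly_shift)
  have deg: "degree (poly_cutoff (Suc l) A) \<le> l"
    by (rule degree_le) (auto simp: coeff_poly_cutoff)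
  have "poly (poly_cutoff (Suc l) A) v = (\<Sum>i\<le>l. coeff (poly_cutoff (Suc l) A) i * v ^ i)"
    using arg_cong[OF poly_as_sum_of_monoms'[OF deg], of "\<lambda>A. poly A v"]
    by (simp add: poly_sum poly_monom)
  also have "\<dots> = (\<Sum>i\<le>l. coeff A i * v ^ i)"
    by (intro sum.cong) (auto simp: coeff_poly_cutoff)
  finally show ?thesis
    by (subst eq) (simp add: poly_monom)
qed

lemma taylor_coeff_taylor:
  "poly W (c + v) - poly W c
     = (\<Sum>i=1..l. taylor_coeff c W i * v ^ i) + v ^ Suc l * poly (poly_shift (Suc l) (pcompose W [:c, 1:])) v"
proof -
  let ?A = "pcompose W [:c, 1:]"
  have 1: "poly W (c + v) = poly ?A v" for v by (simp add: poly_pcompose)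
  have 2: "poly W c = coeff ?A 0" using 1[of 0] by (simp add: poly_0_coeff_0)
  have 3: "(\<Sum>i\<le>l. coeff ?A i * v ^ i) = coeff ?A 0 + (\<Sum>i=1..l. coeff ?A i * v ^ i)"
    by (simp add: atMost_atLeast0 sum.atLeast_Suc_atMost)
  show ?thesis
    unfolding 1 2 taylor_coeff_def by (subst poly_shift_decomp[of ?A v l]) (simp add: 3)
qed

lemma smult_sum_distrib: "smult c (\<Sum>i\<in>I. A i) = (\<Sum>i\<in>I. smult c (A i))"
  by (induction I rule: infinite_finite_induct) (auto simp: smult_add_right)

text \<open>The terms of order above \<open>l\<close> are divisible by \<open>p^(a(l+1))\<close>.
  After division by \<open>p^(aj)\<close> with \<open>j \<le> l\<close> at least one factor
  \<open>p\<close> is left, since \<open>a \<ge> 1\<close>; that factor is what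
  \<open>smult p C\<close> records.\<close>

lemma taylor_curve:
  assumes "a \<ge> 1" "1 \<le> j" "j \<le> l"
    and H: "\<And>i. i \<in> {1..l} \<Longrightarrow> [taylor_coeff c W i = (if i = j then 1 else 0)] (mod q)"
  shows "\<exists>C. \<forall>u. [poly W (c + p ^ a * u) - poly W c = p ^ (a * j) * poly (monom 1 j + smult p C) u] (mod q)"
proof -
  define R where "R = poly_shift (Suc l) (pcompose W [:c, 1:])"
  define C where "C = monom (p ^ (a * (Suc l - j) - 1)) (Suc l) * pcompose R [:0, p ^ a:]"
  have ge: "a * (Suc l - j) \<ge> 1" using assms by simp
  have pw: "p ^ (a * j) * (p * p ^ (a * (Suc l - j) - 1)) = p ^ (a * Suc l)"
  proof -
    have "p * p ^ (a * (Suc l - j) - 1) = p ^ (a * (Suc l - j))"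
      using ge by (metis One_nat_def Suc_pred power_Suc less_le_trans zero_less_one)
    moreover have "a * j + a * (Suc l - j) = a * Suc l"
      using assms by (metis distrib_left le_SucI le_add_diff_inverse)
    ultimately show ?thesis by (metis power_add)
  qed
  have "[poly W (c + p ^ a * u) - poly W c = p ^ (a * j) * poly (monom 1 j + smult p C) u] (mod q)" for u
  proof -
    let ?v = "p ^ a * u"
    have "[(\<Sum>i=1..l. taylor_coeff c W i * ?v ^ i) = (\<Sum>i=1..l. (if i = j then 1 else 0) * ?v ^ i)] (mod q)"
      using H by (intro cong_sum cong_mult cong_refl) auto
    also have "(\<Sum>i=1..l. (if i = j then 1 else 0) * ?v ^ i) = (\<Sum>i\<in>{1..l}. if i = j then ?v ^ i else 0)"
      by (intro sum.cong) auto
    also have "\<dots> = ?v ^ j" using assms by simp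
    finally have "[poly W (c + ?v) - poly W c = ?v ^ j + ?v ^ Suc l * poly R ?v] (mod q)"
      unfolding taylor_coeff_taylor[of W c ?v l] R_def by (intro cong_add cong_refl)
    also have "?v ^ j + ?v ^ Suc l * poly R ?v = p ^ (a * j) * poly (monom 1 j + smult p C) u"
    proof -
      have "p ^ (a * j) * (p * poly C u) = p ^ (a * j) * (p * p ^ (a * (Suc l - j) - 1)) * u ^ Suc l * poly R ?v"
        by (simp add: C_def poly_monom poly_pcompose algebra_simps)
      also have "\<dots> = p ^ (a * Suc l) * u ^ Suc l * poly R ?v"
        by (simp only: pw)
      also have "\<dots> = ?v ^ Suc l * poly R ?v"
        by (simp only: power_mult_distrib power_mult)
      finally show ?thesis
        by (simp add: poly_monom power_mult_distrib algebra_simps flip: power_mult)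
    qed
    finally show ?thesis .
  qed
  then show ?thesis by blast
qed

lemma taylor_zero:
  assumes H: "\<And>i. i \<in> {1..m} \<Longrightarrow> [taylor_coeff c W i = 0] (mod q)" and q: "p ^ (Suc m * b) dvd q"
  shows "p ^ (Suc m * b) dvd poly W (c + p ^ b * u) - poly W c"
proof -
  have "p ^ (Suc m * b) dvd taylor_coeff c W i" if "i \<in> {1..m}" for i
    using H[OF that] q by (meson cong_0_iff dvd_trans)
  then have "p ^ (Suc m * b) dvd (\<Sum>i=1..m. taylor_coeff c W i * (p ^ b * u) ^ i)"
    by (intro dvd_sum) auto
  moreover have "p ^ (Suc m * b) dvd (p ^ b * u) ^ Suc m"
    by (simp only: power_mult_distrib power_mult[symmetric] mult.commute[of b]) simp
  ultimately show ?thesis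
    unfolding taylor_coeff_taylor[of W c "p ^ b * u" m] by (meson dvd_add dvd_mult2)
qed

text \<open>Solvability modulo \<open>p\<close> follows from a triangular family of functionals and lifts to \<open>p^M\<close> by
  successive approximation, which avoids determinants.\<close>

lemma triangular_solve:
  fixes p :: int and v :: "nat \<Rightarrow> nat \<Rightarrow> int"
  assumes p: "prime p"
    and T: "\<And>t. t \<in> {1..k} \<Longrightarrow> \<exists>w. (\<forall>u\<in>{1..<t}. p dvd (\<Sum>i\<in>I. w i * v u i)) \<and> \<not> p dvd (\<Sum>i\<in>I. w i * v t i)"
  shows "\<exists>w. \<forall>t\<in>{1..k}. [(\<Sum>i\<in>I. w i * v t i) = b t] (mod p)"
proof -
  have "\<exists>w. \<forall>t\<in>{1..s}. [(\<Sum>i\<in>I. w i * v t i) = b t] (mod p)" if "s \<le> k" for s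
    using that
  proof (induction s)
    case 0
    then show ?case by simp
  next
    case (Suc s)
    then obtain w where w: "\<forall>t\<in>{1..s}. [(\<Sum>i\<in>I. w i * v t i) = b t] (mod p)" by auto
    obtain w' where w': "\<forall>u\<in>{1..<Suc s}. p dvd (\<Sum>i\<in>I. w' i * v u i)" "\<not> p dvd (\<Sum>i\<in>I. w' i * v (Suc s) i)"
      using T[of "Suc s"] Suc.prems by auto
    let ?L = "\<lambda>w t. \<Sum>i\<in>I. w i * v t i"
    have "coprime (?L w' (Suc s)) p" using w'(2) p by (metis coprime_commute prime_imp_coprime)
    then obtain y where y: "[?L w' (Suc s) * y = 1] (mod p)" using cong_solve_coprime_int by blast
    define x where "x = y * (b (Suc s) - ?L w (Suc s))"
    define w2 where "w2 = (\<lambda>i. w i + x * w' i)"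
    have lin: "?L w2 t = ?L w t + x * ?L w' t" for t
      by (simp add: w2_def algebra_simps sum.distrib sum_distrib_left)
    have "[?L w2 t = b t] (mod p)" if "t \<in> {1..Suc s}" for t
    proof (cases "t = Suc s")
      case True
      have "[?L w (Suc s) + (?L w' (Suc s) * y) * (b (Suc s) - ?L w (Suc s)) = ?L w (Suc s) + 1 * (b (Suc s) - ?L w (Suc s))] (mod p)"
        by (intro cong_add cong_mult cong_refl y)
      then show ?thesis unfolding lin True x_def by (simp add: algebra_simps)
    next
      case False
      then have t: "t \<in> {1..s}" "t \<in> {1..<Suc s}" using that by auto
      have "[?L w t + x * ?L w' t = b t + x * 0] (mod p)"
        using w w' t by (intro cong_add cong_mult cong_refl) (auto simp: cong_0_iff)
      then show ?thesis unfolding lin by simp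
    qed
    then show ?case by blast
  qed
  then show ?thesis by blast
qed

lemma hensel_solve:
  fixes p :: int and v :: "nat \<Rightarrow> nat \<Rightarrow> int"
  assumes T: "\<And>b. \<exists>w. \<forall>t\<in>K. [(\<Sum>i\<in>I. w i * v t i) = b t] (mod p)"
  shows "\<exists>w. \<forall>t\<in>K. [(\<Sum>i\<in>I. w i * v t i) = b t] (mod p ^ M)"
proof (induction M)
  case 0
  then show ?case by (simp add: cong_def)
next
  case (Suc M)
  let ?L = "\<lambda>w t. \<Sum>i\<in>I. w i * v t i"
  from Suc obtain w where w: "\<forall>t\<in>K. [?L w t = b t] (mod p ^ M)" by blast
  then have "\<forall>t\<in>K. \<exists>r. b t = ?L w t + p ^ M * r" by (simp add: cong_iff_lin)
  then obtain r where r: "\<forall>t\<in>K. b t = ?L w t + p ^ M * r t" by metis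
  obtain w' where w': "\<forall>t\<in>K. [?L w' t = r t] (mod p)" using T by blast
  define w2 where "w2 = (\<lambda>i. w i + p ^ M * w' i)"
  have lin: "?L w2 t = ?L w t + p ^ M * ?L w' t" for t
    by (simp add: w2_def algebra_simps sum.distrib sum_distrib_left)
  have "[?L w2 t = b t] (mod p ^ Suc M)" if "t \<in> K" for t
  proof -
    have "p dvd ?L w' t - r t" using w' that by (simp add: cong_iff_dvd_diff)
    then have "p ^ M * p dvd p ^ M * (?L w' t - r t)" by (intro mult_dvd_mono dvd_refl)
    then show ?thesis using r that unfolding lin cong_iff_dvd_diff
      by (simp add: algebra_simps)
  qed
  then show ?case by blast
qed

text \<open>The factor \<open>fact k\<close> clears the denominators \<open>1, ..., k\<close> of
  integration. It is a unit modulo any prime above \<open>k\<close>.\<close>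

lemma antiderivative:
  fixes G :: "int poly"
  assumes "degree G < k"
  shows "\<exists>R. degree R \<le> k \<and> pderiv R = smult (fact k) G"
proof -
  define R where "R = (\<Sum>j<k. monom (fact k div int (Suc j) * coeff G j) (Suc j))"
  have deg: "degree R \<le> k"
    unfolding R_def by (intro degree_sum_le) (auto intro: order_trans[OF degree_monom_le])
  have "coeff (pderiv R) j = fact k * coeff G j" for j
  proof -
    have "coeff R (Suc j) = (\<Sum>i<k. if i = j then fact k div int (Suc j) * coeff G j else 0)"
      unfolding R_def coeff_sum by (intro sum.cong) auto
    also have "\<dots> = (if j < k then fact k div int (Suc j) * coeff G j else 0)" by simp
    finally have *: "coeff R (Suc j) = (if j < k then fact k div int (Suc j) * coeff G j else 0)" .
    show ?thesis
    proof (cases "j < k")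
      case True
      then have "int (Suc j) dvd fact k"
        by (metis Suc_leI dvd_fact le_add1 of_nat_dvd_iff of_nat_fact plus_1_eq_Suc)
      then have "int (Suc j) * (fact k div int (Suc j)) = fact k" by simp
      then show ?thesis using True * by (simp add: coeff_pderiv flip: mult.assoc del: of_nat_Suc)
    next
      case False
      then show ?thesis using * assms by (simp add: coeff_pderiv coeff_eq_0)
    qed
  qed
  then have "pderiv R = smult (fact k) G" by (simp add: poly_eq_iff)
  with deg show ?thesis by blast
qed

lemma taylor_coeff_shift_power: "taylor_coeff c ([:-c', 1:] ^ m * [:-c, 1:] ^ i) j
   = (if j < i then 0 else coeff ([:c - c', 1:] ^ m) (j - i))"
proof -
  have pw: "pcompose (A ^ n) q = pcompose A q ^ n" for A q :: "int poly" and n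
    by (induction n) (auto simp: pcompose_mult pcompose_1)
  have "pcompose ([:-c', 1:] ^ m * [:-c, 1:] ^ i) [:c, 1:] = [:c - c', 1:] ^ m * [:0, 1:] ^ i"
    by (simp add: pcompose_mult pw pcompose_pCons)
  also have "\<dots> = monom 1 i * [:c - c', 1:] ^ m"
    by (simp add: monom_altdef mult.commute)
  finally show ?thesis by (simp add: taylor_coeff_def coeff_monom_mult)
qed

text \<open>Independence modulo \<open>p\<close> of the Hermite interpolation data (orders
  \<open>1..k-l\<close> at \<open>c'\<close>, then \<open>1..l\<close> at \<open>c\<close>), in the
  triangular form that can be solved without determinants. For the data at \<open>c'\<close> powers
  of \<open>x - c'\<close> serve. For the data at \<open>c\<close> one integrates
  \<open>(x - c')^(k-l) (x - c)^(i-1)\<close>: its antiderivative has vanishing coefficients at both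
  points up to the right orders, and the next one is, up to units, a power of
  \<open>c - c'\<close>.\<close>

lemma confluent_vandermonde:
  fixes p :: int
  assumes p: "prime p" "int k < p" and c: "\<not> [c = c'] (mod p)" and l: "l \<le> k" and t: "t \<in> {1..k}"
  defines "H \<equiv> \<lambda>W t. if t \<le> k - l then taylor_coeff c' W t else taylor_coeff c W (t - (k - l))"
  shows "\<exists>W. degree W \<le> k \<and> (\<forall>u\<in>{1..<t}. p dvd H W u) \<and> \<not> p dvd H W t"
proof (cases "t \<le> k - l")
  case True
  define W where "W = [:-c', 1:] ^ t"
  have "taylor_coeff c' W j = (if j < t then 0 else coeff 1 (j - t))" for j
    using taylor_coeff_shift_power[of c' 0 0 t j] by (simp add: W_def)
  then have "(\<forall>u\<in>{1..<t}. p dvd H W u) \<and> \<not> p dvd H W t"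
    using True p prime_gt_1_int[of p] by (auto simp: H_def zdvd_not_zless)
  moreover have "degree W \<le> k"
    using t unfolding W_def by (intro order_trans[OF degree_power_le]) auto
  ultimately show ?thesis by blast
next
  case False
  define m where "m = k - l"
  define i where "i = t - m"
  have i: "i \<ge> 1" "t = m + i" "m + i \<le> k" using False t by (auto simp: m_def i_def)
  define G where "G = [:-c', 1:] ^ m * [:-c, 1:] ^ (i - 1)"
  have "degree G \<le> m + (i - 1)" unfolding G_def
    by (intro order_trans[OF degree_mult_le] add_mono order_trans[OF degree_power_le]) auto
  then have "degree G < k" using i by linarith
  then obtain R where R: "degree R \<le> k" "pderiv R = smult (fact k) G" using antiderivative by blast
  have HR: "int u * taylor_coeff x R u = fact k * taylor_coeff x G (u - 1)" if "u \<ge> 1" for u x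
  proof -
    from \<open>u \<ge> 1\<close> obtain u' where u': "u = Suc u'" by (cases u) auto
    show ?thesis using taylor_coeff_pderiv[of x R u'] by (simp add: R u' taylor_coeff_smult)
  qed
  have G1: "taylor_coeff c' G j = 0" if "j < m" for j
    using taylor_coeff_shift_power[of c' c "i - 1" m j] that by (simp add: G_def mult.commute)
  have G2: "taylor_coeff c G j = 0" if "j < i - 1" for j
    using taylor_coeff_shift_power[of c c' m "i - 1" j] that by (simp add: G_def)
  have G3: "taylor_coeff c G (i - 1) = (c - c') ^ m"
    using taylor_coeff_shift_power[of c c' m "i - 1" "i - 1"] by (simp add: G_def coeff_0_power)
  have "H R u = 0" if "u \<in> {1..<t}" for u
  proof (cases "u \<le> m")
    case True
    then have "int u * taylor_coeff c' R u = 0" using HR[of u c'] G1[of "u - 1"] that by auto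
    then show ?thesis using True that by (auto simp: H_def m_def)
  next
    case False
    then have "int (u - m) * taylor_coeff c R (u - m) = 0"
      using HR[of "u - m" c] G2[of "u - m - 1"] that i by auto
    then show ?thesis using False that by (auto simp: H_def m_def)
  qed
  moreover have "\<not> p dvd H R t"
  proof
    assume "p dvd H R t"
    then have "p dvd taylor_coeff c R i" using False by (auto simp: H_def i_def m_def)
    then have "p dvd fact k * (c - c') ^ m" using HR[of i c] G3 i by (metis dvd_mult)
    then have "p dvd fact k \<or> p dvd (c - c') ^ m" using p prime_dvd_mult_iff by blast
    moreover have "\<not> p dvd (c - c') ^ m"
      using p(1) c by (metis cong_iff_dvd_diff prime_dvd_power)
    moreover have "\<not> p dvd fact k"
    proof
      assume a: "p dvd fact k"
      obtain q where q: "p = int q" using p(2) by (metis nat_0_le of_nat_0_le_iff order.strict_implies_order order_trans)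
      have "q dvd fact k" using a unfolding q by (metis of_nat_dvd_iff of_nat_fact)
      moreover have "prime q" using p(1) q by simp
      ultimately have "q \<le> k" using prime_dvd_fact_iff by blast
      then show False using p(2) q by simp
    qed
    ultimately show False by blast
  qed
  ultimately show ?thesis using R by auto
qed

text \<open>Transversality of the osculating spaces at two different classes. The \<open>l\<close>
  linear combinations are prescribed by interpolation: at \<open>c\<close> their Taylor coefficients
  of orders \<open>1..l\<close> form the identity matrix, at \<open>c'\<close> those of orders
  \<open>1..k-l\<close> vanish. So near \<open>c\<close> the projected curve is a rescaled
  nondegenerate curve in dimension \<open>l\<close>, while along the class of \<open>c'\<close>
  modulo \<open>p^b\<close> it moves only by multiples of \<open>p^((k-l+1)b)\<close>.\<close>

lemma curve_project:
  fixes p :: int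
  assumes p: "prime p" "int k < p" and c: "\<not> [c = c'] (mod p)" and l: "1 \<le> l" "l \<le> k"
    and a: "a \<ge> 1" and P: "moment_like p k P" and M: "(k - l + 1) * b \<le> M"
  shows "\<exists>w P'. moment_like p l P' \<and>
     (\<forall>j\<in>{1..l}. \<forall>u. [(\<Sum>i=1..k. w j i * (poly (P i) (c + p ^ a * u) - poly (P i) c))
                      = p ^ (a * j) * poly (P' j) u] (mod p ^ M)) \<and>
     (\<forall>j\<in>{1..l}. \<forall>u. p ^ ((k - l + 1) * b) dvd
         (\<Sum>i=1..k. w j i * (poly (P i) (c' + p ^ b * u) - poly (P i) c')))"
proof -
  define H where "H \<equiv> \<lambda>W t. if t \<le> k - l then taylor_coeff c' W t else taylor_coeff c W (t - (k - l))"
  define W where "W = (\<lambda>w. \<Sum>i=1..k. smult (w i) (P i))"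
  have Hlin: "(\<Sum>i=1..k. w i * H (P i) t) = H (W w) t" for w t
    by (auto simp: H_def W_def taylor_coeff_sum taylor_coeff_smult)
  have Wp: "poly (W w) x - poly (W w) y = (\<Sum>i=1..k. w i * (poly (P i) x - poly (P i) y))" for w x y
    by (simp add: W_def poly_sum right_diff_distrib sum_subtractf)
  have "\<exists>w. (\<forall>u\<in>{1..<t}. p dvd (\<Sum>i=1..k. w i * H (P i) u)) \<and> \<not> p dvd (\<Sum>i=1..k. w i * H (P i) t)"
    if t: "t \<in> {1..k}" for t
  proof -
    obtain A where A: "degree A \<le> k" "\<forall>u\<in>{1..<t}. p dvd H A u" "\<not> p dvd H A t"
      using confluent_vandermonde[OF p c l(2) t] unfolding H_def by blast
    obtain C where C: "\<forall>i\<in>{1..k}. P i = monom 1 i + smult p (C i)"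
      using P unfolding moment_like_def by metis
    have A_eq: "A = [:coeff A 0:] + (\<Sum>i=1..k. monom (coeff A i) i)"
      using A(1) poly_as_sum_of_monoms'[of A k]
      by (simp add: atMost_atLeast0 sum.atLeast_Suc_atMost monom_0)
    have "W (coeff A) = (\<Sum>i=1..k. monom (coeff A i) i + smult p (smult (coeff A i) (C i)))"
      unfolding W_def using C by (intro sum.cong) (auto simp: smult_add_right smult_monom mult.commute)
    also have "\<dots> = (\<Sum>i=1..k. monom (coeff A i) i) + smult p (\<Sum>i=1..k. smult (coeff A i) (C i))"
      by (simp add: sum.distrib smult_sum_distrib)
    finally have W_eq: "W (coeff A) = (\<Sum>i=1..k. monom (coeff A i) i) + smult p (\<Sum>i=1..k. smult (coeff A i) (C i))" .
    define D where "D = (\<Sum>i=1..k. smult (coeff A i) (C i))"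
    \<comment> \<open>The coordinates start at degree one, so the constant term of \<open>A\<close>
      cannot be produced by a linear combination of them. The functionals all have positive order
      and do not see it.\<close>
    have "W (coeff A) + [:coeff A 0:] = ([:coeff A 0:] + (\<Sum>i=1..k. monom (coeff A i) i)) + smult p D"
      by (simp only: W_eq D_def add_ac)
    then have D: "W (coeff A) + [:coeff A 0:] = A + smult p D"
      by (simp only: A_eq[symmetric])
    have const: "taylor_coeff x [:coeff A 0:] u = 0" if "u \<ge> 1" for x u
      using that by (cases u) (auto simp: taylor_coeff_def)
    have "H (W (coeff A)) u = H A u + p * H D u" if "u \<ge> 1" for u
    proof -
      have "H (W (coeff A) + [:coeff A 0:]) u = H A u + p * H D u"
        unfolding D by (simp add: H_def taylor_coeff_add taylor_coeff_smult)
      then show ?thesis using that by (auto simp: H_def taylor_coeff_add const split: if_splits)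
    qed
    then have "p dvd H (W (coeff A)) u \<longleftrightarrow> p dvd H A u" if "u \<ge> 1" for u
      using that by (metis dvd_add_times_triv_right_iff mult.commute)
    then show ?thesis using A t unfolding Hlin by (intro exI[of _ "coeff A"]) auto
  qed
  then have solve: "\<exists>w. \<forall>t\<in>{1..k}. [(\<Sum>i=1..k. w i * H (P i) t) = b t] (mod p)" for b
    using triangular_solve[OF p(1), where k = k and I = "{1..k}" and v = "\<lambda>t i. H (P i) t" and b = b] by blast
  have ex: "\<exists>w. \<forall>t\<in>{1..k}. [H (W w) t = b t] (mod p ^ M)" for b
    using hensel_solve[where K = "{1..k}" and I = "{1..k}" and v = "\<lambda>t i. H (P i) t", OF solve] unfolding Hlin by blast
  have "\<exists>w. \<forall>t\<in>{1..k}. [H (W w) t = (if t = k - l + j then 1 else 0)] (mod p ^ M)" for j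
    by (rule ex)
  then obtain w where w: "\<And>j t. t \<in> {1..k} \<Longrightarrow> [H (W (w j)) t = (if t = k - l + j then 1 else 0)] (mod p ^ M)"
    by metis
  have w1: "[taylor_coeff c (W (w j)) i = (if i = j then 1 else 0)] (mod p ^ M)" if "i \<in> {1..l}" for i j
  proof -
    define t where "t = k - l + i"
    have t: "t \<in> {1..k}" "\<not> t \<le> k - l" "t - (k - l) = i" "t = k - l + j \<longleftrightarrow> i = j"
      using that l by (auto simp: t_def)
    show ?thesis using w[OF t(1), of j] t(2-4) by (simp add: H_def)
  qed
  have w2: "[taylor_coeff c' (W (w j)) i = 0] (mod p ^ M)" if "i \<in> {1..k-l}" "j \<in> {1..l}" for i j
  proof -
    have t: "i \<in> {1..k}" "i \<le> k - l" "i \<noteq> k - l + j"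
      using that l by auto
    show ?thesis using w[OF t(1), of j] t(2,3) by (simp add: H_def)
  qed
  have "\<exists>C. \<forall>u. [poly (W (w j)) (c + p ^ a * u) - poly (W (w j)) c = p ^ (a * j) * poly (monom 1 j + smult p C) u] (mod p ^ M)"
    if "j \<in> {1..l}" for j
    using that a w1 by (intro taylor_curve[where l = l]) auto
  then obtain C where C: "\<And>j u. j \<in> {1..l} \<Longrightarrow> [poly (W (w j)) (c + p ^ a * u) - poly (W (w j)) c = p ^ (a * j) * poly (monom 1 j + smult p (C j)) u] (mod p ^ M)"
    by metis
  have Z: "p ^ (Suc (k - l) * b) dvd poly (W (w j)) (c' + p ^ b * u) - poly (W (w j)) c'" if "j \<in> {1..l}" for j u
    using that w2 M by (intro taylor_zero[where q = "p ^ M"]) (auto simp: le_imp_power_dvd)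
  show ?thesis
    by (rule exI[of _ w], rule exI[of _ "\<lambda>j. monom 1 j + smult p (C j)"])
       (use C Z in \<open>auto simp: moment_like_def Wp\<close>)
qed

section \<open>Decoupling inequalities\<close>

lemma convex_on_power: "convex_on {0::real..} (\<lambda>x. x ^ n)"
  using convex_power_even[of n] convex_power_odd[of n]
  by (cases "even n") (auto intro: convex_on_subset)

text \<open>Jensen's inequality for the power \<open>Suc n\<close>, with probabilities proportional
  to \<open>lam i\<close> at the points \<open>mu i / lam i\<close>. This form of Hoelder's
  inequality replaces norms throughout, so that only integer powers occur.\<close>

lemma power_sum_le_weighted:
  fixes lam mu :: "'a \<Rightarrow> real"
  assumes "finite A" "A \<noteq> {}" "\<And>i. i \<in> A \<Longrightarrow> lam i > 0" "\<And>i. i \<in> A \<Longrightarrow> mu i \<ge> 0"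
  shows "(\<Sum>i\<in>A. mu i) ^ Suc n \<le> (\<Sum>i\<in>A. lam i) ^ n * (\<Sum>i\<in>A. mu i ^ Suc n / lam i ^ n)"
proof -
  define L where "L = (\<Sum>i\<in>A. lam i)"
  have L: "L > 0" unfolding L_def using assms by (intro sum_pos) auto
  have "(\<Sum>i\<in>A. (lam i / L) *\<^sub>R (mu i / lam i)) ^ Suc n \<le> (\<Sum>i\<in>A. (lam i / L) * (mu i / lam i) ^ Suc n)"
    using assms L
    by (intro convex_on_sum[OF _ _ convex_on_power[of "Suc n"]])
       (auto simp: less_imp_le L_def simp flip: sum_divide_distrib)
  also have "(\<Sum>i\<in>A. (lam i / L) *\<^sub>R (mu i / lam i)) = (\<Sum>i\<in>A. mu i) / L"
    unfolding sum_divide_distrib using assms(3) by (intro sum.cong) (auto simp: less_imp_neq[symmetric])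
  also have "(\<Sum>i\<in>A. (lam i / L) * (mu i / lam i) ^ Suc n) = (\<Sum>i\<in>A. mu i ^ Suc n / lam i ^ n) / L"
    unfolding sum_divide_distrib using assms(3) by (intro sum.cong) (auto simp: less_imp_neq[symmetric] power_divide field_simps)
  finally have "(\<Sum>i\<in>A. mu i) ^ Suc n / L ^ Suc n \<le> (\<Sum>i\<in>A. mu i ^ Suc n / lam i ^ n) / L"
    by (simp only: power_divide)
  then have "(\<Sum>i\<in>A. mu i) ^ Suc n \<le> (\<Sum>i\<in>A. mu i ^ Suc n / lam i ^ n) / L * L ^ Suc n"
    using L by (simp add: pos_divide_le_eq)
  then show ?thesis using L unfolding L_def[symmetric] by (simp add: mult.commute)
qed

lemma power_sum_le_card:
  fixes mu :: "'a \<Rightarrow> real"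
  assumes "finite A" "\<And>i. i \<in> A \<Longrightarrow> mu i \<ge> 0"
  shows "(\<Sum>i\<in>A. mu i) ^ Suc n \<le> real (card A) ^ n * (\<Sum>i\<in>A. mu i ^ Suc n)"
  using power_sum_le_weighted[of A "\<lambda>_. 1" mu n] assms by (cases "A = {}") auto

lemma sum_power_le_power_sum:
  fixes mu :: "'a \<Rightarrow> real"
  assumes "finite A" "\<And>i. i \<in> A \<Longrightarrow> mu i \<ge> 0" "n \<ge> 1"
  shows "(\<Sum>i\<in>A. mu i ^ n) \<le> (\<Sum>i\<in>A. mu i) ^ n"
proof -
  obtain m where n: "n = Suc m" using assms(3) by (cases n) auto
  have "(\<Sum>i\<in>A. mu i ^ n) \<le> (\<Sum>i\<in>A. mu i * (\<Sum>i\<in>A. mu i) ^ m)"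
    unfolding n power_Suc using assms
    by (intro sum_mono mult_left_mono power_mono) (auto intro: member_le_sum)
  also have "\<dots> = (\<Sum>i\<in>A. mu i) ^ n" by (simp add: n flip: sum_distrib_right)
  finally show ?thesis .
qed

section \<open>Decoupling at the critical exponent\<close>

lemma cong_int_lin: "[r = c] (mod m) \<Longrightarrow> \<exists>t. r = c + m * t" for r c m :: int
  by (metis cong_iff_lin cong_sym)

text \<open>Each \<open>lam r\<close> bounds the square of the norm of order
  \<open>2 * tri k\<close> of the piece on the class \<open>r\<close>; the conclusion is the
  \<open>l^2\<close> decoupling inequality raised to the power \<open>2 * tri k\<close>. Arbitrary
  positive upper bounds instead of the norms themselves avoid roots and divisions by zero. The
  modulus \<open>p^(k * B)\<close> is the spatial scale that belongs to caps of length
  \<open>p^(-B)\<close>.\<close>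

definition decoupling_bound :: "int \<Rightarrow> nat \<Rightarrow> nat \<Rightarrow> real \<Rightarrow> bool" where
  "decoupling_bound p k B K \<longleftrightarrow> (\<forall>P co S lam. moment_like p k P \<longrightarrow> finite S \<longrightarrow>
     (\<forall>r\<in>{0..<p ^ B}. lam r > 0 \<and>
        avg k (p ^ (k * B)) (\<lambda>x. norm (exp_sum k (p ^ (k * B)) P co (S \<inter> res_class p B r) x) ^ (2 * tri k)) \<le> lam r ^ tri k) \<longrightarrow>
     avg k (p ^ (k * B)) (\<lambda>x. norm (exp_sum k (p ^ (k * B)) P co S x) ^ (2 * tri k))
       \<le> K * (\<Sum>r\<in>{0..<p ^ B}. lam r) ^ tri k)"

lemma decoupling_bound_mono:
  assumes "decoupling_bound p k B K" "K \<le> K'" shows "decoupling_bound p k B K'"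
  unfolding decoupling_bound_def
proof (intro allI impI)
  fix P co S and lam :: "int \<Rightarrow> real"
  assume h: "moment_like p k P" "finite S" "\<forall>r\<in>{0..<p ^ B}. lam r > 0 \<and>
        avg k (p ^ (k * B)) (\<lambda>x. norm (exp_sum k (p ^ (k * B)) P co (S \<inter> res_class p B r) x) ^ (2 * tri k)) \<le> lam r ^ tri k"
  have "avg k (p ^ (k * B)) (\<lambda>x. norm (exp_sum k (p ^ (k * B)) P co S x) ^ (2 * tri k))
       \<le> K * (\<Sum>r\<in>{0..<p ^ B}. lam r) ^ tri k"
    using assms(1) h unfolding decoupling_bound_def by blast
  also have "\<dots> \<le> K' * (\<Sum>r\<in>{0..<p ^ B}. lam r) ^ tri k"
    using assms(2) h(3) by (intro mult_right_mono zero_le_power sum_nonneg) (auto simp: less_imp_le)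
  finally show "avg k (p ^ (k * B)) (\<lambda>x. norm (exp_sum k (p ^ (k * B)) P co S x) ^ (2 * tri k))
       \<le> K' * (\<Sum>r\<in>{0..<p ^ B}. lam r) ^ tri k" .
qed

text \<open>By homogeneity and convexity the bound becomes linear in the averages, so that it survives
  integration against an arbitrary nonnegative weight without Minkowski's inequality.\<close>

lemma decoupling_bound_linear:
  assumes D: "decoupling_bound p k B K" and p: "p > 1" and k: "k \<ge> 1" and K: "K \<ge> 0"
    and P: "moment_like p k P" and S: "finite S" and lam: "\<And>r. r \<in> {0..<p ^ B} \<Longrightarrow> lam r > 0"
  shows "avg k (p ^ (k * B)) (\<lambda>x. norm (exp_sum k (p ^ (k * B)) P co S x) ^ (2 * tri k))
     \<le> K * (\<Sum>r\<in>{0..<p ^ B}. lam r) ^ (tri k - 1) *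
       (\<Sum>r\<in>{0..<p ^ B}. avg k (p ^ (k * B)) (\<lambda>x. norm (exp_sum k (p ^ (k * B)) P co (S \<inter> res_class p B r) x) ^ (2 * tri k)) / lam r ^ (tri k - 1))"
    (is "?lhs \<le> _")
proof -
  obtain n where n: "tri k = Suc n" using tri_pos[OF k] by (cases "tri k") auto
  define I where "I = {0..<p ^ B}"
  define E where "E = (\<lambda>r. avg k (p ^ (k * B)) (\<lambda>x. norm (exp_sum k (p ^ (k * B)) P co (S \<inter> res_class p B r) x) ^ (2 * tri k)))"
  have E0: "E r \<ge> 0" for r unfolding E_def using p by (intro avg_nonneg) auto
  have I: "finite I" "I \<noteq> {}" using p by (auto simp: I_def)
  have lam: "lam r > 0" if "r \<in> I" for r using lam that by (simp add: I_def)
  define L where "L = (\<Sum>r\<in>I. lam r)"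
  have L: "L > 0" unfolding L_def using I lam by (intro sum_pos) auto
  have main: "?lhs \<le> K * (L ^ n * (\<Sum>r\<in>I. E r / lam r ^ n)) + \<tau> * (K * L ^ Suc n)" if "\<tau> > 0" for \<tau>
  proof -
    \<comment> \<open>The best admissible bounds are the roots of \<open>E r\<close>, but these may
      vanish; the regularisation keeps them positive, and \<tau> is sent to zero at the end.\<close>
    define mu where "mu = (\<lambda>r. root (Suc n) (E r + \<tau> * lam r ^ Suc n))"
    have pos: "E r + \<tau> * lam r ^ Suc n > 0" if "r \<in> I" for r
      using E0[of r] lam[OF that] \<open>\<tau> > 0\<close> by (intro add_nonneg_pos mult_pos_pos) auto
    have mu: "mu r > 0" "mu r ^ Suc n = E r + \<tau> * lam r ^ Suc n" if "r \<in> I" for r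
      using pos[OF that] by (auto simp: mu_def simp del: power_Suc intro!: real_root_pow_pos)
    have "?lhs \<le> K * (\<Sum>r\<in>I. mu r) ^ Suc n"
      using D P S mu \<open>\<tau> > 0\<close> lam unfolding decoupling_bound_def I_def[symmetric] E_def n
      by (auto simp del: power_Suc simp: less_imp_le)
    also have "\<dots> \<le> K * (L ^ n * (\<Sum>r\<in>I. mu r ^ Suc n / lam r ^ n))"
      unfolding L_def using I lam mu K
      by (intro mult_left_mono power_sum_le_weighted) (auto simp: less_imp_le)
    also have "(\<Sum>r\<in>I. mu r ^ Suc n / lam r ^ n) = (\<Sum>r\<in>I. E r / lam r ^ n + \<tau> * lam r)"
    proof (intro sum.cong refl)
      fix r assume r: "r \<in> I"
      show "mu r ^ Suc n / lam r ^ n = E r / lam r ^ n + \<tau> * lam r"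
        unfolding mu(2)[OF r] using lam[OF r] by (simp add: field_simps)
    qed
    also have "\<dots> = (\<Sum>r\<in>I. E r / lam r ^ n) + \<tau> * L"
      by (simp add: sum.distrib L_def flip: sum_distrib_left)
    finally show ?thesis by (simp add: algebra_simps)
  qed
  have nn: "K * L ^ Suc n \<ge> 0" using K L by simp
  have "?lhs \<le> K * (L ^ n * (\<Sum>r\<in>I. E r / lam r ^ n)) + \<epsilon>" if "\<epsilon> > 0" for \<epsilon>
  proof -
    have "\<epsilon> / (K * L ^ Suc n + 1) * (K * L ^ Suc n) \<le> \<epsilon>"
      using nn that by (simp add: field_simps del: power_Suc)
    moreover have "\<epsilon> / (K * L ^ Suc n + 1) > 0" using nn that by (simp del: power_Suc)
    ultimately show ?thesis using main[of "\<epsilon> / (K * L ^ Suc n + 1)"] by linarith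
  qed
  then have "?lhs \<le> K * (L ^ n * (\<Sum>r\<in>I. E r / lam r ^ n))" by (rule field_le_epsilon)
  then show ?thesis by (simp add: n L_def I_def E_def mult.assoc)
qed

lemma bij_subclasses:
  assumes p: "(p::int) > 1"
  shows "bij_betw (\<lambda>v. (c + p ^ a * v) mod p ^ (a + b)) {0..<p ^ b} (subclasses p a (a + b) c)"
proof -
  have d: "p ^ a dvd p ^ (a + b)" by (simp add: power_add)
  have inj: "inj_on (\<lambda>v. (c + p ^ a * v) mod p ^ (a + b)) {0..<p ^ b}"
  proof (rule inj_onI)
    fix v v' assume v: "v \<in> {0..<p ^ b}" "v' \<in> {0..<p ^ b}"
      "(c + p ^ a * v) mod p ^ (a + b) = (c + p ^ a * v') mod p ^ (a + b)"
    then have "p ^ a * p ^ b dvd p ^ a * (v - v')"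
      by (simp add: mod_eq_dvd_iff power_add algebra_simps)
    then have "p ^ b dvd v - v'" using p by (subst (asm) dvd_mult_cancel_left) auto
    then have "v mod p ^ b = v' mod p ^ b" by (simp add: mod_eq_dvd_iff)
    then show "v = v'" using v by simp
  qed
  moreover have "(\<lambda>v. (c + p ^ a * v) mod p ^ (a + b)) ` {0..<p ^ b} = subclasses p a (a + b) c"
  proof (intro equalityI subsetI)
    fix r assume "r \<in> (\<lambda>v. (c + p ^ a * v) mod p ^ (a + b)) ` {0..<p ^ b}"
    then obtain v where "r = (c + p ^ a * v) mod p ^ (a + b)" by blast
    then show "r \<in> subclasses p a (a + b) c"
      using p d by (auto simp: subclasses_def cong_def mod_mod_cancel)
  next
    fix r assume r: "r \<in> subclasses p a (a + b) c"
    then obtain t where t: "r = c + p ^ a * t" using cong_int_lin by (force simp: subclasses_def)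
    have "(c + p ^ a * (t mod p ^ b)) mod p ^ (a + b) = r mod p ^ (a + b)"
      unfolding t mod_eq_dvd_iff
    proof -
      have "c + p ^ a * (t mod p ^ b) - (c + p ^ a * t) = p ^ a * (t mod p ^ b - t)" by (simp add: algebra_simps)
      moreover have "p ^ b dvd t mod p ^ b - t" by (simp add: mod_eq_dvd_iff[symmetric])
      ultimately show "p ^ (a + b) dvd c + p ^ a * (t mod p ^ b) - (c + p ^ a * t)"
        by (simp only: power_add mult_dvd_mono dvd_refl)
    qed
    also have "\<dots> = r" using r by (auto simp: subclasses_def)
    finally show "r \<in> (\<lambda>v. (c + p ^ a * v) mod p ^ (a + b)) ` {0..<p ^ b}"
      using p by (intro image_eqI[of _ _ "t mod p ^ b"]) auto
  qed
  ultimately show ?thesis by (simp add: bij_betw_def)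
qed

text \<open>On the fibre through \<open>x\<close> spanned by the vectors \<open>w j\<close>, the
  phase at \<open>n = c + p^a u\<close> splits into a factor independent of \<open>u\<close>, the
  phase of the projected curve in \<open>z\<close>, and the phase at \<open>x\<close>. The first has
  modulus one and the last is absorbed into the coefficients. The common factor
  \<open>p^(M-m)\<close> leaves only \<open>z\<close> modulo \<open>p^m\<close> visible; for
  \<open>m = 0\<close> the modulus of the sum is therefore constant on the fibre.\<close>

lemma norm_exp_sum_restrict:
  fixes p :: int
  assumes p: "p > 1" and m: "m \<le> M"
    and w: "\<And>j u. j \<in> {1..l} \<Longrightarrow>
       [(\<Sum>i=1..k. w j i * (poly (P i) (c + p ^ a * u) - poly (P i) c)) = p ^ (M - m) * poly (P' j) u] (mod p ^ M)"
    and T: "T \<subseteq> res_class p a c"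
  shows "norm (exp_sum k (p ^ M) P co T (\<lambda>i. x i + (\<Sum>j=1..l. z j * w j i))) =
     norm (exp_sum l (p ^ m) P' (\<lambda>u. co (c + p ^ a * u) * add_char (p ^ M) (\<Sum>i=1..k. x i * poly (P i) (c + p ^ a * u)))
        {u. c + p ^ a * u \<in> T} z)"
proof -
  let ?Q = "p ^ M" and ?n = "\<lambda>u. c + p ^ a * u"
  define h where "h = (\<lambda>i. \<Sum>j=1..l. z j * w j i)"
  have Q0: "?Q \<noteq> 0" using p by simp
  have img: "T = ?n ` {u. ?n u \<in> T}"
  proof (intro equalityI subsetI)
    fix n assume n: "n \<in> T"
    then obtain u where "n = c + p ^ a * u" using T cong_int_lin by (force simp: res_class_def)
    with n show "n \<in> ?n ` {u. ?n u \<in> T}" by auto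
  qed auto
  have inj: "inj_on ?n X" for X using p by (auto simp: inj_on_def)
  have key: "add_char ?Q (\<Sum>i=1..k. h i * poly (P i) (?n u))
     = add_char ?Q (\<Sum>i=1..k. h i * poly (P i) c) * add_char (p ^ m) (\<Sum>j=1..l. z j * poly (P' j) u)" for u
  proof -
    have "(\<Sum>i=1..k. h i * (poly (P i) (?n u) - poly (P i) c))
        = (\<Sum>j=1..l. z j * (\<Sum>i=1..k. w j i * (poly (P i) (?n u) - poly (P i) c)))"
      unfolding h_def sum_distrib_right sum_distrib_left by (subst sum.swap) (simp add: mult.assoc)
    also have "[\<dots> = (\<Sum>j=1..l. z j * (p ^ (M - m) * poly (P' j) u))] (mod ?Q)"
      using w by (intro cong_sum cong_mult cong_refl) auto
    also have "(\<Sum>j=1..l. z j * (p ^ (M - m) * poly (P' j) u)) = p ^ (M - m) * (\<Sum>j=1..l. z j * poly (P' j) u)"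
      by (simp add: sum_distrib_left algebra_simps)
    finally have "add_char ?Q (\<Sum>i=1..k. h i * (poly (P i) (?n u) - poly (P i) c))
        = add_char (p ^ (M - m) * p ^ m) (p ^ (M - m) * (\<Sum>j=1..l. z j * poly (P' j) u))"
      using m by (subst add_char_cong[OF _ Q0]) (auto simp flip: power_add)
    also have "\<dots> = add_char (p ^ m) (\<Sum>j=1..l. z j * poly (P' j) u)"
      using p by (intro add_char_cancel) auto
    finally have *: "add_char ?Q (\<Sum>i=1..k. h i * (poly (P i) (?n u) - poly (P i) c)) = add_char (p ^ m) (\<Sum>j=1..l. z j * poly (P' j) u)" .
    have "(\<Sum>i=1..k. h i * poly (P i) (?n u)) = (\<Sum>i=1..k. h i * poly (P i) c) + (\<Sum>i=1..k. h i * (poly (P i) (?n u) - poly (P i) c))"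
      by (simp add: algebra_simps flip: sum.distrib)
    then show ?thesis by (simp only: add_char_add *)
  qed
  have "exp_sum k ?Q P co T (\<lambda>i. x i + h i) = (\<Sum>n\<in>?n ` {u. ?n u \<in> T}. co n * add_char ?Q (\<Sum>i=1..k. (x i + h i) * poly (P i) n))"
    unfolding exp_sum_def using img by simp
  also have "\<dots> = (\<Sum>u\<in>{u. ?n u \<in> T}. co (?n u) * add_char ?Q (\<Sum>i=1..k. (x i + h i) * poly (P i) (?n u)))"
    by (subst sum.reindex[OF inj]) simp
  also have "\<dots> = add_char ?Q (\<Sum>i=1..k. h i * poly (P i) c) *
      exp_sum l (p ^ m) P' (\<lambda>u. co (?n u) * add_char ?Q (\<Sum>i=1..k. x i * poly (P i) (?n u))) {u. ?n u \<in> T} z"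
    unfolding exp_sum_def sum_distrib_left
    by (intro sum.cong refl, simp only: distrib_right sum.distrib add_char_add key) (simp only: mult_ac)
  finally show ?thesis by (simp add: norm_mult h_def)
qed

lemma res_class_subset: assumes "a \<le> b" "[r = c] (mod p ^ a)" shows "res_class p b r \<subseteq> res_class p a c"
  unfolding res_class_def using assms by (auto intro: cong_trans cong_dvd_modulus le_imp_power_dvd)

text \<open>Decoupling in dimension \<open>l\<close> holds on every fibre separately. The weight
  \<open>g\<close> is constant on fibres, hence comes out of the inner average, and the averages
  over the fibres recombine to the full one. It is the linear form of the bound that can be
  multiplied by \<open>g\<close> and averaged.\<close>

lemma decoupling_bound_transfer:
  fixes p :: int and g :: "(nat \<Rightarrow> int) \<Rightarrow> real"
  assumes D: "decoupling_bound p l b K" and p: "p > 1" and l: "l \<ge> 1" and K: "K \<ge> 0"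
    and P': "moment_like p l P'" and S: "finite S" and m: "l * b \<le> M"
    and w: "\<And>j u. j \<in> {1..l} \<Longrightarrow>
       [(\<Sum>i=1..k. w j i * (poly (P i) (c + p ^ a * u) - poly (P i) c)) = p ^ (M - l * b) * poly (P' j) u] (mod p ^ M)"
    and g0: "\<And>x. g x \<ge> 0" and gper: "periodic k (p ^ M) g"
    and ginv: "\<And>x z. g (\<lambda>i. x i + (\<Sum>j=1..l. z j * w j i)) = g x"
    and lam: "\<And>r. r \<in> subclasses p a (a + b) c \<Longrightarrow> lam r > 0"
  shows "avg k (p ^ M) (\<lambda>x. g x * norm (exp_sum k (p ^ M) P co (S \<inter> res_class p a c) x) ^ (2 * tri l))
    \<le> K * (\<Sum>r\<in>subclasses p a (a + b) c. lam r) ^ (tri l - 1) *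
      (\<Sum>r\<in>subclasses p a (a + b) c. avg k (p ^ M) (\<lambda>x. g x * norm (exp_sum k (p ^ M) P co (S \<inter> res_class p (a + b) r) x) ^ (2 * tri l)) / lam r ^ (tri l - 1))"
proof -
  let ?Q = "p ^ M" and ?q = "p ^ (l * b)" and ?n = "\<lambda>u. c + p ^ a * u" and ?s = "2 * tri l"
  let ?\<rho> = "\<lambda>v. (c + p ^ a * v) mod p ^ (a + b)"
  have Q: "?Q > 0" and q: "?q > 0" using p by auto
  define h where "h = (\<lambda>z i. \<Sum>j=1..l. z j * w j i)"
  define F where "F = (\<lambda>T x. norm (exp_sum k ?Q P co T x) ^ ?s)"
  define lam' where "lam' = (\<lambda>v. lam (?\<rho> v))"
  define S' where "S' = {u. ?n u \<in> S \<inter> res_class p a c}"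
  note bij = bij_subclasses[OF p, of c a b]
  have inj: "inj ?n" using p by (auto simp: inj_on_def)
  have finS': "finite S'" unfolding S'_def
    using finite_vimageI[OF _ inj, of "S \<inter> res_class p a c"] S by (simp add: vimage_def)
  have sub: "res_class p (a + b) r \<subseteq> res_class p a c" if "r \<in> subclasses p a (a + b) c" for r
    using that by (intro res_class_subset) (auto simp: subclasses_def)
  have S'cl: "S' \<inter> res_class p b v = {u. ?n u \<in> S \<inter> res_class p (a + b) (?\<rho> v)}" if v: "v \<in> {0..<p ^ b}" for v
  proof -
    have "?\<rho> v \<in> subclasses p a (a + b) c" using bij_betwE[OF bij] v by blast
    note sub[OF this]
    moreover have "?n u \<in> res_class p (a + b) (?\<rho> v) \<longleftrightarrow> u \<in> res_class p b v" for u
    proof -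
      have "?n u - ?n v = p ^ a * (u - v)" by (simp add: algebra_simps)
      then have "[?n u = ?n v] (mod p ^ (a + b)) \<longleftrightarrow> p ^ b dvd u - v"
        using p by (simp add: cong_iff_dvd_diff power_add)
      then show ?thesis by (simp add: res_class_def cong_iff_dvd_diff[symmetric])
    qed
    ultimately show ?thesis by (auto simp: S'_def)
  qed
  have local: "avg l ?q (\<lambda>z. F (S \<inter> res_class p a c) (\<lambda>i. x i + h z i)) \<le>
     K * (\<Sum>r\<in>subclasses p a (a + b) c. lam r) ^ (tri l - 1) *
      (\<Sum>r\<in>subclasses p a (a + b) c. avg l ?q (\<lambda>z. F (S \<inter> res_class p (a + b) r) (\<lambda>i. x i + h z i)) / lam r ^ (tri l - 1))" for x
  proof -
    define cx where "cx = (\<lambda>u. co (?n u) * add_char ?Q (\<Sum>i=1..k. x i * poly (P i) (?n u)))"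
    have tri: "norm (exp_sum l ?q P' cx {u. ?n u \<in> T} z) ^ ?s = F T (\<lambda>i. x i + h z i)" if "T \<subseteq> res_class p a c" for T z
      unfolding F_def h_def cx_def using norm_exp_sum_restrict[where P = P and x = x, OF p m w that] by simp
    have "avg l ?q (\<lambda>z. norm (exp_sum l ?q P' cx S' z) ^ ?s) \<le>
       K * (\<Sum>v\<in>{0..<p ^ b}. lam' v) ^ (tri l - 1) *
       (\<Sum>v\<in>{0..<p ^ b}. avg l ?q (\<lambda>z. norm (exp_sum l ?q P' cx (S' \<inter> res_class p b v) z) ^ ?s) / lam' v ^ (tri l - 1))"
      using bij_betwE[OF bij] lam by (intro decoupling_bound_linear D p l K P' finS') (auto simp: lam'_def)
    also have "(\<Sum>v\<in>{0..<p ^ b}. lam' v) = (\<Sum>r\<in>subclasses p a (a + b) c. lam r)"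
      unfolding lam'_def by (rule sum.reindex_bij_betw[OF bij])
    also have "(\<Sum>v\<in>{0..<p ^ b}. avg l ?q (\<lambda>z. norm (exp_sum l ?q P' cx (S' \<inter> res_class p b v) z) ^ ?s) / lam' v ^ (tri l - 1))
       = (\<Sum>v\<in>{0..<p ^ b}. avg l ?q (\<lambda>z. F (S \<inter> res_class p (a + b) (?\<rho> v)) (\<lambda>i. x i + h z i)) / lam (?\<rho> v) ^ (tri l - 1))"
    proof (intro sum.cong refl)
      fix v assume v: "v \<in> {0..<p ^ b}"
      have "S \<inter> res_class p (a + b) (?\<rho> v) \<subseteq> res_class p a c"
        using sub bij_betwE[OF bij] v by blast
      then show "avg l ?q (\<lambda>z. norm (exp_sum l ?q P' cx (S' \<inter> res_class p b v) z) ^ ?s) / lam' v ^ (tri l - 1)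
         = avg l ?q (\<lambda>z. F (S \<inter> res_class p (a + b) (?\<rho> v)) (\<lambda>i. x i + h z i)) / lam (?\<rho> v) ^ (tri l - 1)"
        unfolding S'cl[OF v] lam'_def by (simp only: tri)
    qed
    also have "\<dots> = (\<Sum>r\<in>subclasses p a (a + b) c. avg l ?q (\<lambda>z. F (S \<inter> res_class p (a + b) r) (\<lambda>i. x i + h z i)) / lam r ^ (tri l - 1))"
      by (rule sum.reindex_bij_betw[OF bij])
    finally show ?thesis unfolding S'_def using tri[of "S \<inter> res_class p a c"] by simp
  qed
  have avg: "avg k ?Q (\<lambda>x. g x * F T x) = avg k ?Q (\<lambda>x. g x * avg l ?q (\<lambda>z. F T (\<lambda>i. x i + h z i)))" for T
  proof -
    have "periodic k ?Q (\<lambda>x. g x * F T x)"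
      unfolding F_def using periodic_comp2[OF gper periodic_exp_sum[OF Q], of "\<lambda>a b. a * norm b ^ ?s"] .
    then have "avg k ?Q (\<lambda>x. g x * F T x) = avg k ?Q (\<lambda>x. avg l ?q (\<lambda>z. g (\<lambda>i. x i + h z i) * F T (\<lambda>i. x i + h z i)))"
      by (rule avg_average[OF _ Q q])
    also have "\<dots> = avg k ?Q (\<lambda>x. g x * avg l ?q (\<lambda>z. F T (\<lambda>i. x i + h z i)))"
      using ginv unfolding h_def by (simp add: avg_cmult)
    finally show ?thesis .
  qed
  have "avg k ?Q (\<lambda>x. g x * F (S \<inter> res_class p a c) x) \<le> avg k ?Q (\<lambda>x. K * (\<Sum>r\<in>subclasses p a (a + b) c. lam r) ^ (tri l - 1) *
      (\<Sum>r\<in>subclasses p a (a + b) c. (g x * avg l ?q (\<lambda>z. F (S \<inter> res_class p (a + b) r) (\<lambda>i. x i + h z i))) / lam r ^ (tri l - 1)))"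
    unfolding avg
  proof (intro avg_mono Q)
    fix x
    show "g x * avg l ?q (\<lambda>z. F (S \<inter> res_class p a c) (\<lambda>i. x i + h z i)) \<le>
       K * (\<Sum>r\<in>subclasses p a (a + b) c. lam r) ^ (tri l - 1) *
      (\<Sum>r\<in>subclasses p a (a + b) c. (g x * avg l ?q (\<lambda>z. F (S \<inter> res_class p (a + b) r) (\<lambda>i. x i + h z i))) / lam r ^ (tri l - 1))"
      using mult_left_mono[OF local g0, of x x] by (simp add: sum_distrib_left algebra_simps)
  qed
  also have "\<dots> = K * (\<Sum>r\<in>subclasses p a (a + b) c. lam r) ^ (tri l - 1) *
      (\<Sum>r\<in>subclasses p a (a + b) c. avg k ?Q (\<lambda>x. g x * F (S \<inter> res_class p (a + b) r) x) / lam r ^ (tri l - 1))"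
    unfolding avg by (simp only: avg_cmult avg_sum avg_cdiv)
  finally show ?thesis unfolding F_def .
qed

section \<open>Bilinear estimates\<close>

text \<open>The exponents balance in Hoelder's inequality: the pair
  \<open>(tri l, tri k - tri l)\<close> is the mean, with weights \<open>1/(k-l+1)\<close> and
  \<open>(k-l)/(k-l+1)\<close>, of the pair for \<open>k - l\<close> with the two factors exchanged
  and of the pair for \<open>l - 1\<close>.\<close>

lemma tri_diff_identity:
  assumes "1 \<le> l" "l < k"
  shows "Suc (k - l) * tri l = (tri k - tri (k - l)) + (k - l) * tri (l - 1)"
    and "Suc (k - l) * (tri k - tri l) = tri (k - l) + (k - l) * (tri k - tri (l - 1))"
proof -
  obtain m l' where k: "k = Suc l' + m" and l: "l = Suc l'" using assms
    by (metis One_nat_def Suc_le_D le_add_diff_inverse less_imp_le)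
  have m: "k - l = m" and l': "l - 1 = l'" using k l by auto
  have T: "int (tri n) * 2 = int n * (int n + 1)" for n using arg_cong[OF tri_2[of n], of int] by (simp add: algebra_simps)
  have le: "tri m \<le> tri k" "tri l \<le> tri k" "tri l' \<le> tri k" using k l by (auto intro: tri_mono)
  have "2 * (int (Suc m) * int (tri l)) = 2 * (int (tri k) - int (tri m) + int m * int (tri l'))"
    using T[of l] T[of k] T[of m] T[of l'] unfolding k l by simp algebra
  then have "2 * int (Suc m * tri l) = 2 * int ((tri k - tri m) + m * tri l')"
    using le by (simp only: of_nat_mult of_nat_add of_nat_diff)
  then show "Suc (k - l) * tri l = (tri k - tri (k - l)) + (k - l) * tri (l - 1)" unfolding m l' by (metis mult_cancel_left of_nat_eq_iff zero_neq_numeral)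
  have "2 * (int (Suc m) * (int (tri k) - int (tri l))) = 2 * (int (tri m) + int m * (int (tri k) - int (tri l')))"
    using T[of l] T[of k] T[of m] T[of l'] unfolding k l by simp algebra
  then have "2 * int (Suc m * (tri k - tri l)) = 2 * int (tri m + m * (tri k - tri l'))"
    using le by (simp only: of_nat_mult of_nat_add of_nat_diff)
  then show "Suc (k - l) * (tri k - tri l) = tri (k - l) + (k - l) * (tri k - tri (l - 1))" unfolding m l' by (metis mult_cancel_left of_nat_eq_iff zero_neq_numeral)
qed

text \<open>Hoelder's inequality in pointwise form. If the averages of \<open>x\<close> and
  \<open>y\<close> are at most \<open>K1\<close> and \<open>K2\<close>, averaging the conclusion
  bounds the average of \<open>F\<close> by their weighted geometric mean \<open>K\<close>.\<close>

lemma weighted_am_gm: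
  fixes F x y K K1 K2 :: real
  assumes "F \<ge> 0" "x \<ge> 0" "y \<ge> 0" "K > 0" "K1 > 0" "K2 > 0" "m \<ge> 1"
    and F: "F ^ Suc m = x * y ^ m" and K: "K ^ Suc m = K1 * K2 ^ m"
  shows "F \<le> K * ((1 / Suc m) * (x / K1) + (m / Suc m) * (y / K2))"
proof (cases "x = 0 \<or> y = 0")
  case True
  then have "F ^ Suc m = 0" using F assms(7) by auto
  then have "F = 0" by auto
  then show ?thesis using assms by simp
next
  case False
  define A where "A = x / K1"
  define C where "C = y / K2"
  have AC: "A > 0" "C > 0" using False assms by (auto simp: A_def C_def)
  define G where "G = A powr (1 / Suc m) * C powr (m / Suc m)"
  have "G ^ Suc m = A * C ^ m"
  proof -
    have "G ^ Suc m = (A powr (1 / Suc m)) ^ Suc m * (C powr (m / Suc m)) ^ Suc m"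
      unfolding G_def by (rule power_mult_distrib)
    also have "(A powr (1 / Suc m)) ^ Suc m = A"
      using AC by (simp only: powr_powr powr_realpow[symmetric] powr_gt_zero) simp
    also have "(C powr (m / Suc m)) ^ Suc m = C ^ m"
      using AC by (subst powr_realpow[symmetric]) (auto simp: powr_powr powr_realpow simp del: of_nat_Suc power_Suc)
    finally show ?thesis .
  qed
  also have "\<dots> = (F / K) ^ Suc m"
    using F K by (simp add: A_def C_def power_divide del: power_Suc)
  finally have "G = F / K"
    using assms AC by (intro power_eq_imp_eq_base[of G "Suc m" "F / K"]) (auto simp: G_def)
  moreover have "G \<le> (1 / Suc m) * A + (m / Suc m) * C"
    unfolding G_def using AC by (intro Youngs_inequality_0) (auto simp: field_simps)
  ultimately have "F / K \<le> (1 / Suc m) * A + (m / Suc m) * C" by simp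
  then show ?thesis using assms(4) by (simp add: A_def C_def pos_divide_le_eq mult.commute)
qed

text \<open>Fixes one sum to be decoupled at scale \<open>B\<close>. The bilinear estimates compare
  its restrictions to classes at all coarser scales; the weights on the finest classes determine
  those on the coarser ones by addition.\<close>

locale curve_sum =
  fixes p :: int and k B :: nat and P :: "nat \<Rightarrow> int poly" and co :: "int \<Rightarrow> complex" and S :: "int set"
    and mu :: "int \<Rightarrow> real"
  assumes p: "prime p" "int k < p" and k: "k \<ge> 2" and P: "moment_like p k P" and S: "finite S"
    and mu: "\<And>r. r \<in> {0..<p ^ B} \<Longrightarrow> mu r > 0"
    and bd: "\<And>r. r \<in> {0..<p ^ B} \<Longrightarrow>
      avg k (p ^ (k * B)) (\<lambda>x. norm (exp_sum k (p ^ (k * B)) P co (S \<inter> res_class p B r) x) ^ (2 * tri k)) \<le> mu r ^ tri k"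
begin

definition Y :: "nat \<Rightarrow> int \<Rightarrow> (nat \<Rightarrow> int) \<Rightarrow> real" where
  "Y a c x = (norm (exp_sum k (p ^ (k * B)) P co (S \<inter> res_class p a c) x))\<^sup>2"

definition U :: "nat \<Rightarrow> int \<Rightarrow> real" where
  "U a c = (\<Sum>r\<in>subclasses p a B c. mu r)"

abbreviation E :: "((nat \<Rightarrow> int) \<Rightarrow> real) \<Rightarrow> real" where
  "E \<equiv> avg k (p ^ (k * B))"

text \<open>The classes are distinct modulo \<open>p\<close>, which is transversality, but their
  scales \<open>a\<close> and \<open>b\<close> are independent and the exponents are unequal. Since
  these add up to \<open>tri k\<close>, the constant is directly comparable with a decoupling
  constant.\<close>

definition bilinear_bound :: "nat \<Rightarrow> nat \<Rightarrow> nat \<Rightarrow> real \<Rightarrow> bool" where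
  "bilinear_bound l a b K \<longleftrightarrow> (\<forall>c c'. \<not> [c = c'] (mod p) \<longrightarrow>
     E (\<lambda>x. (Y a c x / U a c) ^ tri l * (Y b c' x / U b c') ^ (tri k - tri l)) \<le> K)"

lemma p1: "p > 1" using p prime_gt_1_int by blast

lemma Q0: "p ^ M > 0" using p1 by simp

lemma trk: "tri k \<ge> 1" using k by (intro tri_pos) auto

lemma Y_nonneg [simp]: "Y a c x \<ge> 0" by (simp add: Y_def)

lemma Y_power: "Y a c x ^ n = norm (exp_sum k (p ^ (k * B)) P co (S \<inter> res_class p a c) x) ^ (2 * n)"
  by (simp add: Y_def power_mult)

lemma U_pos: "a \<le> B \<Longrightarrow> U a c > 0"
  unfolding U_def using subclasses_nonempty[OF p1, of a B c] by (intro sum_pos mu finite_subclasses) (auto simp: subclasses_def)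

lemma U_nest: "a \<le> a' \<Longrightarrow> a' \<le> B \<Longrightarrow> (\<Sum>r\<in>subclasses p a a' c. U a' r) = U a c"
  unfolding U_def by (rule sum_subclasses_nest[OF p1])

text \<open>The projections scale like \<open>p^(aj)\<close>, differently for each \<open>j\<close>.
  Multiplying the \<open>j\<close>-th one by the missing power gives all of them the factor
  \<open>p^(M-m)\<close> that restriction to fibres asks for; there is room for it when
  \<open>m + a * l \<le> M\<close>.\<close>

lemma scaled_weights:
  assumes "int j \<le> int l" "m + a * l \<le> M"
    and "[(\<Sum>i=1..k. w i * g i) = p ^ (a * j) * t] (mod p ^ M)"
  shows "[(\<Sum>i=1..k. (p ^ (M - m - a * j) * w i) * g i) = p ^ (M - m) * t] (mod p ^ M)"
proof -
  have "a * j \<le> a * l" using assms by simp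
  then have "a * j \<le> M - m" using assms(2) by linarith
  then have "M - m - a * j + a * j = M - m" by simp
  then have eq: "p ^ (M - m - a * j) * (p ^ (a * j) * t) = p ^ (M - m) * t"
    by (simp only: mult.assoc[symmetric] power_add[symmetric])
  show ?thesis
    using cong_mult[OF cong_refl assms(3), of "p ^ (M - m - a * j)"] unfolding eq
    by (simp add: sum_distrib_left mult.assoc)
qed

text \<open>Affine invariance: the class \<open>c\<close> modulo \<open>p^a\<close> is again a full
  sum along a nondegenerate curve, with only \<open>B - a\<close> scales left. This is the
  projection with \<open>l = k\<close>; its second class \<open>c + 1\<close> is auxiliary, since
  \<open>b = 0\<close> imposes no condition there.\<close>

lemma rescale:
  assumes D: "decoupling_bound p k (B - a) K" and K: "K \<ge> 0" and a: "a \<le> B"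
  shows "E (\<lambda>x. Y a c x ^ tri k) \<le> K * U a c ^ tri k"
proof (cases "a = 0")
  case True
  then show ?thesis using D P S mu bd unfolding decoupling_bound_def Y_power U_def by simp
next
  case False
  define M where "M = k * B"
  obtain n where n: "tri k = Suc n" using trk by (cases "tri k") auto
  have nc: "\<not> [c = c + 1] (mod p)" using p1 by (auto simp: cong_iff_dvd_diff)
  have k1: "1 \<le> k" and a1: "a \<ge> 1" and M0: "(k - k + 1) * 0 \<le> M" using k False by auto
  obtain w P' where P': "moment_like p k P'" and
    w: "\<And>j u. j \<in> {1..k} \<Longrightarrow> [(\<Sum>i=1..k. w j i * (poly (P i) (c + p ^ a * u) - poly (P i) c))
                      = p ^ (a * j) * poly (P' j) u] (mod p ^ M)"
    using curve_project[OF p nc k1 order_refl a1 P M0] by blast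
  define w' where "w' = (\<lambda>j i. p ^ (M - k * (B - a) - a * j) * w j i)"
  have w': "[(\<Sum>i=1..k. w' j i * (poly (P i) (c + p ^ a * u) - poly (P i) c))
          = p ^ (M - k * (B - a)) * poly (P' j) u] (mod p ^ M)" if "j \<in> {1..k}" for j u
  proof -
    have "k * (B - a) + a * k \<le> M" using a by (simp add: M_def mult.commute[of a] flip: distrib_left)
    then show ?thesis
      unfolding w'_def using that w[OF that, of u] by (intro scaled_weights[where l = k]) auto
  qed
  have aB: "a + (B - a) = B" using a by simp
  have "E (\<lambda>x. 1 * norm (exp_sum k (p ^ M) P co (S \<inter> res_class p a c) x) ^ (2 * tri k))
    \<le> K * (\<Sum>r\<in>subclasses p a (a + (B - a)) c. mu r) ^ (tri k - 1) *
      (\<Sum>r\<in>subclasses p a (a + (B - a)) c. E (\<lambda>x. 1 * norm (exp_sum k (p ^ M) P co (S \<inter> res_class p (a + (B - a)) r) x) ^ (2 * tri k)) / mu r ^ (tri k - 1))"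
    unfolding M_def[symmetric] using k mu
    by (intro decoupling_bound_transfer[where w = w' and P' = P'] D p1 K P' S w') (auto simp: M_def periodic_def aB subclasses_def)
  then have "E (\<lambda>x. Y a c x ^ tri k) \<le> K * U a c ^ n * (\<Sum>r\<in>subclasses p a B c. E (\<lambda>x. Y B r x ^ tri k) / mu r ^ n)"
    unfolding aB Y_power by (simp add: M_def U_def n)
  also have "\<dots> \<le> K * U a c ^ n * (\<Sum>r\<in>subclasses p a B c. mu r)"
  proof (intro mult_left_mono sum_mono)
    fix r assume "r \<in> subclasses p a B c"
    then have r: "r \<in> {0..<p ^ B}" by (auto simp: subclasses_def)
    have "E (\<lambda>x. Y B r x ^ tri k) \<le> mu r ^ Suc n" using bd[OF r] unfolding Y_power n .
    then show "E (\<lambda>x. Y B r x ^ tri k) / mu r ^ n \<le> mu r"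
      using mu[OF r] by (simp add: pos_divide_le_eq)
  qed (use K U_pos[OF a, of c] in simp)
  also have "\<dots> = K * U a c ^ tri k" by (simp add: n U_def)
  finally show ?thesis .
qed

text \<open>The sum over the class \<open>c'\<close> is invariant under the translations along which the curve near
  \<open>c\<close> projects to a nondegenerate curve in dimension \<open>l\<close>.\<close>

lemma lower_decoupling:
  assumes D: "decoupling_bound p l B' K1" and K1: "K1 \<ge> 0" and l: "1 \<le> l" "l < k" and a: "a \<ge> 1"
    and ab: "l * (a + B') \<le> (k - l + 1) * b" and aB: "a + B' \<le> B" and b: "b \<le> B"
    and bilinear_bound: "bilinear_bound l (a + B') b K"
  shows "bilinear_bound l a b (K1 * K)"
  unfolding bilinear_bound_def
proof (intro allI impI)
  fix c c' assume nc: "\<not> [c = c'] (mod p)"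
  define M where "M = k * B"
  define m where "m = l * B'"
  have kb: "(k - l + 1) * b \<le> M" unfolding M_def using l b by (intro mult_le_mono) auto
  have ml: "m + a * l \<le> (k - l + 1) * b" using ab by (simp add: m_def algebra_simps)
  obtain n where n: "tri l = Suc n" using tri_pos[OF l(1)] by (cases "tri l") auto
  obtain w P' where P': "moment_like p l P'" and
    w: "\<And>j u. j \<in> {1..l} \<Longrightarrow> [(\<Sum>i=1..k. w j i * (poly (P i) (c + p ^ a * u) - poly (P i) c))
                      = p ^ (a * j) * poly (P' j) u] (mod p ^ M)" and
    z: "\<And>j u. j \<in> {1..l} \<Longrightarrow> p ^ ((k - l + 1) * b) dvd
         (\<Sum>i=1..k. w j i * (poly (P i) (c' + p ^ b * u) - poly (P i) c'))"
    using curve_project[OF p nc l(1) less_imp_le[OF l(2)] a P kb] by blast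
  define w' where "w' = (\<lambda>j i. p ^ (M - m - a * j) * w j i)"
  have w': "[(\<Sum>i=1..k. w' j i * (poly (P i) (c + p ^ a * u) - poly (P i) c))
          = p ^ (M - m) * poly (P' j) u] (mod p ^ M)" if "j \<in> {1..l}" for j u
    unfolding w'_def using that w ml kb by (intro scaled_weights[where l = l]) auto
  \<comment> \<open>Here \<open>l * (a + B') \<le> (k - l + 1) * b\<close> enters: with the extra
    factor \<open>p^(M-m-aj)\<close>, where \<open>aj \<le> al\<close>, the variation of the
    projections on the class \<open>c'\<close> reaches \<open>p^M\<close>. So the factor at scale
    \<open>b\<close> does not change along the fibres.\<close>
  have z': "[(\<Sum>i=1..k. w' j i * (poly (P i) (c' + p ^ b * u) - poly (P i) c')) = p ^ (M - 0) * poly 0 u] (mod p ^ M)"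
    if j: "j \<in> {1..l}" for j u
  proof -
    have "a * j \<le> a * l" using j by simp
    then have "M \<le> (M - m - a * j) + (k - l + 1) * b" using ml by linarith
    then have "p ^ M dvd p ^ (M - m - a * j) * p ^ ((k - l + 1) * b)"
      by (simp only: power_add[symmetric] le_imp_power_dvd)
    also have "\<dots> dvd p ^ (M - m - a * j) * (\<Sum>i=1..k. w j i * (poly (P i) (c' + p ^ b * u) - poly (P i) c'))"
      by (intro mult_dvd_mono dvd_refl z j)
    also have "\<dots> = (\<Sum>i=1..k. w' j i * (poly (P i) (c' + p ^ b * u) - poly (P i) c'))"
      by (simp add: w'_def sum_distrib_left mult.assoc)
    finally show ?thesis by (simp add: cong_0_iff)
  qed
  define g where "g = (\<lambda>x. (Y b c' x / U b c') ^ (tri k - tri l))"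
  have inv: "Y b c' (\<lambda>i. x i + (\<Sum>j=1..l. z j * w' j i)) = Y b c' x" for x z
  proof -
    note R = norm_exp_sum_restrict[where M = M and m = 0 and w = w' and k = k and P = P and c = c' and a = b and P' = "\<lambda>_. 0" and l = l
       and T = "S \<inter> res_class p b c'" and co = co, OF p1 _ z']
    have "norm (exp_sum k (p ^ M) P co (S \<inter> res_class p b c') (\<lambda>i. x i + (\<Sum>j=1..l. z j * w' j i))) =
          norm (exp_sum k (p ^ M) P co (S \<inter> res_class p b c') (\<lambda>i. x i + (\<Sum>j=1..l. 0 * w' j i)))"
      using R[where x = x and z = z] R[where x = x and z = "\<lambda>_. 0"] by (simp add: exp_sum_def)
    then show ?thesis by (simp add: Y_def M_def)
  qed
  have ginv: "g (\<lambda>i. x i + (\<Sum>j=1..l. z j * w' j i)) = g x" for x z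
    unfolding g_def inv ..
  have g0: "g x \<ge> 0" for x using U_pos[OF b, of c'] by (simp add: g_def)
  have gper: "periodic k (p ^ M) g"
    unfolding g_def Y_def M_def
    by (rule periodic_comp[OF periodic_exp_sum[OF Q0], where F = "\<lambda>y. ((norm y)\<^sup>2 / U b c') ^ (tri k - tri l)"])
  define lam where "lam = (\<lambda>r. U (a + B') r)"
  define F where "F = (\<lambda>a c. E (\<lambda>x. g x * Y a c x ^ tri l))"
  have "F a c \<le> K1 * (\<Sum>r\<in>subclasses p a (a + B') c. lam r) ^ (tri l - 1) *
      (\<Sum>r\<in>subclasses p a (a + B') c. F (a + B') r / lam r ^ (tri l - 1))"
    unfolding F_def Y_power M_def[symmetric] using ml kb U_pos[OF aB]
    by (intro decoupling_bound_transfer[where w = w' and P' = P'] D p1 K1 P' S g0 gper l w'[unfolded m_def] ginv)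
       (auto simp: m_def lam_def)
  also have "(\<Sum>r\<in>subclasses p a (a + B') c. lam r) = U a c" unfolding lam_def using aB by (intro U_nest) auto
  also have "K1 * U a c ^ (tri l - 1) * (\<Sum>r\<in>subclasses p a (a + B') c. F (a + B') r / lam r ^ (tri l - 1))
      \<le> K1 * U a c ^ (tri l - 1) * (\<Sum>r\<in>subclasses p a (a + B') c. K * lam r)"
  proof (intro mult_left_mono sum_mono)
    fix r assume "r \<in> subclasses p a (a + B') c"
    then have "[r = c] (mod p ^ a)" by (auto simp: subclasses_def)
    then have "[r = c] (mod p)" using a by (metis cong_dvd_modulus dvd_power less_le_trans zero_less_one)
    then have "\<not> [r = c'] (mod p)" using nc by (meson cong_sym cong_trans)
    then have "E (\<lambda>x. (Y (a + B') r x / U (a + B') r) ^ tri l * g x) \<le> K"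
      using bilinear_bound unfolding bilinear_bound_def g_def by blast
    moreover have "E (\<lambda>x. (Y (a + B') r x / U (a + B') r) ^ tri l * g x) = F (a + B') r / lam r ^ tri l"
      unfolding F_def lam_def by (simp add: power_divide mult.commute flip: avg_cdiv)
    ultimately have "F (a + B') r \<le> K * lam r ^ Suc n"
      using U_pos[OF aB, of r] by (simp add: pos_divide_le_eq lam_def n)
    then show "F (a + B') r / lam r ^ (tri l - 1) \<le> K * lam r"
      using U_pos[OF aB, of r] by (simp add: pos_divide_le_eq lam_def n mult.assoc)
  qed (use K1 U_pos[of a c] aB in simp)
  also have "(\<Sum>r\<in>subclasses p a (a + B') c. K * lam r) = K * U a c"
    unfolding lam_def using U_nest[of a "a + B'" c] aB by (simp flip: sum_distrib_left)
  finally have "F a c \<le> (K1 * K) * U a c ^ tri l" by (simp add: n algebra_simps)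
  then have "F a c / U a c ^ tri l \<le> K1 * K"
    using U_pos[of a c] aB by (simp add: pos_divide_le_eq)
  then show "E (\<lambda>x. (Y a c x / U a c) ^ tri l * (Y b c' x / U b c') ^ (tri k - tri l)) \<le> K1 * K"
    unfolding F_def g_def by (simp add: power_divide mult.commute flip: avg_cdiv)
qed

text \<open>Interpolation between the estimate for \<open>k - l\<close>, in which the two classes
  exchange their roles, and the estimate for \<open>l - 1\<close>. Distinctness modulo
  \<open>p\<close> is symmetric, so the exchange is harmless.\<close>

lemma bilinear_bound_hoelder:
  assumes l: "1 \<le> l" "l < k" and B1: "bilinear_bound (k - l) b a K1" and B2: "bilinear_bound (l - 1) a b K2"
    and K: "K > 0" "K1 > 0" "K2 > 0" "K ^ Suc (k - l) = K1 * K2 ^ (k - l)" and ab: "a \<le> B" "b \<le> B"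
  shows "bilinear_bound l a b K"
  unfolding bilinear_bound_def
proof (intro allI impI)
  fix c c' assume nc: "\<not> [c = c'] (mod p)"
  define m where "m = k - l"
  have m: "m \<ge> 1" using l by (simp add: m_def)
  define u where "u = (\<lambda>x. Y a c x / U a c)"
  define v where "v = (\<lambda>x. Y b c' x / U b c')"
  have uv: "u x \<ge> 0" "v x \<ge> 0" for x using U_pos ab by (auto simp: u_def v_def less_imp_le)
  define F1 where "F1 = (\<lambda>x. v x ^ tri m * u x ^ (tri k - tri m))"
  define F2 where "F2 = (\<lambda>x. u x ^ tri (l - 1) * v x ^ (tri k - tri (l - 1)))"
  have E1: "E F1 \<le> K1"
    using B1 nc unfolding bilinear_bound_def F1_def u_def v_def m_def by (metis (no_types, lifting) cong_sym)
  have E2: "E F2 \<le> K2"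
    using B2 nc unfolding bilinear_bound_def F2_def u_def v_def by blast
  have "u x ^ tri l * v x ^ (tri k - tri l) \<le> (K / Suc m / K1) * F1 x + (K * m / Suc m / K2) * F2 x" for x
  proof -
    have e1: "u x ^ (Suc m * tri l) = u x ^ (tri k - tri m) * u x ^ (m * tri (l - 1))"
      unfolding m_def tri_diff_identity(1)[OF l] by (rule power_add)
    have e2: "v x ^ (Suc m * (tri k - tri l)) = v x ^ tri m * v x ^ (m * (tri k - tri (l - 1)))"
      unfolding m_def tri_diff_identity(2)[OF l] by (rule power_add)
    have "(u x ^ tri l * v x ^ (tri k - tri l)) ^ Suc m = u x ^ (Suc m * tri l) * v x ^ (Suc m * (tri k - tri l))"
      by (simp only: power_mult_distrib power_mult[symmetric] mult.commute)
    also have "\<dots> = F1 x * F2 x ^ m"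
      unfolding e1 e2 F1_def F2_def
      by (simp only: power_mult_distrib power_mult[symmetric] mult_ac)
    finally have "(u x ^ tri l * v x ^ (tri k - tri l)) ^ Suc m = F1 x * F2 x ^ m" .
    then have "u x ^ tri l * v x ^ (tri k - tri l) \<le> K * ((1 / Suc m) * (F1 x / K1) + (m / Suc m) * (F2 x / K2))"
      using uv K m by (intro weighted_am_gm) (auto simp: F1_def F2_def m_def simp del: power_Suc)
    then show ?thesis by (simp add: algebra_simps)
  qed
  then have "E (\<lambda>x. u x ^ tri l * v x ^ (tri k - tri l)) \<le> E (\<lambda>x. (K / Suc m / K1) * F1 x + (K * m / Suc m / K2) * F2 x)"
    by (intro avg_mono Q0)
  also have "\<dots> = (K / Suc m / K1) * E F1 + (K * m / Suc m / K2) * E F2"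
    by (simp only: avg_add avg_cmult)
  also have "\<dots> \<le> (K / Suc m / K1) * K1 + (K * m / Suc m / K2) * K2"
    using K E1 E2 by (intro add_mono mult_left_mono) auto
  also have "\<dots> = K / Suc m + K * m / Suc m" using K by simp
  also have "\<dots> = (K * Suc m) / Suc m" by (simp add: algebra_simps add_divide_distrib)
  also have "\<dots> = K" by simp
  finally show "E (\<lambda>x. (Y a c x / U a c) ^ tri l * (Y b c' x / U b c') ^ (tri k - tri l)) \<le> K"
    unfolding u_def v_def .
qed

lemma bilinear_bound_trivial:
  assumes l: "l \<le> k" and ab: "a \<le> B" "b \<le> B"
    and K: "\<And>c. E (\<lambda>x. Y a c x ^ tri k) \<le> K * U a c ^ tri k" "\<And>c. E (\<lambda>x. Y b c x ^ tri k) \<le> K * U b c ^ tri k"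
  shows "bilinear_bound l a b (2 * K)"
  unfolding bilinear_bound_def
proof (intro allI impI)
  fix c c'
  define u where "u = (\<lambda>x. Y a c x / U a c)"
  define v where "v = (\<lambda>x. Y b c' x / U b c')"
  have uv: "u x \<ge> 0" "v x \<ge> 0" for x using U_pos ab by (auto simp: u_def v_def less_imp_le)
  have "tri l \<le> tri k" using l by (rule tri_mono)
  have "u x ^ tri l * v x ^ (tri k - tri l) \<le> u x ^ tri k + v x ^ tri k" for x
  proof -
    define t where "t = max (u x) (v x)"
    have "u x ^ tri l * v x ^ (tri k - tri l) \<le> t ^ tri l * t ^ (tri k - tri l)"
      using uv[of x] by (intro mult_mono power_mono) (auto simp: t_def)
    also have "\<dots> = t ^ tri k" using \<open>tri l \<le> tri k\<close> by (simp flip: power_add)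
    also have "\<dots> \<le> u x ^ tri k + v x ^ tri k" using uv[of x] by (auto simp: t_def max_def)
    finally show ?thesis .
  qed
  then have "E (\<lambda>x. u x ^ tri l * v x ^ (tri k - tri l)) \<le> E (\<lambda>x. u x ^ tri k + v x ^ tri k)"
    by (intro avg_mono Q0)
  also have "\<dots> = E (\<lambda>x. Y a c x ^ tri k) / U a c ^ tri k + E (\<lambda>x. Y b c' x ^ tri k) / U b c' ^ tri k"
    by (simp add: avg_add u_def v_def power_divide avg_cdiv)
  also have "\<dots> \<le> K + K"
    using K U_pos ab by (intro add_mono) (auto simp: pos_divide_le_eq)
  finally show "E (\<lambda>x. (Y a c x / U a c) ^ tri l * (Y b c' x / U b c') ^ (tri k - tri l)) \<le> 2 * K"
    unfolding u_def v_def by simp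
qed

text \<open>With exponent zero on the first class only the sum at scale \<open>b\<close> is left,
  and rescaling controls it by the decoupling constant for \<open>B - b\<close> scales. In the
  iteration every gain originates here.\<close>

lemma bilinear_bound_0:
  assumes b: "b \<le> B" and K: "\<And>c. E (\<lambda>x. Y b c x ^ tri k) \<le> K * U b c ^ tri k"
  shows "bilinear_bound 0 a b K"
  unfolding bilinear_bound_def using K U_pos[OF b] by (simp add: power_divide avg_cdiv pos_divide_le_eq)

lemma Y_split:
  assumes "a \<le> b"
  shows "Y a c x \<le> real_of_int p ^ (b - a) * (\<Sum>r\<in>subclasses p a b c. Y b r x)"
proof -
  have card: "real (card (subclasses p a b c)) = real_of_int p ^ (b - a)"
  proof -
    have "card (subclasses p a b c) = nat (p ^ (b - a))"
      using bij_betw_same_card[OF bij_subclasses[OF p1, of c a "b - a"]] assms by simp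
    moreover have "real (nat (p ^ (b - a))) = of_int (p ^ (b - a))"
      using p1 by (intro of_nat_nat) simp
    ultimately show ?thesis by simp
  qed
  have "norm (exp_sum k (p ^ (k * B)) P co (S \<inter> res_class p a c) x)
      \<le> (\<Sum>r\<in>subclasses p a b c. norm (exp_sum k (p ^ (k * B)) P co (S \<inter> res_class p b r) x))"
    unfolding exp_sum_split[OF p1 assms S] by (rule norm_sum)
  then have "Y a c x \<le> (\<Sum>r\<in>subclasses p a b c. norm (exp_sum k (p ^ (k * B)) P co (S \<inter> res_class p b r) x)) ^ Suc 1"
    unfolding Y_def by (simp add: power2_eq_square[symmetric] power_mono)
  also have "\<dots> \<le> real (card (subclasses p a b c)) ^ 1 * (\<Sum>r\<in>subclasses p a b c. norm (exp_sum k (p ^ (k * B)) P co (S \<inter> res_class p b r) x) ^ Suc 1)"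
    by (intro power_sum_le_card) auto
  finally show ?thesis unfolding card by (simp add: Y_def power2_eq_square)
qed

text \<open>Cauchy-Schwarz over the \<open>p^(b-1)\<close> subclasses brings the second class back
  to scale one, and convexity with the weights \<open>U b r / U 1 c'\<close> keeps the
  normalisation. The loss \<open>p^(b * tri k)\<close> is the price that the gain per unit of
  \<open>b\<close> has to exceed.\<close>

lemma bilinear_bound_coarsen:
  assumes l: "l < k" and b: "1 \<le> b" "b \<le> B" and bilinear_bound: "bilinear_bound l 1 b K" and K: "K \<ge> 0"
  shows "bilinear_bound l 1 1 (real_of_int p ^ (b * tri k) * K)"
  unfolding bilinear_bound_def
proof (intro allI impI)
  fix c c' assume nc: "\<not> [c = c'] (mod p)"
  have "l * (l + 1) < k * (k + 1)" using l by (intro mult_strict_mono) auto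
  then have "tri l < tri k" using tri_2[of l] tri_2[of k] by linarith
  then obtain q where q: "tri k - tri l = Suc q" by (cases "tri k - tri l") auto
  define C where "C = real_of_int p ^ (b - 1)"
  have C: "C \<ge> 1" using p1 by (simp add: C_def)
  have U1: "U 1 c > 0" "U 1 c' > 0" and Ub: "U b r > 0" for r using U_pos b by auto
  have UU: "(\<Sum>r\<in>subclasses p 1 b c'. U b r) = U 1 c'" using b by (intro U_nest) auto
  have ne: "subclasses p 1 b c' \<noteq> {}" using subclasses_nonempty[OF p1] b by blast
  have pt: "(Y 1 c' x / U 1 c') ^ Suc q \<le> C ^ Suc q * (\<Sum>r\<in>subclasses p 1 b c'. (U b r / U 1 c') * (Y b r x / U b r) ^ Suc q)" for x
  proof -
    have "Y 1 c' x ^ Suc q \<le> (C * (\<Sum>r\<in>subclasses p 1 b c'. Y b r x)) ^ Suc q"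
      using Y_split[OF b(1)] by (intro power_mono) (auto simp: C_def)
    also have "\<dots> = C ^ Suc q * (\<Sum>r\<in>subclasses p 1 b c'. Y b r x) ^ Suc q" by (rule power_mult_distrib)
    also have "\<dots> \<le> C ^ Suc q * (U 1 c' ^ q * (\<Sum>r\<in>subclasses p 1 b c'. Y b r x ^ Suc q / U b r ^ q))"
      unfolding UU[symmetric] using C Ub ne by (intro mult_left_mono power_sum_le_weighted) auto
    finally have "(Y 1 c' x / U 1 c') ^ Suc q \<le> C ^ Suc q * (U 1 c' ^ q * (\<Sum>r\<in>subclasses p 1 b c'. Y b r x ^ Suc q / U b r ^ q)) / U 1 c' ^ Suc q"
      using U1 unfolding power_divide by (intro divide_right_mono) auto
    also have "\<dots> = C ^ Suc q * (\<Sum>r\<in>subclasses p 1 b c'. Y b r x ^ Suc q / U b r ^ q / U 1 c')"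
      using U1 by (simp only: sum_divide_distrib[symmetric]) (simp add: field_simps)
    also have "(\<Sum>r\<in>subclasses p 1 b c'. Y b r x ^ Suc q / U b r ^ q / U 1 c') = (\<Sum>r\<in>subclasses p 1 b c'. (U b r / U 1 c') * (Y b r x / U b r) ^ Suc q)"
      using Ub by (intro sum.cong refl) (simp add: power_divide less_imp_neq[symmetric])
    finally show ?thesis .
  qed
  have "E (\<lambda>x. (Y 1 c x / U 1 c) ^ tri l * (Y 1 c' x / U 1 c') ^ (tri k - tri l))
     \<le> E (\<lambda>x. C ^ Suc q * (\<Sum>r\<in>subclasses p 1 b c'. (U b r / U 1 c') * ((Y 1 c x / U 1 c) ^ tri l * (Y b r x / U b r) ^ (tri k - tri l))))"
  proof (intro avg_mono Q0)
    fix x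
    have "(Y 1 c x / U 1 c) ^ tri l * (Y 1 c' x / U 1 c') ^ (tri k - tri l) \<le> (Y 1 c x / U 1 c) ^ tri l *
       (C ^ Suc q * (\<Sum>r\<in>subclasses p 1 b c'. (U b r / U 1 c') * (Y b r x / U b r) ^ Suc q))"
      unfolding q using U1 by (intro mult_left_mono pt) auto
    also have "\<dots> = C ^ Suc q * (\<Sum>r\<in>subclasses p 1 b c'. (U b r / U 1 c') * ((Y 1 c x / U 1 c) ^ tri l * (Y b r x / U b r) ^ (tri k - tri l)))"
      unfolding q sum_distrib_left by (intro sum.cong refl) (simp only: mult_ac)
    finally show "(Y 1 c x / U 1 c) ^ tri l * (Y 1 c' x / U 1 c') ^ (tri k - tri l) \<le>
      C ^ Suc q * (\<Sum>r\<in>subclasses p 1 b c'. (U b r / U 1 c') * ((Y 1 c x / U 1 c) ^ tri l * (Y b r x / U b r) ^ (tri k - tri l)))" .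
  qed
  also have "\<dots> = C ^ Suc q * (\<Sum>r\<in>subclasses p 1 b c'. (U b r / U 1 c') * E (\<lambda>x. (Y 1 c x / U 1 c) ^ tri l * (Y b r x / U b r) ^ (tri k - tri l)))"
    by (simp only: avg_cmult avg_sum)
  also have "\<dots> \<le> C ^ Suc q * (\<Sum>r\<in>subclasses p 1 b c'. (U b r / U 1 c') * K)"
  proof (intro mult_left_mono sum_mono)
    fix r assume "r \<in> subclasses p 1 b c'"
    then have "[r = c'] (mod p)" by (auto simp: subclasses_def)
    then have "\<not> [c = r] (mod p)" using nc by (meson cong_trans)
    then show "E (\<lambda>x. (Y 1 c x / U 1 c) ^ tri l * (Y b r x / U b r) ^ (tri k - tri l)) \<le> K"
      using bilinear_bound unfolding bilinear_bound_def by blast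
  qed (use C U1 Ub in \<open>auto simp: less_imp_le\<close>)
  also have "(\<Sum>r\<in>subclasses p 1 b c'. (U b r / U 1 c') * K) = K"
    using UU U1 by (simp flip: sum_distrib_right sum_divide_distrib)
  also have "C ^ Suc q * K \<le> real_of_int p ^ (b * tri k) * K"
  proof (intro mult_right_mono K)
    have "(b - 1) * Suc q \<le> b * tri k" using q by (intro mult_le_mono) auto
    then show "C ^ Suc q \<le> real_of_int p ^ (b * tri k)"
      unfolding C_def power_mult[symmetric] using p1 by (intro power_increasing) auto
  qed
  finally show "E (\<lambda>x. (Y 1 c x / U 1 c) ^ tri l * (Y 1 c' x / U 1 c') ^ (tri k - tri l)) \<le> real_of_int p ^ (b * tri k) * K" .
qed

end

text \<open>The exponent saved in the bilinear estimate with parameter \<open>l\<close> after \<open>n\<close> rounds; the recursion is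
  the one produced by Hoelder's inequality followed by decoupling in dimension \<open>l\<close>.\<close>

fun gain :: "nat \<Rightarrow> real \<Rightarrow> nat \<Rightarrow> nat \<Rightarrow> real" where
  "gain k \<eta> 0 l = (if l = 0 then \<eta> else 0)"
| "gain k \<eta> (Suc n) l = (if l = 0 then \<eta> else
     gain k \<eta> n (k - l) / l + real (k - l) / real (k - l + 1) * gain k \<eta> n (l - 1))"

lemma gain_0 [simp]: "gain k \<eta> n 0 = \<eta>"
  by (cases n) auto

text \<open>The weights of the recursion add up to one, so every round increases the total gain by a fixed
  multiple of \<open>\<eta>\<close>.\<close>

lemma sum_gain:
  assumes "k \<ge> 2"
  shows "(\<Sum>l\<in>{1..<k}. gain k \<eta> n l) = n * ((real k - 1) / k * \<eta>)"
proof (induction n)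
  case 0
  have "(\<Sum>l\<in>{1..<k}. gain k \<eta> 0 l) = (\<Sum>l\<in>{1..<k}. 0)" by (intro sum.cong) auto
  then show ?case by simp
next
  case (Suc n)
  let ?g = "gain k \<eta> n"
  have 1: "(\<Sum>l\<in>{1..<k}. ?g (k - l) / l) = (\<Sum>j\<in>{1..<k}. ?g j / real (k - j))"
    by (rule sum.reindex_bij_witness[where i = "\<lambda>j. k - j" and j = "\<lambda>j. k - j"]) auto
  have 2: "(\<Sum>l\<in>{1..<k}. real (k - l) / real (k - l + 1) * ?g (l - 1))
       = (\<Sum>j\<in>{0..<k - 1}. (1 - 1 / real (k - j)) * ?g j)"
  proof (rule sum.reindex_bij_witness[where i = "\<lambda>j. j + 1" and j = "\<lambda>l. l - 1"])
    fix l assume l: "l \<in> {1..<k}"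
    have "k - (l - 1) = k - l + 1" using l by auto
    moreover have "1 - 1 / real (k - l + 1) = real (k - l) / real (k - l + 1)"
      by (simp add: field_simps)
    ultimately show "(1 - 1 / real (k - (l - 1))) * ?g (l - 1) = real (k - l) / real (k - l + 1) * ?g (l - 1)"
      by simp
  qed auto
  \<comment> \<open>The weight \<open>1 - 1/(k - j)\<close> vanishes at \<open>j = k - 1\<close>, so
    the range may be extended to match the other sum.\<close>
  have "{0..<k} = insert (k - 1) {0..<k - 1}" using assms by auto
  then have 3: "(\<Sum>j\<in>{0..<k - 1}. (1 - 1 / real (k - j)) * ?g j) = (\<Sum>j\<in>{0..<k}. (1 - 1 / real (k - j)) * ?g j)"
    using assms by simp
  also have "\<dots> = (1 - 1 / real k) * \<eta> + (\<Sum>j\<in>{1..<k}. (1 - 1 / real (k - j)) * ?g j)"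
    using assms by (simp add: sum.atLeast_Suc_lessThan)
  also have "(\<Sum>j\<in>{1..<k}. (1 - 1 / real (k - j)) * ?g j) = (\<Sum>j\<in>{1..<k}. ?g j) - (\<Sum>j\<in>{1..<k}. ?g j / real (k - j))"
    by (simp add: sum_subtractf algebra_simps)
  finally have 4: "(\<Sum>j\<in>{0..<k - 1}. (1 - 1 / real (k - j)) * ?g j)
     = (1 - 1 / real k) * \<eta> + ((\<Sum>j\<in>{1..<k}. ?g j) - (\<Sum>j\<in>{1..<k}. ?g j / real (k - j)))" .
  have "(\<Sum>l\<in>{1..<k}. gain k \<eta> (Suc n) l)
     = (\<Sum>l\<in>{1..<k}. ?g (k - l) / l + real (k - l) / real (k - l + 1) * ?g (l - 1))"
    by (intro sum.cong) auto
  also have "\<dots> = (1 - 1 / real k) * \<eta> + (\<Sum>j\<in>{1..<k}. ?g j)"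
    unfolding sum.distrib 1 2 4 by simp
  also have "\<dots> = Suc n * ((real k - 1) / k * \<eta>)"
    unfolding Suc.IH using assms by (simp add: field_simps)
  finally show ?case .
qed

text \<open>The \<open>k - 1\<close> gains with \<open>1 \<le> l < k\<close> have mean
  \<open>n * \<eta> / k\<close>, so one of them reaches it. Any such \<open>l\<close> is good enough
  for the passage back to the linear estimate.\<close>

lemma gain_large:
  assumes "k \<ge> 2"
  shows "\<exists>l\<in>{1..<k}. gain k \<eta> n l \<ge> n * \<eta> / k"
proof (rule ccontr)
  assume "\<not> ?thesis"
  then have "(\<Sum>l\<in>{1..<k}. gain k \<eta> n l) < (\<Sum>l\<in>{1..<k}. n * \<eta> / k)"
    using assms by (intro sum_strict_mono) (auto simp: not_le)
  also have "\<dots> = n * ((real k - 1) / k * \<eta>)" using assms by (simp add: of_nat_diff)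
  finally show False using sum_gain[OF assms, of \<eta> n] by simp
qed

section \<open>Iteration of the bilinear estimates\<close>

context curve_sum
begin

lemma bilinear_bound_mono: "bilinear_bound l a b K \<Longrightarrow> K \<le> K' \<Longrightarrow> bilinear_bound l a b K'"
  unfolding bilinear_bound_def by (meson order_trans)

abbreviation q :: real where "q \<equiv> real_of_int p"

lemma q1: "q > 1" using p1 by simp

text \<open>One round passes from scale \<open>a\<close> to \<open>a' = (k-l+1) b / l\<close>, the
  finest scale for which the sum at scale \<open>b\<close> is still constant on the fibres:
  decoupling in dimension \<open>l\<close> reaches \<open>a'\<close>, then Hoelder leads to
  \<open>(k-l, b, a')\<close> and \<open>(l-1, a', b)\<close>, where the induction hypothesis
  applies. Since \<open>a'/(k-l+1) = b/l\<close>, the first weight of \<open>gain\<close> is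
  \<open>1/l\<close>. Divisibility of \<open>b\<close> by \<open>fact k ^ n\<close> keeps
  \<open>a'\<close> an integer in all rounds, and \<open>k ^ n * b \<le> B\<close> keeps all scales
  below \<open>B\<close> because \<open>a' \<le> k * b\<close>.\<close>

lemma bilinear_bound_iterate:
  fixes C0 C1 \<eta> \<epsilon> :: real
  assumes C0: "\<And>a c. a \<le> B \<Longrightarrow> E (\<lambda>x. Y a c x ^ tri k) \<le> C0 * q powr (\<eta> * (real B - real a)) * U a c ^ tri k"
    and low: "\<And>l B'. 1 \<le> l \<Longrightarrow> l < k \<Longrightarrow> decoupling_bound p l B' (C1 * q powr (\<epsilon> * B'))"
    and pos: "C0 > 0" "C1 \<ge> 1" "\<epsilon> \<ge> 0" "\<eta> \<ge> 0"
  shows "l < k \<Longrightarrow> fact k ^ n dvd b \<Longrightarrow> b \<ge> 1 \<Longrightarrow> a \<ge> 1 \<Longrightarrow> l * a \<le> (k - l + 1) * b \<Longrightarrow> a \<le> B \<Longrightarrow> k ^ n * b \<le> B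
    \<Longrightarrow> bilinear_bound l a b (2 * C0 * C1 ^ n * q powr ((\<eta> + n * \<epsilon>) * B - gain k \<eta> n l * b))"
proof (induction n arbitrary: l a b)
  case 0
  then have b: "b \<le> B" by simp
  show ?case
  proof (cases "l = 0")
    case True
    have "bilinear_bound 0 a b (C0 * q powr (\<eta> * (real B - real b)))"
      by (intro bilinear_bound_0 b C0)
    then show ?thesis unfolding True
      by (rule bilinear_bound_mono) (use pos in \<open>simp add: algebra_simps\<close>)
  next
    case False
    have le: "C0 * q powr (\<eta> * (real B - real a)) * U a c ^ tri k \<le> C0 * q powr (\<eta> * B) * U a c ^ tri k" if "a \<le> B" for a c
      using pos q1 that U_pos[OF that, of c]
      by (intro mult_right_mono mult_left_mono powr_mono) (auto simp: algebra_simps)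
    have "bilinear_bound l a b (2 * (C0 * q powr (\<eta> * B)))"
      using 0 b by (intro bilinear_bound_trivial order_trans[OF C0 le]) auto
    then show ?thesis using False by (simp add: algebra_simps)
  qed
next
  case (Suc n)
  have kn: "k ^ n \<ge> 1" using k by simp
  have kn': "k ^ Suc n \<ge> 1" using k by (metis one_le_power le_trans one_le_numeral)
  have b: "b \<le> B" using Suc.prems(7) kn' by (metis mult_1 mult_le_mono1 order_trans)
  define D where "D = 2 * C0 * C1 ^ n"
  have D: "D > 0" using pos by (simp add: D_def)
  show ?case
  proof (cases "l = 0")
    case True
    have "bilinear_bound 0 a b (C0 * q powr (\<eta> * (real B - real b)))"
      by (intro bilinear_bound_0 b C0)
    moreover have "C0 * q powr (\<eta> * (real B - real b)) \<le> 2 * C0 * C1 ^ Suc n * q powr ((\<eta> + Suc n * \<epsilon>) * B - gain k \<eta> (Suc n) 0 * b)"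
    proof (intro mult_mono powr_mono)
      have "1 \<le> C1 ^ Suc n" using pos(2) by (rule one_le_power)
      then have "C0 * 1 \<le> C0 * (2 * C1 ^ Suc n)" using pos by (intro mult_left_mono) auto
      then show "C0 \<le> 2 * C0 * C1 ^ Suc n" by (simp add: mult_ac)
    qed (use pos q1 in \<open>auto simp: algebra_simps\<close>)
    ultimately show ?thesis unfolding True by (rule bilinear_bound_mono)
  next
    case False
    then have l: "1 \<le> l" "l < k" using Suc.prems by auto
    define m where "m = k - l"
    have m: "m \<ge> 1" "m < k" "k - m = l" using l by (auto simp: m_def)
    obtain t where t: "b = fact k ^ Suc n * t" using Suc.prems(2) by (auto elim: dvdE)
    obtain f where f: "fact k = l * f" using l dvd_fact[of l k] by (auto elim: dvdE)
    define b1 where "b1 = fact k ^ n * (f * t)"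
    have bb: "b = l * b1" by (simp add: t b1_def f)
    have b1: "b1 \<ge> 1" using bb Suc.prems(3) by (cases b1) auto
    define a' where "a' = (m + 1) * b1"
    have a': "a' \<ge> 1" using b1 by (simp add: a'_def)
    have dvd: "fact k ^ n dvd a'" "fact k ^ n dvd b" by (auto simp: a'_def b1_def t)
    have "l * a \<le> l * a'" using Suc.prems(5) by (simp add: a'_def bb m_def algebra_simps)
    then have aa': "a \<le> a'" using l by simp
    have "a' \<le> k * b1" unfolding a'_def using l by (intro mult_right_mono) (auto simp: m_def)
    also have "\<dots> \<le> k * b" using l by (simp add: bb)
    finally have a'kb: "a' \<le> k * b" .
    have ka': "k ^ n * a' \<le> B"
    proof -
      have "k ^ n * a' \<le> k ^ n * (k * b)" using a'kb by simp
      also have "\<dots> \<le> B" using Suc.prems(7) by (simp add: mult_ac)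
      finally show ?thesis .
    qed
    then have a'B: "a' \<le> B" using kn by (metis mult_1 mult_le_mono1 order_trans)
    have kb: "k ^ n * b \<le> B"
    proof -
      have "k ^ n * b \<le> k ^ Suc n * b" using k by simp
      then show ?thesis using Suc.prems(7) by (rule order_trans)
    qed
    define K1 where "K1 = D * q powr ((\<eta> + n * \<epsilon>) * B - gain k \<eta> n m * a')"
    define K2 where "K2 = D * q powr ((\<eta> + n * \<epsilon>) * B - gain k \<eta> n (l - 1) * b)"
    have B1: "bilinear_bound m b a' K1"
      unfolding K1_def D_def
    proof (rule Suc.IH)
      have "m * b \<le> (l + 1) * a'"
      proof -
        have "m * b = (l * m) * b1" by (simp add: bb)
        also have "\<dots> \<le> ((l + 1) * (m + 1)) * b1" by (intro mult_right_mono mult_mono) auto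
        finally show ?thesis by (simp only: a'_def mult.assoc)
      qed
      then show "m * b \<le> (k - m + 1) * a'" by (simp add: m(3))
    qed (use m dvd a' b Suc.prems ka' in auto)
    have B2: "bilinear_bound (l - 1) a' b K2"
      unfolding K2_def D_def
    proof (rule Suc.IH)
      have "(l - 1) * a' = ((l - 1) * (m + 1)) * b1" by (simp only: a'_def mult.assoc)
      also have "\<dots> \<le> (l * (m + 2)) * b1" by (intro mult_right_mono mult_mono) auto
      also have "\<dots> = (k - (l - 1) + 1) * b" using l by (simp add: bb m_def algebra_simps Suc_diff_le)
      finally show "(l - 1) * a' \<le> (k - (l - 1) + 1) * b" .
    qed (use l dvd a' a'B Suc.prems kb in auto)
    define e1 where "e1 = (\<eta> + n * \<epsilon>) * B - gain k \<eta> n m * a'"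
    define e2 where "e2 = (\<eta> + n * \<epsilon>) * B - gain k \<eta> n (l - 1) * b"
    define e where "e = (e1 + m * e2) / Suc m"
    define K where "K = D * q powr e"
    have KK: "K ^ Suc m = K1 * K2 ^ m"
    proof -
      have "(q powr e) ^ Suc m = q powr (e * Suc m)"
        using q1 by (simp add: powr_powr flip: powr_realpow del: power_Suc of_nat_Suc)
      also have "e * Suc m = e1 + e2 * m" by (simp add: e_def mult.commute del: of_nat_Suc)
      also have "q powr (e1 + e2 * m) = q powr e1 * (q powr e2) ^ m"
        using q1 by (simp add: powr_add powr_powr flip: powr_realpow)
      finally show ?thesis unfolding K_def K1_def K2_def e1_def[symmetric] e2_def[symmetric]
        by (simp only: power_mult_distrib) (simp add: mult_ac)
    qed
    have BK: "bilinear_bound l a' b K"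
    proof -
      have "K > 0" "K1 > 0" "K2 > 0" using D q1 by (auto simp: K_def K1_def K2_def)
      then show ?thesis
        by (rule bilinear_bound_hoelder[OF l B1[unfolded m_def] B2 _ _ _ KK[unfolded m_def] a'B b])
    qed
    define B' where "B' = a' - a"
    have aB': "a + B' = a'" using aa' by (simp add: B'_def)
    have "bilinear_bound l a b (C1 * q powr (\<epsilon> * B') * K)"
    proof (rule lower_decoupling[where B' = B'])
      show "decoupling_bound p l B' (C1 * q powr (\<epsilon> * B'))" using low l by blast
      show "l * (a + B') \<le> (k - l + 1) * b" unfolding aB' by (simp add: a'_def bb m_def algebra_simps)
    qed (use pos l Suc.prems aB' a'B b BK in auto)
    moreover have "C1 * q powr (\<epsilon> * B') * K \<le> 2 * C0 * C1 ^ Suc n * q powr ((\<eta> + Suc n * \<epsilon>) * B - gain k \<eta> (Suc n) l * b)"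
    proof -
      have e_eq: "e = (\<eta> + n * \<epsilon>) * B - gain k \<eta> (Suc n) l * b"
      proof -
        have "gain k \<eta> n m * a' / Suc m = gain k \<eta> n m / l * b"
          using l by (simp add: a'_def bb field_simps)
        moreover have "real (m) / real (m + 1) * gain k \<eta> n (l - 1) * b = m * (gain k \<eta> n (l - 1) * b) / Suc m"
          by simp
        moreover have "e = (\<eta> + n * \<epsilon>) * B - gain k \<eta> n m * a' / Suc m - m * (gain k \<eta> n (l - 1) * b) / Suc m"
        proof -
          have "(X - y1 + m * (X - y2)) / Suc m = X - y1 / Suc m - m * y2 / Suc m" for X y1 y2 :: real
          proof -
            have eq: "X - y1 + m * (X - y2) = Suc m * X - y1 - m * y2" by (simp add: algebra_simps)
            show ?thesis unfolding eq by (simp add: diff_divide_distrib del: of_nat_Suc)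
          qed
          then show ?thesis unfolding e_def e1_def e2_def .
        qed
        ultimately show ?thesis using l by (simp add: m_def[symmetric] algebra_simps)
      qed
      have "\<epsilon> * B' \<le> \<epsilon> * B" using pos a'B by (intro mult_left_mono) (auto simp: B'_def)
      then have "\<epsilon> * B' + e \<le> (\<eta> + Suc n * \<epsilon>) * B - gain k \<eta> (Suc n) l * b"
        unfolding e_eq by (simp add: algebra_simps)
      then have "q powr (\<epsilon> * B' + e) \<le> q powr ((\<eta> + Suc n * \<epsilon>) * B - gain k \<eta> (Suc n) l * b)"
        using q1 by (intro powr_mono) auto
      then have "(D * C1) * q powr (\<epsilon> * B' + e) \<le> (D * C1) * q powr ((\<eta> + Suc n * \<epsilon>) * B - gain k \<eta> (Suc n) l * b)"
        using D pos by (intro mult_left_mono) auto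
      then show ?thesis by (simp only: K_def D_def powr_add power_Suc mult_ac)
    qed
    ultimately show ?thesis by (rule bilinear_bound_mono)
  qed
qed

end

text \<open>Either one class dominates the sum, or two different classes are comparable to it.\<close>

lemma broad_narrow:
  fixes \<kappa> :: real
  assumes \<kappa>: "\<kappa> > 1" and t: "t \<le> s" and s: "s \<ge> 1"
  shows "\<exists>C\<ge>0. \<forall>(I :: 'a set) y. finite I \<longrightarrow> card I \<le> N \<longrightarrow> (\<forall>i\<in>I. y i \<ge> 0) \<longrightarrow>
     (\<Sum>i\<in>I. y i) ^ (2 * s) \<le> \<kappa> * (\<Sum>i\<in>I. y i ^ (2 * s))
        + C * (\<Sum>i\<in>I. \<Sum>j\<in>I - {i}. y i ^ (2 * t) * y j ^ (2 * (s - t)))"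
proof -
  \<comment> \<open>If all other terms are at most the largest one divided by \<open>W\<close>, the
    whole sum is at most \<open>1 + \<delta>\<close> times the largest term, and \<delta> is chosen
    so that the power of this factor stays below \<kappa>. Otherwise the largest term and a second
    one within a factor \<open>W\<close> control everything.\<close>
  define \<delta> where "\<delta> = min 1 (root (2 * s) \<kappa> - 1)"
  have r1: "root (2 * s) \<kappa> > 1" using \<kappa> s by simp
  have \<delta>: "0 < \<delta>" "\<delta> \<le> 1" using r1 by (auto simp: \<delta>_def)
  have \<delta>\<kappa>: "(1 + \<delta>) ^ (2 * s) \<le> \<kappa>"
  proof -
    have "(1 + \<delta>) ^ (2 * s) \<le> root (2 * s) \<kappa> ^ (2 * s)"
      using \<delta> by (intro power_mono) (auto simp: \<delta>_def)
    then show ?thesis using \<kappa> s by simp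
  qed
  define W where "W = (real N + 1) / \<delta>"
  have W: "W \<ge> 1" "W > 0" using \<delta> by (auto simp: W_def field_simps)
  define C where "C = real N ^ (2 * s) * W ^ (2 * (s - t))"
  have C: "C \<ge> 0" using W by (simp add: C_def)
  have "(\<Sum>i\<in>I. y i) ^ (2 * s) \<le> \<kappa> * (\<Sum>i\<in>I. y i ^ (2 * s))
        + C * (\<Sum>i\<in>I. \<Sum>j\<in>I - {i}. y i ^ (2 * t) * y j ^ (2 * (s - t)))"
    if I: "finite I" "card I \<le> N" and y: "\<forall>i\<in>I. y i \<ge> 0" for I :: "'a set" and y
  proof (cases "I = {}")
    case True
    then show ?thesis using s by (simp add: power_0_left)
  next
    case False
    have nn: "(\<Sum>i\<in>I. \<Sum>j\<in>I - {i}. y i ^ (2 * t) * y j ^ (2 * (s - t))) \<ge> 0"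
      "(\<Sum>i\<in>I. y i ^ (2 * s)) \<ge> 0" using y by (auto intro!: sum_nonneg)
    have "Max (y ` I) \<in> y ` I" using I False by simp
    then obtain i where i: "i \<in> I" "y i = Max (y ` I)" by auto
    have yi: "y i \<ge> 0" using y i(1) by blast
    have ymax: "y j \<le> y i" if "j \<in> I" for j using that I by (simp add: i(2))
    show ?thesis
    proof (cases "\<forall>j\<in>I - {i}. W * y j \<le> y i")
      case True
      have "(\<Sum>j\<in>I. y j) = y i + (\<Sum>j\<in>I - {i}. y j)" using I i by (simp add: sum.remove)
      also have "(\<Sum>j\<in>I - {i}. y j) \<le> (\<Sum>j\<in>I - {i}. y i / W)"
        using True W by (intro sum_mono) (auto simp: pos_le_divide_eq mult.commute)
      also have "\<dots> \<le> real N * (y i / W)"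
        using I i y W by (simp, intro divide_right_mono mult_right_mono) auto
      also have "\<dots> \<le> \<delta> * y i"
      proof -
        have "real N / W \<le> \<delta>" using \<delta> by (simp add: W_def field_simps)
        then have "real N / W * y i \<le> \<delta> * y i" using y i by (intro mult_right_mono) auto
        then show ?thesis by simp
      qed
      finally have "(\<Sum>j\<in>I. y j) ^ (2 * s) \<le> ((1 + \<delta>) * y i) ^ (2 * s)"
        using y by (intro power_mono sum_nonneg) (auto simp: algebra_simps)
      also have "\<dots> \<le> \<kappa> * y i ^ (2 * s)"
        unfolding power_mult_distrib using \<delta>\<kappa> y i by (intro mult_right_mono) auto
      also have "\<dots> \<le> \<kappa> * (\<Sum>i\<in>I. y i ^ (2 * s))"
        using \<kappa> I y i by (intro mult_left_mono member_le_sum) auto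
      finally show ?thesis using C nn by (smt (verit) mult_nonneg_nonneg)
    next
      case False
      then obtain j where j: "j \<in> I - {i}" "y i < W * y j" by (auto simp: not_le)
      have "(\<Sum>j\<in>I. y j) \<le> (\<Sum>j\<in>I. y i)" using ymax by (intro sum_mono)
      also have "\<dots> = real (card I) * y i" by simp
      also have "\<dots> \<le> real N * y i" using I yi by (intro mult_right_mono) auto
      finally have "(\<Sum>j\<in>I. y j) ^ (2 * s) \<le> (real N * y i) ^ (2 * s)"
        using y by (intro power_mono sum_nonneg) auto
      also have "\<dots> = real N ^ (2 * s) * (y i ^ (2 * t) * y i ^ (2 * (s - t)))"
        using t by (simp add: power_mult_distrib flip: power_add distrib_left)
      also have "\<dots> \<le> real N ^ (2 * s) * (y i ^ (2 * t) * (W * y j) ^ (2 * (s - t)))"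
        using j y i by (intro mult_left_mono power_mono) auto
      also have "\<dots> = C * (y i ^ (2 * t) * y j ^ (2 * (s - t)))"
        by (simp add: C_def power_mult_distrib)
      also have "\<dots> \<le> C * (\<Sum>j\<in>I - {i}. y i ^ (2 * t) * y j ^ (2 * (s - t)))"
        using C I y j i by (intro mult_left_mono member_le_sum) auto
      also have "\<dots> \<le> C * (\<Sum>i\<in>I. \<Sum>j\<in>I - {i}. y i ^ (2 * t) * y j ^ (2 * (s - t)))"
        using C I y i
        by (intro mult_left_mono member_le_sum[where f = "\<lambda>i. \<Sum>j\<in>I - {i}. y i ^ (2 * t) * y j ^ (2 * (s - t))"])
           (auto intro!: sum_nonneg)
      finally show ?thesis using nn \<kappa> by (smt (verit) mult_nonneg_nonneg)
    qed
  qed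
  then show ?thesis using C by blast
qed

text \<open>The dominated part is rescaled by one step; adding up the classes modulo
  \<open>p\<close> costs nothing, because a sum of powers is at most the power of the sum. So this
  part loses only \<kappa>, which may be arbitrarily close to one. The transversal part loses the
  number \<open>p^2\<close> of pairs, but there the bilinear gain is available.\<close>

lemma (in curve_sum) bilinear_to_linear:
  assumes B: "B \<ge> 1" and l: "l < k" and D: "decoupling_bound p k (B - 1) K'" and K': "K' \<ge> 0"
    and bilinear_bound: "bilinear_bound l 1 1 K" and K: "K \<ge> 0" and \<kappa>: "\<kappa> \<ge> 0" and C: "C \<ge> 0"
    and bn: "\<And>(I :: int set) y. finite I \<Longrightarrow> card I \<le> nat p \<Longrightarrow> (\<And>i. i \<in> I \<Longrightarrow> y i \<ge> 0) \<Longrightarrow>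
     (\<Sum>i\<in>I. y i) ^ (2 * tri k) \<le> \<kappa> * (\<Sum>i\<in>I. y i ^ (2 * tri k))
        + C * (\<Sum>i\<in>I. \<Sum>j\<in>I - {i}. y i ^ (2 * tri l) * y j ^ (2 * (tri k - tri l)))"
  shows "E (\<lambda>x. Y 0 0 x ^ tri k) \<le> (\<kappa> * K' + C * q\<^sup>2 * K) * U 0 0 ^ tri k"
proof -
  define I where "I = {0..<p}"
  have I: "finite I" "card I = nat p" by (auto simp: I_def)
  have UI: "(\<Sum>r\<in>I. U 1 r) = U 0 0" using U_nest[of 0 1 0] B by (simp add: I_def)
  have Up: "U 1 r > 0" for r using U_pos B by simp
  have Ule: "U 1 r \<le> U 0 0" if "r \<in> I" for r
    unfolding UI[symmetric] using that I Up by (intro member_le_sum) (auto simp: less_imp_le)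
  have trle: "tri l \<le> tri k" using l by (intro tri_mono) auto
  have pt: "Y 0 0 x ^ tri k \<le> \<kappa> * (\<Sum>r\<in>I. Y 1 r x ^ tri k)
     + C * (\<Sum>r\<in>I. \<Sum>r'\<in>I - {r}. Y 1 r x ^ tri l * Y 1 r' x ^ (tri k - tri l))" for x
  proof -
    let ?f = "\<lambda>a c. norm (exp_sum k (p ^ (k * B)) P co (S \<inter> res_class p a c) x)"
    have "?f 0 0 \<le> (\<Sum>r\<in>I. ?f 1 r)"
      using exp_sum_split[OF p1 _ S, of 0 1 k "p ^ (k * B)" P co 0 x] norm_sum by (simp add: I_def)
    then have "?f 0 0 ^ (2 * tri k) \<le> (\<Sum>r\<in>I. ?f 1 r) ^ (2 * tri k)" by (intro power_mono) auto
    also have "\<dots> \<le> \<kappa> * (\<Sum>r\<in>I. ?f 1 r ^ (2 * tri k)) +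
        C * (\<Sum>r\<in>I. \<Sum>r'\<in>I - {r}. ?f 1 r ^ (2 * tri l) * ?f 1 r' ^ (2 * (tri k - tri l)))"
      using I by (intro bn) auto
    finally show ?thesis unfolding Y_power .
  qed
  have "E (\<lambda>x. Y 0 0 x ^ tri k) \<le> E (\<lambda>x. \<kappa> * (\<Sum>r\<in>I. Y 1 r x ^ tri k)
     + C * (\<Sum>r\<in>I. \<Sum>r'\<in>I - {r}. Y 1 r x ^ tri l * Y 1 r' x ^ (tri k - tri l)))"
    by (intro avg_mono Q0 pt)
  also have "\<dots> = \<kappa> * (\<Sum>r\<in>I. E (\<lambda>x. Y 1 r x ^ tri k))
     + C * (\<Sum>r\<in>I. \<Sum>r'\<in>I - {r}. E (\<lambda>x. Y 1 r x ^ tri l * Y 1 r' x ^ (tri k - tri l)))"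
    by (simp only: avg_add avg_cmult avg_sum)
  also have "\<dots> \<le> \<kappa> * (\<Sum>r\<in>I. K' * U 1 r ^ tri k) + C * (\<Sum>r\<in>I. \<Sum>r'\<in>I. K * U 0 0 ^ tri k)"
  proof (intro add_mono mult_left_mono sum_mono \<kappa> C)
    fix r
    show "E (\<lambda>x. Y 1 r x ^ tri k) \<le> K' * U 1 r ^ tri k" using rescale D K' B by blast
  next
    fix r assume r: "r \<in> I"
    have "(\<Sum>r'\<in>I - {r}. E (\<lambda>x. Y 1 r x ^ tri l * Y 1 r' x ^ (tri k - tri l))) \<le> (\<Sum>r'\<in>I - {r}. K * U 0 0 ^ tri k)"
    proof (intro sum_mono)
      fix r' assume r': "r' \<in> I - {r}"
      have "\<not> [r = r'] (mod p)" using r r' by (auto simp: I_def cong_def)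
      then have "E (\<lambda>x. (Y 1 r x / U 1 r) ^ tri l * (Y 1 r' x / U 1 r') ^ (tri k - tri l)) \<le> K"
        using bilinear_bound unfolding bilinear_bound_def by blast
      moreover have "E (\<lambda>x. (Y 1 r x / U 1 r) ^ tri l * (Y 1 r' x / U 1 r') ^ (tri k - tri l))
         = E (\<lambda>x. Y 1 r x ^ tri l * Y 1 r' x ^ (tri k - tri l)) / (U 1 r ^ tri l * U 1 r' ^ (tri k - tri l))"
        by (simp add: power_divide flip: avg_cdiv)
      ultimately have "E (\<lambda>x. Y 1 r x ^ tri l * Y 1 r' x ^ (tri k - tri l)) \<le> K * (U 1 r ^ tri l * U 1 r' ^ (tri k - tri l))"
        using Up[of r] Up[of r'] by (simp add: pos_divide_le_eq)
      also have "\<dots> \<le> K * (U 0 0 ^ tri l * U 0 0 ^ (tri k - tri l))"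
        using K Up[of r] Up[of r'] U_pos[of 0 0] Ule r r' by (intro mult_left_mono mult_mono power_mono) (auto simp: less_imp_le)
      also have "\<dots> = K * U 0 0 ^ tri k" using trle by (simp flip: power_add)
      finally show "E (\<lambda>x. Y 1 r x ^ tri l * Y 1 r' x ^ (tri k - tri l)) \<le> K * U 0 0 ^ tri k" .
    qed
    also have "\<dots> \<le> (\<Sum>r'\<in>I. K * U 0 0 ^ tri k)"
      using I K U_pos[of 0 0] by (intro sum_mono2) auto
    finally show "(\<Sum>r'\<in>I - {r}. E (\<lambda>x. Y 1 r x ^ tri l * Y 1 r' x ^ (tri k - tri l))) \<le> (\<Sum>r'\<in>I. K * U 0 0 ^ tri k)" .
  qed
  also have "(\<Sum>r\<in>I. \<Sum>r'\<in>I. K * U 0 0 ^ tri k) = q\<^sup>2 * K * U 0 0 ^ tri k"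
    using I p1 by (simp add: power2_eq_square)
  also have "\<kappa> * (\<Sum>r\<in>I. K' * U 1 r ^ tri k) + C * (q\<^sup>2 * K * U 0 0 ^ tri k)
     \<le> \<kappa> * (K' * U 0 0 ^ tri k) + C * (q\<^sup>2 * K * U 0 0 ^ tri k)"
    unfolding sum_distrib_left[symmetric] UI[symmetric]
    using K' I Up trk \<kappa> by (intro add_right_mono mult_left_mono sum_power_le_power_sum) (auto simp: less_imp_le)
  also have "\<dots> = (\<kappa> * K' + C * q\<^sup>2 * K) * U 0 0 ^ tri k" by (simp add: algebra_simps)
  finally show ?thesis .
qed

text \<open>The scale \<open>b\<close> is the largest multiple of \<open>fact k ^ n\<close> with
  \<open>k ^ n * b \<le> B\<close>. A gain of \<open>tri k + 1\<close> per unit of \<open>b\<close>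
  pays for the return to scale one and leaves \<open>p^(-b)\<close>, about
  \<open>p^(-B/k^n)\<close>. As \<open>2 * \<theta> * k ^ n \<le> 1\<close>, this covers the loss
  \<open>n * \<epsilon> * B \<le> \<theta> * B\<close> and still saves \<open>\<theta> * B\<close>.
  If \<open>B\<close> is so small that \<open>b = 0\<close>, the trivial estimate is absorbed into
  the constant: this is its second summand.\<close>

lemma (in curve_sum) bilinear_gain:
  fixes C0 C1 \<eta> \<epsilon> \<theta> \<zeta> :: real
  assumes D: "\<And>B. decoupling_bound p k B (C0 * q powr (\<eta> * B))"
    and low: "\<And>l B'. 1 \<le> l \<Longrightarrow> l < k \<Longrightarrow> decoupling_bound p l B' (C1 * q powr (\<epsilon> * B'))"
    and pos: "C0 > 0" "C1 \<ge> 1" "\<epsilon> \<ge> 0" "\<eta> \<ge> 0" "n \<ge> 1"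
    and l: "l < k" and g: "gain k \<eta> n l \<ge> tri k + 1"
    and \<theta>: "n * \<epsilon> \<le> \<theta>" "2 * \<theta> * k ^ n \<le> 1" "\<theta> \<ge> 0" and \<zeta>: "\<zeta> \<ge> \<eta> - \<theta>" "\<zeta> \<ge> 0" and B: "B \<ge> 1"
  shows "bilinear_bound l 1 1 ((2 * C0 * C1 ^ n * q powr (fact k ^ n) + 2 * C0 * q powr (\<eta> * (k ^ n * fact k ^ n))) * q powr (\<zeta> * B))"
proof -
  define N where "N = k ^ n"
  define F :: nat where "F = fact k ^ n"
  have N: "N \<ge> 1" using k by (simp add: N_def)
  have F: "F \<ge> 1" by (simp add: F_def)
  have Fk: "F \<ge> k"
  proof -
    have "k \<le> fact k" by (rule fact_ge_self)
    also have "\<dots> \<le> F" unfolding F_def using pos(5) by (intro self_le_power) auto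
    finally show ?thesis .
  qed
  have Freal: "real F = fact k ^ n" by (simp add: F_def)
  have C0: "E (\<lambda>x. Y a c x ^ tri k) \<le> C0 * q powr (\<eta> * (real B - real a)) * U a c ^ tri k" if "a \<le> B" for a c
    using rescale[OF D[of "B - a"] _ that] pos that by (simp add: of_nat_diff)
  define b where "b = F * (B div (N * F))"
  have NF: "N * F \<ge> 1" using N F by (metis mult_le_mono nat_mult_1)
  have Nb: "N * b \<le> B"
    unfolding b_def by (metis div_times_less_eq_dividend mult.assoc mult.commute)
  have bB: "b \<le> B" using Nb N by (metis mult_1 mult_le_mono1 order_trans)
  have bge: "real b \<ge> B / N - F"
  proof -
    have "B < N * F * (B div (N * F) + 1)" using NF by (metis dividend_less_times_div add.commute mult_Suc_right One_nat_def plus_1_eq_Suc add.right_neutral less_le_trans zero_less_one)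
    then have "B < N * b + N * F" by (simp add: b_def algebra_simps)
    then have "real B < real N * (real b + real F)" by (metis distrib_left of_nat_add of_nat_less_iff of_nat_mult)
    then have "B / N < real b + real F" using N by (simp add: pos_divide_less_eq mult.commute)
    then show ?thesis by simp
  qed
  have q\<zeta>: "q powr (\<zeta> * B) \<ge> 1" using q1 \<zeta> by (intro ge_one_powr_ge_zero) auto
  show ?thesis
  proof (cases "b = 0")
    case True
    then have "B / N \<le> F" using bge by simp
    then have BNF: "real B \<le> N * F" using N by (simp add: pos_divide_le_eq mult.commute)
    have "C0 * q powr (\<eta> * (real B - real 1)) * U 1 c ^ tri k \<le> C0 * q powr (\<eta> * (N * F)) * U 1 c ^ tri k" for c
      using pos q1 U_pos[OF B, of c] BNF
      by (intro mult_right_mono mult_left_mono powr_mono) auto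
    then have "bilinear_bound l 1 1 (2 * (C0 * q powr (\<eta> * (N * F))))"
      using l B by (intro bilinear_bound_trivial order_trans[OF C0]) auto
    then show ?thesis
    proof (rule bilinear_bound_mono)
      have "2 * (C0 * q powr (\<eta> * (N * F))) \<le> (2 * C0 * C1 ^ n * q powr (fact k ^ n) + 2 * C0 * q powr (\<eta> * (N * F))) * 1"
        using pos q1 by simp
      also have "\<dots> \<le> (2 * C0 * C1 ^ n * q powr (fact k ^ n) + 2 * C0 * q powr (\<eta> * (N * F))) * q powr (\<zeta> * B)"
        using pos q1 q\<zeta> by (intro mult_left_mono) auto
      finally show "2 * (C0 * q powr (\<eta> * (N * F))) \<le> (2 * C0 * C1 ^ n * q powr (fact k ^ n) + 2 * C0 * q powr (\<eta> * (k ^ n * fact k ^ n))) * q powr (\<zeta> * B)"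
        by (simp add: N_def F_def)
    qed
  next
    case False
    then have "B div (N * F) \<ge> 1" unfolding b_def by (cases "B div (N * F)") auto
    then have bF: "F \<le> b" unfolding b_def by simp
    have b1: "1 \<le> b" using False by simp
    have "bilinear_bound l 1 b (2 * C0 * C1 ^ n * q powr ((\<eta> + n * \<epsilon>) * B - gain k \<eta> n l * b))"
    proof (rule bilinear_bound_iterate[OF C0 low])
      show "l * 1 \<le> (k - l + 1) * b" using l bF Fk b1
        by (metis One_nat_def add.commute le_add1 le_trans less_imp_le_nat mult.right_neutral mult_le_mono1 nat_mult_1 plus_1_eq_Suc)
      show "fact k ^ n dvd b" unfolding b_def F_def by simp
    qed (use pos l B b1 Nb[unfolded N_def] in auto)
    then have "bilinear_bound l 1 1 (q ^ (b * tri k) * (2 * C0 * C1 ^ n * q powr ((\<eta> + n * \<epsilon>) * B - gain k \<eta> n l * b)))"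
      using l b1 bB pos by (intro bilinear_bound_coarsen) auto
    then show ?thesis
    proof (rule bilinear_bound_mono)
      have "q ^ (b * tri k) * q powr ((\<eta> + n * \<epsilon>) * B - gain k \<eta> n l * b)
          = q powr (real (b * tri k) + ((\<eta> + n * \<epsilon>) * B - gain k \<eta> n l * b))"
        using q1 by (simp add: powr_add powr_realpow del: of_nat_mult)
      also have "\<dots> \<le> q powr (F + \<zeta> * B)"
      proof (intro powr_mono)
        have 1: "real b * (tri k + 1) \<le> real b * gain k \<eta> n l" using g by (intro mult_left_mono) auto
        have 2: "n * \<epsilon> * B \<le> \<theta> * B" using \<theta> by (intro mult_right_mono) auto
        have "2 * \<theta> * B * N \<le> B"
          using mult_right_mono[OF \<theta>(2), of "real B"] by (simp add: N_def mult_ac)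
        then have 3: "2 * \<theta> * B \<le> B / N" using N by (simp add: pos_le_divide_eq)
        have 4: "(\<eta> - \<theta>) * B \<le> \<zeta> * B" using \<zeta> by (intro mult_right_mono) auto
        show "real (b * tri k) + ((\<eta> + n * \<epsilon>) * B - gain k \<eta> n l * b) \<le> F + \<zeta> * B"
          using 1 2 3 4 bge by (simp add: algebra_simps)
      qed (use q1 in auto)
      finally have "(2 * C0 * C1 ^ n) * (q ^ (b * tri k) * q powr ((\<eta> + n * \<epsilon>) * B - gain k \<eta> n l * b))
         \<le> (2 * C0 * C1 ^ n) * q powr (F + \<zeta> * B)" using pos by (intro mult_left_mono) auto
      also have "\<dots> = (2 * C0 * C1 ^ n * q powr (fact k ^ n)) * q powr (\<zeta> * B)"
        by (simp add: powr_add Freal)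
      also have "\<dots> \<le> (2 * C0 * C1 ^ n * q powr (fact k ^ n) + 2 * C0 * q powr (\<eta> * (k ^ n * fact k ^ n))) * q powr (\<zeta> * B)"
        using pos q1 by (intro mult_right_mono) auto
      finally show "q ^ (b * tri k) * (2 * C0 * C1 ^ n * q powr ((\<eta> + n * \<epsilon>) * B - gain k \<eta> n l * b))
        \<le> (2 * C0 * C1 ^ n * q powr (fact k ^ n) + 2 * C0 * q powr (\<eta> * (k ^ n * fact k ^ n))) * q powr (\<zeta> * B)"
        by (simp add: mult_ac)
    qed
  qed
qed

section \<open>Starting points: no scales, the triangle inequality, dimension one\<close>

lemma decoupling_bound_0: "K \<ge> 1 \<Longrightarrow> decoupling_bound p k 0 K"
  unfolding decoupling_bound_def
proof (intro allI impI)
  fix P co S and lam :: "int \<Rightarrow> real"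
  assume K: "K \<ge> 1" and h: "\<forall>r\<in>{0..<p ^ 0}. lam r > 0 \<and>
        avg k (p ^ (k * 0)) (\<lambda>x. norm (exp_sum k (p ^ (k * 0)) P co (S \<inter> res_class p 0 r) x) ^ (2 * tri k)) \<le> lam r ^ tri k"
  have eq: "{0..<p ^ 0} = {0}" by auto
  have sum_0: "sum lam {0..<p ^ 0} = lam 0" unfolding eq by simp
  have "avg k (p ^ (k * 0)) (\<lambda>x. norm (exp_sum k (p ^ (k * 0)) P co S x) ^ (2 * tri k)) \<le> 1 * lam 0 ^ tri k" and "lam 0 > 0"
    using h unfolding eq by auto
  moreover from this(2) have "1 * lam 0 ^ tri k \<le> K * lam 0 ^ tri k" using K by (intro mult_right_mono) auto
  ultimately show "avg k (p ^ (k * 0)) (\<lambda>x. norm (exp_sum k (p ^ (k * 0)) P co S x) ^ (2 * tri k)) \<le> K * sum lam {0..<p ^ 0} ^ tri k"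
    using sum_0 by (metis order_trans)
qed

text \<open>Triangle inequality and convexity over the \<open>p^B\<close> classes. The exponent is
  poor, but it shows that some exponent is admissible, so that the infimum makes sense.\<close>

lemma decoupling_bound_crude:
  assumes p: "p > 1" and k: "k \<ge> 1"
  shows "decoupling_bound p k B (real_of_int p powr (2 * tri k * B))"
  unfolding decoupling_bound_def
proof (intro allI impI)
  fix P co S and lam :: "int \<Rightarrow> real"
  assume P: "moment_like p k P" and S: "finite S" and
    h: "\<forall>r\<in>{0..<p ^ B}. lam r > 0 \<and>
        avg k (p ^ (k * B)) (\<lambda>x. norm (exp_sum k (p ^ (k * B)) P co (S \<inter> res_class p B r) x) ^ (2 * tri k)) \<le> lam r ^ tri k"
  let ?I = "{0..<p ^ B}" and ?Q = "p ^ (k * B)"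
  obtain n where n: "2 * tri k = Suc n" using tri_pos[OF k] by (cases "2 * tri k") auto
  have Q: "?Q > 0" using p by simp
  have card: "real (card ?I) = real_of_int p ^ B" using p by simp
  have pt: "norm (exp_sum k ?Q P co S x) ^ (2 * tri k) \<le> real_of_int p ^ (B * n) * (\<Sum>r\<in>?I. norm (exp_sum k ?Q P co (S \<inter> res_class p B r) x) ^ (2 * tri k))" for x
  proof -
    have "norm (exp_sum k ?Q P co S x) \<le> (\<Sum>r\<in>?I. norm (exp_sum k ?Q P co (S \<inter> res_class p B r) x))"
      using exp_sum_split[OF p _ S, of 0 B k ?Q P co 0 x] norm_sum by simp
    then have "norm (exp_sum k ?Q P co S x) ^ Suc n \<le> (\<Sum>r\<in>?I. norm (exp_sum k ?Q P co (S \<inter> res_class p B r) x)) ^ Suc n"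
      by (intro power_mono) auto
    also have "\<dots> \<le> real (card ?I) ^ n * (\<Sum>r\<in>?I. norm (exp_sum k ?Q P co (S \<inter> res_class p B r) x) ^ Suc n)"
      by (intro power_sum_le_card) auto
    finally show ?thesis unfolding n card by (simp only: power_mult)
  qed
  have "avg k ?Q (\<lambda>x. norm (exp_sum k ?Q P co S x) ^ (2 * tri k)) \<le>
     avg k ?Q (\<lambda>x. real_of_int p ^ (B * n) * (\<Sum>r\<in>?I. norm (exp_sum k ?Q P co (S \<inter> res_class p B r) x) ^ (2 * tri k)))"
    by (intro avg_mono Q pt)
  also have "\<dots> = real_of_int p ^ (B * n) * (\<Sum>r\<in>?I. avg k ?Q (\<lambda>x. norm (exp_sum k ?Q P co (S \<inter> res_class p B r) x) ^ (2 * tri k)))"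
    by (simp only: avg_cmult avg_sum)
  also have "\<dots> \<le> real_of_int p ^ (B * n) * (\<Sum>r\<in>?I. lam r ^ tri k)"
    using h p by (intro mult_left_mono sum_mono) auto
  also have "\<dots> \<le> real_of_int p ^ (B * n) * (\<Sum>r\<in>?I. lam r) ^ tri k"
    using h p tri_pos[OF k] by (intro mult_left_mono sum_power_le_power_sum) (auto simp: less_imp_le)
  also have "\<dots> \<le> real_of_int p powr (2 * tri k * B) * (\<Sum>r\<in>?I. lam r) ^ tri k"
  proof (intro mult_right_mono zero_le_power sum_nonneg)
    have "real_of_int p ^ (B * n) = real_of_int p powr (real (B * n))" using p by (simp only: powr_realpow)
    also have "\<dots> \<le> real_of_int p powr (2 * tri k * B)"
    proof (intro powr_mono)
      have "B * n \<le> 2 * tri k * B" using n by simp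
      then show "real (B * n) \<le> 2 * tri k * B" by (metis of_nat_le_iff of_nat_mult of_nat_numeral)
    qed (use p in auto)
    finally show "real_of_int p ^ (B * n) \<le> real_of_int p powr (2 * tri k * B)" .
  qed (use h in \<open>auto simp: less_imp_le\<close>)
  finally show "avg k ?Q (\<lambda>x. norm (exp_sum k ?Q P co S x) ^ (2 * tri k)) \<le> real_of_int p powr (2 * tri k * B) * (\<Sum>r\<in>?I. lam r) ^ tri k" .
qed

lemma sum_int_box_1: "(\<Sum>x\<in>int_box 1 Q. g (x 1)) = (\<Sum>t\<in>{0..<Q}. g t)"
  by (rule sum.reindex_bij_witness[where i = "\<lambda>t. \<lambda>_\<in>{1}. t" and j = "\<lambda>x. x 1"])
     (auto simp: int_box_def PiE_def extensional_def)

lemma add_char_diff: "add_char Q s * cnj (add_char Q t) = add_char Q (s - t)"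
  by (simp add: cnj_add_char flip: add_char_add)

lemma parseval_cong:
  fixes a :: "int \<Rightarrow> complex"
  assumes "Q > 0"
  shows "complex_of_real (\<Sum>t\<in>{0..<Q}. (norm (\<Sum>n\<in>S. a n * add_char Q (t * g n)))\<^sup>2)
     = of_int Q * (\<Sum>n\<in>S. \<Sum>n'\<in>S. if Q dvd g n - g n' then a n * cnj (a n') else 0)"
proof -
  have "complex_of_real ((norm (\<Sum>n\<in>S. a n * add_char Q (t * g n)))\<^sup>2)
     = (\<Sum>n\<in>S. \<Sum>n'\<in>S. (a n * cnj (a n')) * add_char Q (t * (g n - g n')))" for t
    unfolding complex_norm_square cnj_sum sum_product
    by (intro sum.cong refl) (simp add: right_diff_distrib flip: add_char_diff)
  then have "complex_of_real (\<Sum>t\<in>{0..<Q}. (norm (\<Sum>n\<in>S. a n * add_char Q (t * g n)))\<^sup>2)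
     = (\<Sum>t\<in>{0..<Q}. \<Sum>n\<in>S. \<Sum>n'\<in>S. (a n * cnj (a n')) * add_char Q (t * (g n - g n')))"
    by (simp only: of_real_sum)
  also have "\<dots> = (\<Sum>n\<in>S. \<Sum>n'\<in>S. (a n * cnj (a n')) * (\<Sum>t\<in>{0..<Q}. add_char Q (t * (g n - g n'))))"
    unfolding sum_distrib_left by (subst sum.swap, rule sum.cong[OF refl], subst sum.swap) (rule refl)
  also have "\<dots> = of_int Q * (\<Sum>n\<in>S. \<Sum>n'\<in>S. if Q dvd g n - g n' then a n * cnj (a n') else 0)"
    unfolding add_char_orth[OF assms] sum_distrib_left by (intro sum.cong refl) auto
  finally show ?thesis .
qed

text \<open>Since \<open>n - n'\<close> divides \<open>poly C n - poly C n'\<close>, the difference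
  quotient of \<open>P\<close> has the form \<open>1 + p * t\<close> and is prime to
  \<open>p\<close>.\<close>

lemma moment_like_dvd_iff:
  assumes p: "prime (p::int)" and P: "P = monom 1 1 + smult p C"
  shows "p ^ B dvd poly P n - poly P n' \<longleftrightarrow> p ^ B dvd n - n'"
proof -
  have "n - n' dvd poly C n - poly C n'"
  proof -
    have "[poly C n = poly C n'] (mod (n - n'))"
      unfolding poly_altdef by (intro cong_sum cong_mult cong_refl cong_pow) (simp add: cong_iff_dvd_diff)
    then show ?thesis by (simp add: cong_iff_dvd_diff)
  qed
  then obtain t where t: "poly C n - poly C n' = (n - n') * t" by (auto elim: dvdE)
  have "poly P n - poly P n' = (n - n') + p * (poly C n - poly C n')"
    by (simp add: P poly_monom algebra_simps)
  also have "\<dots> = (n - n') * (1 + p * t)" unfolding t by (simp add: algebra_simps)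
  finally have eq: "poly P n - poly P n' = (n - n') * (1 + p * t)" .
  have "coprime (p ^ B) (1 + p * t)"
  proof -
    have "\<not> p dvd 1 + p * t" using p by (metis dvd_add_left_iff dvd_triv_left not_prime_unit)
    then show ?thesis using p by (simp add: prime_imp_coprime)
  qed
  then show ?thesis unfolding eq by (simp add: coprime_dvd_mult_left_iff)
qed

text \<open>In dimension one the critical exponent is two and decoupling is orthogonality:
  frequencies from different classes modulo \<open>p^B\<close> do not interact, so the mean square
  is exactly the sum over the classes.\<close>

lemma decoupling_bound_1:
  assumes p: "prime p"
  shows "decoupling_bound p 1 B 1"
  unfolding decoupling_bound_def
proof (intro allI impI)
  fix P co S and lam :: "int \<Rightarrow> real"
  assume P: "moment_like p 1 P" and S: "finite S" and
    h: "\<forall>r\<in>{0..<p ^ B}. lam r > 0 \<and>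
        avg 1 (p ^ (1 * B)) (\<lambda>x. norm (exp_sum 1 (p ^ (1 * B)) P co (S \<inter> res_class p B r) x) ^ (2 * tri 1)) \<le> lam r ^ tri 1"
  let ?Q = "p ^ B"
  have p1: "p > 1" using p prime_gt_1_int by blast
  have tr1: "tri 1 = 1" by (simp add: tri_def)
  have Q: "?Q > 0" using p1 by simp
  obtain C where C: "P 1 = monom 1 1 + smult p C" using P by (auto simp: moment_like_def)
  define H where "H = (\<lambda>T. \<Sum>n\<in>T. \<Sum>n'\<in>T \<inter> res_class p B n. co n * cnj (co n'))"
  have avg: "complex_of_real (avg 1 ?Q (\<lambda>x. (norm (exp_sum 1 ?Q P co T x))\<^sup>2)) = H T" if T: "finite T" for T
  proof -
    have "complex_of_real (\<Sum>x\<in>int_box 1 ?Q. (norm (exp_sum 1 ?Q P co T x))\<^sup>2)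
       = complex_of_real (\<Sum>t\<in>{0..<?Q}. (norm (\<Sum>n\<in>T. co n * add_char ?Q (t * poly (P 1) n)))\<^sup>2)"
      using sum_int_box_1[of "\<lambda>t. (norm (\<Sum>n\<in>T. co n * add_char ?Q (t * poly (P 1) n)))\<^sup>2" ?Q]
      by (simp add: exp_sum_def)
    also have "\<dots> = of_int ?Q * (\<Sum>n\<in>T. \<Sum>n'\<in>T. if ?Q dvd poly (P 1) n - poly (P 1) n' then co n * cnj (co n') else 0)"
      by (rule parseval_cong[OF Q])
    also have "(\<Sum>n\<in>T. \<Sum>n'\<in>T. if ?Q dvd poly (P 1) n - poly (P 1) n' then co n * cnj (co n') else 0) = H T"
      unfolding H_def moment_like_dvd_iff[OF p C]
    proof (rule sum.cong[OF refl])
      fix n assume "n \<in> T"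
      have "T \<inter> res_class p B n = {n' \<in> T. ?Q dvd n - n'}"
        by (auto simp: res_class_def cong_iff_dvd_diff dvd_diff_commute)
      then show "(\<Sum>n'\<in>T. if ?Q dvd n - n' then co n * cnj (co n') else 0) = (\<Sum>n'\<in>T \<inter> res_class p B n. co n * cnj (co n'))"
        using T by (simp add: sum.inter_filter)
    qed
    finally show ?thesis using p1 by (simp add: avg_def)
  qed
  have HS: "H S = (\<Sum>r\<in>{0..<?Q}. H (S \<inter> res_class p B r))"
  proof -
    have "H S = (\<Sum>r\<in>subclasses p 0 B 0. \<Sum>n\<in>S \<inter> res_class p B r. \<Sum>n'\<in>S \<inter> res_class p B n. co n * cnj (co n'))"
      unfolding H_def using sum_res_class_split[OF p1 _ S, of 0 B "\<lambda>n. \<Sum>n'\<in>S \<inter> res_class p B n. co n * cnj (co n')" 0] by simp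
    also have "\<dots> = (\<Sum>r\<in>{0..<?Q}. H (S \<inter> res_class p B r))"
      unfolding subclasses_0 H_def
    proof (intro sum.cong refl)
      fix r n assume "n \<in> S \<inter> res_class p B r"
      then have "res_class p B n = res_class p B r" unfolding res_class_def using cong_sym cong_trans by blast
      then show "S \<inter> res_class p B n = S \<inter> res_class p B r \<inter> res_class p B n" by auto
    qed
    finally show ?thesis .
  qed
  have "complex_of_real (avg 1 ?Q (\<lambda>x. (norm (exp_sum 1 ?Q P co S x))\<^sup>2))
      = complex_of_real (\<Sum>r\<in>{0..<?Q}. avg 1 ?Q (\<lambda>x. (norm (exp_sum 1 ?Q P co (S \<inter> res_class p B r) x))\<^sup>2))"
    unfolding of_real_sum using avg S HS by simp
  then have "avg 1 ?Q (\<lambda>x. (norm (exp_sum 1 ?Q P co S x))\<^sup>2) = (\<Sum>r\<in>{0..<?Q}. avg 1 ?Q (\<lambda>x. (norm (exp_sum 1 ?Q P co (S \<inter> res_class p B r) x))\<^sup>2))"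
    using of_real_eq_iff by blast
  also have "\<dots> \<le> (\<Sum>r\<in>{0..<?Q}. lam r)"
    using h by (intro sum_mono) (auto simp: tr1 simp del: One_nat_def)
  finally show "avg 1 (p ^ (1 * B)) (\<lambda>x. norm (exp_sum 1 (p ^ (1 * B)) P co S x) ^ (2 * tri 1)) \<le> 1 * (\<Sum>r\<in>{0..<?Q}. lam r) ^ tri 1"
    by (simp add: tr1 del: One_nat_def)
qed

section \<open>Improvement of the exponent\<close>

lemma DecI_curve_sum:
  assumes "prime p" "int k < p" "k \<ge> 2"
    and "\<And>P co S lam. curve_sum p k B P co S lam \<Longrightarrow>
      avg k (p ^ (k * B)) (\<lambda>x. curve_sum.Y p k B P co S 0 0 x ^ tri k) \<le> K * curve_sum.U p B lam 0 0 ^ tri k"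
  shows "decoupling_bound p k B K"
  unfolding decoupling_bound_def
proof (intro allI impI)
  fix P co S and lam :: "int \<Rightarrow> real"
  assume "moment_like p k P" and "finite S" and
    "\<forall>r\<in>{0..<p ^ B}. lam r > 0 \<and>
        avg k (p ^ (k * B)) (\<lambda>x. norm (exp_sum k (p ^ (k * B)) P co (S \<inter> res_class p B r) x) ^ (2 * tri k)) \<le> lam r ^ tri k"
  then interpret curve_sum p k B P co S lam using assms(1-3) by unfold_locales auto
  show "avg k (p ^ (k * B)) (\<lambda>x. norm (exp_sum k (p ^ (k * B)) P co S x) ^ (2 * tri k)) \<le> K * (\<Sum>r\<in>{0..<p ^ B}. lam r) ^ tri k"
    using assms(4)[OF curve_sum_axioms] unfolding Y_power U_def by simp
qed

definition valid_exponent :: "int \<Rightarrow> nat \<Rightarrow> real \<Rightarrow> bool" where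
  "valid_exponent p k \<eta> \<longleftrightarrow> (\<exists>C. \<forall>B. decoupling_bound p k B (C * real_of_int p powr (\<eta> * B)))"

lemma valid_exponent_mono:
  assumes "valid_exponent p k \<eta>" "\<eta> \<le> \<zeta>" "p > 1"
  shows "valid_exponent p k \<zeta>"
proof -
  obtain C where C: "\<And>B. decoupling_bound p k B (C * real_of_int p powr (\<eta> * B))"
    using assms(1) by (auto simp: valid_exponent_def)
  have "C * real_of_int p powr (\<eta> * B) \<le> max C 0 * real_of_int p powr (\<zeta> * B)" for B :: nat
  proof -
    have "\<eta> * B \<le> \<zeta> * B" using assms(2) by (intro mult_right_mono) auto
    then have "real_of_int p powr (\<eta> * B) \<le> real_of_int p powr (\<zeta> * B)" using assms(3) by (intro powr_mono) auto
    then show ?thesis by (intro mult_mono) auto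
  qed
  then show ?thesis using decoupling_bound_mono C unfolding valid_exponent_def by blast
qed

text \<open>The saving \<theta> depends on the lower bound \<open>\<eta>0\<close> only, not on
  \<eta>, so it applies to exponents arbitrarily close to the infimum. The number \<open>n\<close>
  of rounds is such that the guaranteed gain \<open>n * \<eta> / k\<close> is at least
  \<open>tri k + 1\<close> whenever \<open>\<eta> \<ge> \<eta>0\<close>; \<theta> and the exponent
  allowed in lower dimensions are then read off from \<open>n\<close>.\<close>

lemma exponent_improve:
  fixes p :: int and \<eta>0 :: real
  assumes p: "prime p" "int k < p" and k: "k \<ge> 2"
    and low: "\<And>l \<epsilon>. 1 \<le> l \<Longrightarrow> l < k \<Longrightarrow> \<epsilon> > 0 \<Longrightarrow> valid_exponent p l \<epsilon>" and \<eta>0: "\<eta>0 > 0"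
  shows "\<exists>\<theta>>0. \<forall>\<eta>\<ge>\<eta>0. \<forall>\<zeta>>0. valid_exponent p k \<eta> \<longrightarrow> \<zeta> \<ge> \<eta> - \<theta> \<longrightarrow> valid_exponent p k \<zeta>"
proof -
  define q where "q = real_of_int p"
  have q1: "q > 1" using p prime_gt_1_int by (simp add: q_def)
  have p1: "p > 1" using q1 by (simp add: q_def)
  obtain n0 :: nat where n0: "real n0 > (tri k + 1) * k / \<eta>0" using reals_Archimedean2 by blast
  define n where "n = Suc n0"
  have n: "n * \<eta>0 / k \<ge> tri k + 1"
  proof -
    have "(tri k + 1) * k / \<eta>0 \<le> n" using n0 by (simp add: n_def)
    then show ?thesis using \<eta>0 k by (simp add: field_simps)
  qed
  define \<theta> where "\<theta> = 1 / (2 * real (k ^ n))"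
  define \<epsilon> where "\<epsilon> = \<theta> / n"
  have \<theta>: "\<theta> > 0" "2 * \<theta> * k ^ n \<le> 1" using k by (auto simp: \<theta>_def)
  have \<epsilon>: "\<epsilon> > 0" "n * \<epsilon> \<le> \<theta>" using \<theta> by (auto simp: \<epsilon>_def n_def)
  have "\<forall>l. \<exists>C. l \<in> {1..<k} \<longrightarrow> (\<forall>B. decoupling_bound p l B (C * q powr (\<epsilon> * B)))"
    using low \<epsilon> unfolding valid_exponent_def q_def by auto
  then obtain Cl where Cl: "\<And>l B. l \<in> {1..<k} \<Longrightarrow> decoupling_bound p l B (Cl l * q powr (\<epsilon> * B))" by metis
  define C1 where "C1 = 1 + (\<Sum>l\<in>{1..<k}. \<bar>Cl l\<bar>)"
  have C1: "C1 \<ge> 1" unfolding C1_def by (simp add: sum_nonneg)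
  have low1: "decoupling_bound p l B (C1 * q powr (\<epsilon> * B))" if "1 \<le> l" "l < k" for l B
  proof -
    have "Cl l \<le> \<bar>Cl l\<bar>" by simp
    also have "\<dots> \<le> (\<Sum>l\<in>{1..<k}. \<bar>Cl l\<bar>)" using that by (intro member_le_sum) auto
    finally have "Cl l \<le> C1" by (simp add: C1_def)
    then have "Cl l * q powr (\<epsilon> * B) \<le> C1 * q powr (\<epsilon> * B)" by (intro mult_right_mono) auto
    then show ?thesis using Cl that by (intro decoupling_bound_mono[OF Cl]) auto
  qed
  have "valid_exponent p k \<zeta>" if \<eta>: "\<eta> \<ge> \<eta>0" and \<zeta>: "\<zeta> > 0" "\<zeta> \<ge> \<eta> - \<theta>" and v: "valid_exponent p k \<eta>" for \<eta> \<zeta>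
  proof -
    obtain C0' where "\<And>B. decoupling_bound p k B (C0' * q powr (\<eta> * B))"
      using v by (auto simp: valid_exponent_def q_def)
    moreover define C0 where "C0 = max C0' 1"
    moreover have "C0' * q powr (\<eta> * B) \<le> C0 * q powr (\<eta> * B)" for B
      by (intro mult_right_mono) (auto simp: C0_def)
    ultimately have D: "\<And>B. decoupling_bound p k B (C0 * q powr (\<eta> * B))" using decoupling_bound_mono by blast
    have C0: "C0 > 0" by (simp add: C0_def)
    obtain l where l: "l \<in> {1..<k}" "gain k \<eta> n l \<ge> n * \<eta> / k" using gain_large[OF k] by blast
    have "n * \<eta>0 / k \<le> n * \<eta> / k" using \<eta> by (intro divide_right_mono mult_left_mono) auto
    then have g: "gain k \<eta> n l \<ge> tri k + 1" using l n by linarith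
    define C3 where "C3 = 2 * C0 * C1 ^ n * q powr (fact k ^ n) + 2 * C0 * q powr (\<eta> * (k ^ n * fact k ^ n))"
    have C3: "C3 \<ge> 0" using C0 C1 by (simp add: C3_def)
    define \<kappa> where "\<kappa> = q powr (\<zeta> / 2)"
    have \<kappa>: "\<kappa> > 1" using q1 \<zeta> by (simp add: \<kappa>_def)
    have trl: "tri l \<le> tri k" using l by (intro tri_mono) auto
    have trk: "tri k \<ge> 1" using k by (intro tri_pos) auto
    obtain C where C: "C \<ge> 0" and bn': "\<forall>(I :: int set) y. finite I \<longrightarrow> card I \<le> nat p \<longrightarrow> (\<forall>i\<in>I. y i \<ge> 0) \<longrightarrow>
     (\<Sum>i\<in>I. y i) ^ (2 * tri k) \<le> \<kappa> * (\<Sum>i\<in>I. y i ^ (2 * tri k))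
        + C * (\<Sum>i\<in>I. \<Sum>j\<in>I - {i}. y i ^ (2 * tri l) * y j ^ (2 * (tri k - tri l)))"
      using broad_narrow[OF \<kappa> trl trk, where N = "nat p" and 'a = int] by blast
    note bn = bn'[rule_format]
    \<comment> \<open>The induction on \<open>B\<close> may grow by \<open>q powr \<zeta>\<close>
      per step. The dominated part takes \<kappa>, half of this exponent, so the old constant
      returns with the factor \<rho> below one, and \<open>A\<close> absorbs the transversal
      contribution.\<close>
    define \<rho> where "\<rho> = q powr (- (\<zeta> / 2))"
    have \<rho>: "\<rho> < 1" using q1 \<zeta> by (simp add: \<rho>_def powr_less_one)
    define A where "A = max 1 (C * q\<^sup>2 * C3 / (1 - \<rho>))"
    have A: "A \<ge> 1" "\<rho> * A + C * q\<^sup>2 * C3 \<le> A"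
    proof -
      have "C * q\<^sup>2 * C3 / (1 - \<rho>) \<le> A" by (simp add: A_def)
      then have "C * q\<^sup>2 * C3 \<le> A * (1 - \<rho>)" using \<rho> by (simp add: pos_divide_le_eq)
      then show "\<rho> * A + C * q\<^sup>2 * C3 \<le> A" by (simp add: algebra_simps)
    qed (simp add: A_def)
    have "decoupling_bound p k B (A * q powr (\<zeta> * B))" for B
    proof (induction B)
      case 0
      then show ?case using A q1 by (intro decoupling_bound_0) auto
    next
      case (Suc B)
      show ?case
      proof (rule DecI_curve_sum[OF p k])
        fix P co S and lam :: "int \<Rightarrow> real"
        assume "curve_sum p k (Suc B) P co S lam"
        then interpret curve_sum p k "Suc B" P co S lam .
        have bilinear_bound: "bilinear_bound l 1 1 (C3 * q powr (\<zeta> * Suc B))"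
          unfolding C3_def q_def
          by (rule bilinear_gain[OF D[unfolded q_def] low1[unfolded q_def]])
             (use C0 C1 \<epsilon> \<eta> \<eta>0 \<theta> \<zeta> l g in \<open>auto simp: n_def less_imp_le\<close>)
        have "E (\<lambda>x. Y 0 0 x ^ tri k) \<le> (\<kappa> * (A * q powr (\<zeta> * B)) + C * (real_of_int p)\<^sup>2 * (C3 * q powr (\<zeta> * Suc B))) * U 0 0 ^ tri k"
          by (rule bilinear_to_linear[OF _ _ _ _ bilinear_bound _ _ C bn])
             (use Suc.IH l A C3 \<kappa> in auto)
        also have "\<dots> \<le> (A * q powr (\<zeta> * Suc B)) * U 0 0 ^ tri k"
        proof (intro mult_right_mono)
          have "\<kappa> * q powr (\<zeta> * B) = \<rho> * q powr (\<zeta> * Suc B)"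
            using q1 by (simp add: \<kappa>_def \<rho>_def algebra_simps flip: powr_add)
          then have "\<kappa> * (A * q powr (\<zeta> * B)) + C * (real_of_int p)\<^sup>2 * (C3 * q powr (\<zeta> * Suc B))
            = (\<rho> * A + C * q\<^sup>2 * C3) * q powr (\<zeta> * Suc B)"
            by (simp add: q_def algebra_simps)
          also have "\<dots> \<le> A * q powr (\<zeta> * Suc B)" using A by (intro mult_right_mono) auto
          finally show "\<kappa> * (A * q powr (\<zeta> * B)) + C * (real_of_int p)\<^sup>2 * (C3 * q powr (\<zeta> * Suc B)) \<le> A * q powr (\<zeta> * Suc B)" .
        qed (use U_pos[of 0 0] in simp)
        finally show "E (\<lambda>x. Y 0 0 x ^ tri k) \<le> (A * q powr (\<zeta> * Suc B)) * U 0 0 ^ tri k" .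
      qed
    qed
    then show ?thesis by (auto simp: valid_exponent_def q_def)
  qed
  then show ?thesis using \<theta>(1) by blast
qed

theorem decoupling:
  fixes p :: int
  assumes "prime p" "int k < p" "k \<ge> 1" "\<eta> > 0"
  shows "valid_exponent p k \<eta>"
  using assms
proof (induction k arbitrary: \<eta> rule: less_induct)
  case (less k)
  have p1: "p > 1" using less.prems prime_gt_1_int by blast
  show ?case
  proof (cases "k = 1")
    case True
    have "decoupling_bound p 1 B (1 * real_of_int p powr (\<eta> * B))" for B
      using less.prems p1 by (intro decoupling_bound_mono[OF decoupling_bound_1]) (auto intro!: ge_one_powr_ge_zero)
    then show ?thesis unfolding True valid_exponent_def by blast
  next
    case False
    then have k: "k \<ge> 2" using less.prems by simp
    define H where "H = {\<eta>. \<eta> > 0 \<and> valid_exponent p k \<eta>}"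
    have bdd: "bdd_below H" by (rule bdd_belowI[of _ 0]) (auto simp: H_def)
    have "2 * real (tri k) \<in> H"
    proof -
      have "\<forall>B. decoupling_bound p k B (1 * real_of_int p powr (2 * real (tri k) * real B))"
        using decoupling_bound_crude[OF p1, of k] less.prems by (simp add: algebra_simps)
      then show ?thesis using tri_pos[of k] k unfolding H_def valid_exponent_def by (auto intro: exI[of _ 1])
    qed
    then have ne: "H \<noteq> {}" by blast
    show ?thesis
    proof (rule ccontr)
      assume nv: "\<not> valid_exponent p k \<eta>"
      have "\<eta> \<le> x" if "x \<in> H" for x
        using that nv valid_exponent_mono[OF _ _ p1, of k x \<eta>] unfolding H_def by force
      then have "\<eta> \<le> Inf H" using ne by (intro cInf_greatest)
      then have h: "Inf H > 0" using less.prems by simp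
      obtain \<theta> where \<theta>: "\<theta> > 0" "\<forall>\<eta>\<ge>Inf H. \<forall>\<zeta>>0. valid_exponent p k \<eta> \<longrightarrow> \<zeta> \<ge> \<eta> - \<theta> \<longrightarrow> valid_exponent p k \<zeta>"
        using exponent_improve[OF less.prems(1,2) k _ h] less.IH less.prems by force
      obtain x where x: "x \<in> H" "x < Inf H + \<theta>"
        using cInf_lessD[OF ne, of "Inf H + \<theta>"] \<theta>(1) by auto
      have "Inf H \<le> x" using x bdd by (intro cInf_lower)
      \<comment> \<open>The improvement delivers positive exponents only; the second entry of the
        maximum keeps \<zeta> positive and still below the infimum.\<close>
      define \<zeta> where "\<zeta> = max (x - \<theta>) (Inf H / 2)"
      have \<zeta>: "\<zeta> > 0" "\<zeta> \<ge> x - \<theta>" "\<zeta> < Inf H" using h x \<theta>(1) by (auto simp: \<zeta>_def)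
      have "valid_exponent p k x" using x(1) by (simp add: H_def)
      then have "valid_exponent p k \<zeta>" using \<theta>(2) \<open>Inf H \<le> x\<close> \<zeta>(1,2) by blast
      then have "\<zeta> \<in> H" using \<zeta>(1) unfolding H_def by blast
      then have "Inf H \<le> \<zeta>" using bdd by (intro cInf_lower)
      then show False using \<zeta>(3) by simp
    qed
  qed
qed

section \<open>Counting solutions of systems\<close>

text \<open>The first \<open>s\<close> variables count positively, the last \<open>s\<close>
  negatively. A single index set lets the \<open>2s\<close>-th power of a sum be expanded as one
  product.\<close>

definition signed_sum :: "nat \<Rightarrow> (nat \<Rightarrow> int) \<Rightarrow> (int \<Rightarrow> int) \<Rightarrow> int" where
  "signed_sum s x g = (\<Sum>i<2 * s. (if i < s then 1 else - 1) * g (x i))"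

definition tuples :: "nat \<Rightarrow> int set \<Rightarrow> (nat \<Rightarrow> int) set" where
  "tuples s S = PiE {..<2 * s} (\<lambda>_. S)"

lemma finite_tuples [simp]: "finite S \<Longrightarrow> finite (tuples s S)"
  by (simp add: tuples_def finite_PiE)

lemma card_tuples: "finite S \<Longrightarrow> card (tuples s S) = card S ^ (2 * s)"
  by (simp add: tuples_def card_PiE)

lemma signed_sum_cong: "x \<in> tuples s S \<Longrightarrow> (\<And>n. n \<in> S \<Longrightarrow> g n = h n) \<Longrightarrow> signed_sum s x g = signed_sum s x h"
  unfolding signed_sum_def tuples_def by (intro sum.cong refl arg_cong2[where f = "(*)"]) (auto simp: PiE_def Pi_def)

lemma signed_sum_add: "signed_sum s x (\<lambda>n. g n + h n) = signed_sum s x g + signed_sum s x h"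
  by (simp add: signed_sum_def algebra_simps sum.distrib)

lemma signed_sum_cmult: "signed_sum s x (\<lambda>n. a * g n) = a * signed_sum s x g"
  by (simp add: signed_sum_def sum_distrib_left algebra_simps)

lemma signed_sum_sum: "signed_sum s x (\<lambda>n. \<Sum>j\<in>J. g j n) = (\<Sum>j\<in>J. signed_sum s x (g j))"
  unfolding signed_sum_def by (simp add: sum_distrib_left, subst sum.swap) simp

lemma signed_sum_const: "signed_sum s x (\<lambda>n. a) = 0"
proof -
  have "{..<2 * s} = {..<s} \<union> {s..<2 * s}" "{..<s} \<inter> {s..<2 * s} = {}" by auto
  then have "signed_sum s x (\<lambda>n. a) = (\<Sum>i\<in>{..<s}. (if i < s then 1 else - 1) * a) + (\<Sum>i\<in>{s..<2 * s}. (if i < s then 1 else - 1) * a)"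
    unfolding signed_sum_def by (metis (no_types, lifting) finite_atLeastLessThan finite_lessThan sum.union_disjoint)
  also have "(\<Sum>i\<in>{..<s}. (if i < s then 1 else - 1) * a) = (\<Sum>i\<in>{..<s}. a)" by (intro sum.cong) auto
  also have "(\<Sum>i\<in>{s..<2 * s}. (if i < s then 1 else - 1) * a) = (\<Sum>i\<in>{s..<2 * s}. - a)" by (intro sum.cong) auto
  finally show ?thesis by simp
qed

lemma signed_sum_bound:
  assumes "x \<in> tuples s S" "\<And>n. n \<in> S \<Longrightarrow> \<bar>g n\<bar> \<le> A"
  shows "\<bar>signed_sum s x g\<bar> \<le> 2 * int s * A"
proof -
  have "\<bar>signed_sum s x g\<bar> \<le> (\<Sum>i<2 * s. \<bar>(if i < s then 1 else - 1) * g (x i)\<bar>)"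
    unfolding signed_sum_def by (rule sum_abs)
  also have "\<dots> \<le> (\<Sum>i<2 * s. A)"
    using assms by (intro sum_mono) (auto simp: tuples_def PiE_def Pi_def abs_mult)
  finally show ?thesis by simp
qed

lemma signed_sum_poly_zero:
  assumes h: "\<And>j. j \<in> {1..<r} \<Longrightarrow> signed_sum s x (\<lambda>n. u n ^ j) = 0" and deg: "degree A < r"
  shows "signed_sum s x (\<lambda>n. poly A (u n)) = 0"
proof -
  have "signed_sum s x (\<lambda>n. poly A (u n)) = (\<Sum>j\<le>degree A. coeff A j * signed_sum s x (\<lambda>n. u n ^ j))"
    unfolding poly_altdef by (simp add: signed_sum_sum signed_sum_cmult)
  also have "\<dots> = 0"
  proof (intro sum.neutral ballI)
    fix j assume "j \<in> {..degree A}"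
    then show "coeff A j * signed_sum s x (\<lambda>n. u n ^ j) = 0"
      using h[of j] deg signed_sum_const[of s x 1] by (cases "j = 0") auto
  qed
  finally show ?thesis .
qed

lemma norm_power_eq_sum_tuples:
  assumes S: "finite S"
  shows "complex_of_real (norm (\<Sum>n\<in>S. add_char Q (g n)) ^ (2 * s)) = (\<Sum>x\<in>tuples s S. add_char Q (signed_sum s x g))"
proof -
  let ?Z = "\<Sum>n\<in>S. add_char Q (g n)"
  have "complex_of_real (norm ?Z ^ (2 * s)) = (?Z * cnj ?Z) ^ s"
    by (simp only: power_mult of_real_power complex_norm_square[symmetric])
  also have "\<dots> = ?Z ^ s * cnj ?Z ^ s" by (rule power_mult_distrib)
  also have "cnj ?Z = (\<Sum>n\<in>S. add_char Q (- g n))" by (simp add: cnj_add_char)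
  also have "?Z ^ s * (\<Sum>n\<in>S. add_char Q (- g n)) ^ s
     = (\<Prod>i<2 * s. \<Sum>n\<in>S. add_char Q ((if i < s then 1 else - 1) * g n))"
  proof -
    let ?w = "\<lambda>i. \<Sum>n\<in>S. add_char Q ((if i < s then 1 else - 1) * g n)"
    have "{..<2 * s} = {..<s} \<union> {s..<2 * s}" "{..<s} \<inter> {s..<2 * s} = {}" by auto
    then have "(\<Prod>i<2 * s. ?w i) = (\<Prod>i\<in>{..<s}. ?w i) * (\<Prod>i\<in>{s..<2 * s}. ?w i)"
      by (simp add: prod.union_disjoint)
    also have "(\<Prod>i\<in>{..<s}. ?w i) = ?Z ^ s" by simp
    also have "(\<Prod>i\<in>{s..<2 * s}. ?w i) = (\<Sum>n\<in>S. add_char Q (- g n)) ^ s" by simp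
    finally show ?thesis by simp
  qed
  also have "\<dots> = (\<Sum>x\<in>tuples s S. \<Prod>i<2 * s. add_char Q ((if i < s then 1 else - 1) * g (x i)))"
    unfolding tuples_def using S by (intro prod_sum_PiE) auto
  also have "\<dots> = (\<Sum>x\<in>tuples s S. add_char Q (signed_sum s x g))"
    unfolding signed_sum_def by (simp only: add_char_sum)
  finally show ?thesis .
qed

lemma sum_int_box_add_char:
  assumes "Q > 0"
  shows "(\<Sum>x\<in>int_box k Q. add_char Q (\<Sum>i=1..k. x i * t i)) = (if \<forall>i\<in>{1..k}. Q dvd t i then of_int Q ^ k else 0)"
proof -
  have "(\<Sum>x\<in>int_box k Q. add_char Q (\<Sum>i=1..k. x i * t i)) = (\<Sum>x\<in>int_box k Q. \<Prod>i=1..k. add_char Q (x i * t i))"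
    by (simp only: add_char_sum)
  also have "\<dots> = (\<Prod>i=1..k. \<Sum>y\<in>{0..<Q}. add_char Q (y * t i))"
    unfolding int_box_def by (intro prod_sum_PiE[symmetric]) auto
  also have "\<dots> = (\<Prod>i=1..k. if Q dvd t i then of_int Q else 0)"
    using assms by (simp add: add_char_orth)
  also have "\<dots> = (if \<forall>i\<in>{1..k}. Q dvd t i then of_int Q ^ k else 0)"
  proof (cases "\<forall>i\<in>{1..k}. Q dvd t i")
    case False
    then obtain i where "i \<in> {1..k}" "\<not> Q dvd t i" by blast
    then show ?thesis using False by (intro prod_zero[THEN trans]) auto
  qed simp
  finally show ?thesis .
qed

definition system_sols :: "nat \<Rightarrow> nat \<Rightarrow> int \<Rightarrow> (nat \<Rightarrow> int poly) \<Rightarrow> int set \<Rightarrow> (nat \<Rightarrow> int) \<Rightarrow> (nat \<Rightarrow> int) set" where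
  "system_sols s k Q P S h = {x \<in> tuples s S. \<forall>i\<in>{1..k}. Q dvd signed_sum s x (poly (P i)) - h i}"

lemma card_system_sols:
  assumes Q: "Q > 0" and S: "finite S"
  shows "complex_of_real (card (system_sols s k Q P S h)) * of_int Q ^ k =
    (\<Sum>y\<in>int_box k Q. add_char Q (\<Sum>i=1..k. y i * (- h i)) * complex_of_real (norm (exp_sum k Q P (\<lambda>_. 1) S y) ^ (2 * s)))"
proof -
  have "complex_of_real (card (system_sols s k Q P S h)) * of_int Q ^ k
     = (\<Sum>x\<in>tuples s S. if \<forall>i\<in>{1..k}. Q dvd signed_sum s x (poly (P i)) - h i then of_int Q ^ k else 0)"
    unfolding system_sols_def using S by (simp add: sum.If_cases Int_def)
  also have "\<dots> = (\<Sum>x\<in>tuples s S. \<Sum>y\<in>int_box k Q. add_char Q (\<Sum>i=1..k. y i * (signed_sum s x (poly (P i)) - h i)))"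
    by (simp only: sum_int_box_add_char[OF Q])
  also have "\<dots> = (\<Sum>y\<in>int_box k Q. \<Sum>x\<in>tuples s S. add_char Q (\<Sum>i=1..k. y i * (signed_sum s x (poly (P i)) - h i)))"
    by (rule sum.swap)
  also have "\<dots> = (\<Sum>y\<in>int_box k Q. add_char Q (\<Sum>i=1..k. y i * (- h i)) * complex_of_real (norm (exp_sum k Q P (\<lambda>_. 1) S y) ^ (2 * s)))"
  proof (rule sum.cong[OF refl])
    fix y
    have "add_char Q (\<Sum>i=1..k. y i * (signed_sum s x (poly (P i)) - h i))
      = add_char Q (\<Sum>i=1..k. y i * (- h i)) * add_char Q (signed_sum s x (\<lambda>n. \<Sum>i=1..k. y i * poly (P i) n))" for x
      unfolding signed_sum_sum signed_sum_cmult add_char_add[symmetric] sum.distrib[symmetric]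
      by (simp add: algebra_simps)
    then show "(\<Sum>x\<in>tuples s S. add_char Q (\<Sum>i=1..k. y i * (signed_sum s x (poly (P i)) - h i)))
       = add_char Q (\<Sum>i=1..k. y i * (- h i)) * complex_of_real (norm (exp_sum k Q P (\<lambda>_. 1) S y) ^ (2 * s))"
      unfolding exp_sum_def using norm_power_eq_sum_tuples[OF S, of Q "\<lambda>n. \<Sum>i=1..k. y i * poly (P i) n" s]
      by (simp add: sum_distrib_left)
  qed
  finally show ?thesis .
qed

lemma card_system_sols_0:
  assumes Q: "Q > 0" and S: "finite S"
  shows "real (card (system_sols s k Q P S (\<lambda>_. 0))) = avg k Q (\<lambda>y. norm (exp_sum k Q P (\<lambda>_. 1) S y) ^ (2 * s))"
proof -
  have "complex_of_real (card (system_sols s k Q P S (\<lambda>_. 0)) * of_int Q ^ k)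
      = complex_of_real (\<Sum>y\<in>int_box k Q. norm (exp_sum k Q P (\<lambda>_. 1) S y) ^ (2 * s))"
    using card_system_sols[OF assms, of s k P "\<lambda>_. 0"] by simp
  then have "card (system_sols s k Q P S (\<lambda>_. 0)) * of_int Q ^ k = (\<Sum>y\<in>int_box k Q. norm (exp_sum k Q P (\<lambda>_. 1) S y) ^ (2 * s))"
    using of_real_eq_iff by blast
  then show ?thesis using Q by (simp add: avg_def eq_divide_eq)
qed

text \<open>In the Fourier representation of the count the shift \<open>h\<close> occurs only in a
  factor of modulus one in front of a nonnegative function, so the homogeneous system has the most
  solutions.\<close>

lemma card_system_sols_le:
  assumes Q: "Q > 0" and S: "finite S"
  shows "real (card (system_sols s k Q P S h)) \<le> real (card (system_sols s k Q P S (\<lambda>_. 0)))"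
proof -
  have "real (card (system_sols s k Q P S h)) * of_int Q ^ k = norm (complex_of_real (card (system_sols s k Q P S h)) * of_int Q ^ k)"
    using Q by (simp add: norm_mult norm_power)
  also have "\<dots> \<le> (\<Sum>y\<in>int_box k Q. norm (exp_sum k Q P (\<lambda>_. 1) S y) ^ (2 * s))"
    unfolding card_system_sols[OF assms] by (rule order_trans[OF norm_sum]) (simp add: norm_mult norm_power)
  finally have "real (card (system_sols s k Q P S h)) \<le> avg k Q (\<lambda>y. norm (exp_sum k Q P (\<lambda>_. 1) S y) ^ (2 * s))"
    using Q by (simp add: avg_def pos_le_divide_eq)
  then show ?thesis by (simp add: card_system_sols_0[OF assms])
qed

text \<open>No class modulo \<open>p^B\<close> contains two points of \<open>S\<close>, so every
  piece is bounded by one and all weights may be one; their sum is \<open>p^B\<close>.\<close>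

lemma card_system_sols_decoupling:
  assumes D: "decoupling_bound p r B K" and P: "moment_like p r P" and p: "p > 1"
    and S: "finite S" and sep: "\<And>n n'. n \<in> S \<Longrightarrow> n' \<in> S \<Longrightarrow> [n = n'] (mod p ^ B) \<Longrightarrow> n = n'"
  shows "real (card (system_sols (tri r) r (p ^ (r * B)) P S h)) \<le> K * real_of_int p ^ (B * tri r)"
proof -
  let ?Q = "p ^ (r * B)"
  have Q: "?Q > 0" using p by simp
  have one: "norm (exp_sum r ?Q P (\<lambda>_. 1) (S \<inter> res_class p B c) x) \<le> 1" for c x
  proof -
    have "norm (exp_sum r ?Q P (\<lambda>_. 1) (S \<inter> res_class p B c) x) \<le> (\<Sum>n\<in>S \<inter> res_class p B c. 1)"
      unfolding exp_sum_def by (rule order_trans[OF norm_sum]) simp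
    also have "\<dots> = card (S \<inter> res_class p B c)" by simp
    also have "card (S \<inter> res_class p B c) \<le> 1"
    proof -
      have "n = n'" if "n \<in> S \<inter> res_class p B c" "n' \<in> S \<inter> res_class p B c" for n n'
        using that sep[of n n'] by (auto simp: res_class_def) (meson cong_sym cong_trans)
      then show ?thesis using S by (metis One_nat_def card_le_Suc0_iff_eq finite_Int)
    qed
    finally show ?thesis by simp
  qed
  have "real (card (system_sols (tri r) r ?Q P S h)) \<le> avg r ?Q (\<lambda>y. norm (exp_sum r ?Q P (\<lambda>_. 1) S y) ^ (2 * tri r))"
    using card_system_sols_le[OF Q S] card_system_sols_0[OF Q S] by simp
  also have "\<dots> \<le> K * (\<Sum>c\<in>{0..<p ^ B}. 1) ^ tri r"
  proof -
    have "avg r ?Q (\<lambda>x. norm (exp_sum r ?Q P (\<lambda>_. 1) (S \<inter> res_class p B c) x) ^ (2 * tri r)) \<le> 1" for c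
    proof -
      have "avg r ?Q (\<lambda>x. norm (exp_sum r ?Q P (\<lambda>_. 1) (S \<inter> res_class p B c) x) ^ (2 * tri r)) \<le> avg r ?Q (\<lambda>x. 1)"
        by (intro avg_mono Q power_le_one one norm_ge_zero)
      then show ?thesis using Q by simp
    qed
    then show ?thesis
      by (intro D[unfolded decoupling_bound_def, rule_format, OF P S, of "\<lambda>_. 1" "\<lambda>_. 1"]) simp
  qed
  also have "\<dots> = K * real_of_int p ^ (B * tri r)" using p by (simp add: power_mult)
  finally show ?thesis .
qed

section \<open>Degenerate residue classes\<close>

text \<open>Lagrange's bound by splitting off a root. The leading coefficient may be divisible by
  \<open>p\<close>, so it is only asked that some coefficient is not; this property passes to the
  quotient.\<close>

lemma card_roots_mod_prime:
  fixes p :: int and D :: "int poly"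
  assumes p: "prime p"
  shows "\<not> p dvd coeff D j \<Longrightarrow> card {c \<in> {0..<p}. p dvd poly D c} \<le> degree D"
proof (induction "degree D" arbitrary: D j)
  case 0
  then have "D = [:coeff D 0:]" by (metis degree_eq_zeroE coeff_pCons_0)
  moreover have "j = 0" using 0 by (metis coeff_eq_0 dvd_0_right gr0I)
  ultimately have "poly D c = coeff D j" for c by (metis mult_zero_right poly_0 poly_pCons add.right_neutral)
  then have eq: "{c \<in> {0..<p}. p dvd poly D c} = {}" using 0(2) by auto
  show ?case unfolding eq by simp
next
  case (Suc d)
  show ?case
  proof (cases "{c \<in> {0..<p}. p dvd poly D c} = {}")
    case False
    then obtain a where a: "a \<in> {0..<p}" "p dvd poly D a" by blast
    define D1 where "D1 = synthetic_div D a"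
    have D: "D = [:-a, 1:] * D1 + [:poly D a:]" unfolding D1_def by (rule synthetic_div_correct'[symmetric])
    have deg: "degree D1 = d" using Suc(2) by (simp add: D1_def degree_synthetic_div)
    have "\<exists>i. \<not> p dvd coeff D1 i"
    proof (rule ccontr)
      assume "\<not> ?thesis"
      then have all: "p dvd coeff D1 i" for i by blast
      have "coeff D j = - a * coeff D1 j + (if j = 0 then 0 else coeff D1 (j - 1)) + (if j = 0 then poly D a else 0)"
        by (subst D) (auto simp: coeff_pCons split: nat.splits)
      then show False using Suc(3) all a(2) by (cases "j = 0") auto
    qed
    then obtain i where "\<not> p dvd coeff D1 i" by blast
    then have IH: "card {c \<in> {0..<p}. p dvd poly D1 c} \<le> d" using Suc(1)[of D1 i] deg by simp
    have "{c \<in> {0..<p}. p dvd poly D c} \<subseteq> insert a {c \<in> {0..<p}. p dvd poly D1 c}"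
    proof
      fix c assume c: "c \<in> {c \<in> {0..<p}. p dvd poly D c}"
      have "poly D c = (c - a) * poly D1 c + poly D a" by (subst D) (simp add: algebra_simps)
      then have "p dvd (c - a) * poly D1 c" using c a(2) by (simp add: dvd_add_left_iff)
      then have "p dvd c - a \<or> p dvd poly D1 c" using p prime_dvd_mult_iff by blast
      moreover have "c = a" if "p dvd c - a"
        using that c a by (auto simp: mod_eq_dvd_iff[symmetric])
      ultimately show "c \<in> insert a {c \<in> {0..<p}. p dvd poly D1 c}" using c by blast
    qed
    moreover have fin: "finite {c \<in> {0..<p}. p dvd poly D1 c}" by (rule finite_subset[of _ "{0..<p}"]) auto
    ultimately have "card {c \<in> {0..<p}. p dvd poly D c} \<le> card (insert a {c \<in> {0..<p}. p dvd poly D1 c})"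
      by (intro card_mono finite.insertI)
    also have "\<dots> \<le> Suc (card {c \<in> {0..<p}. p dvd poly D1 c})" unfolding card_insert_if[OF fin] by simp
    finally show ?thesis using IH Suc(2) by simp
  next
    case True
    show ?thesis unfolding True by simp
  qed
qed

lemma taylor_coeff_higher_pderiv: "taylor_coeff c ((pderiv ^^ r) A) j = pochhammer (of_nat (Suc j)) r * taylor_coeff c A (j + r)"
proof (induction r arbitrary: j)
  case (Suc r)
  have "taylor_coeff c ((pderiv ^^ Suc r) A) j = of_nat (Suc j) * taylor_coeff c ((pderiv ^^ r) A) (Suc j)"
    by (simp add: taylor_coeff_pderiv)
  also have "\<dots> = of_nat (Suc j) * pochhammer (of_nat (Suc (Suc j))) r * taylor_coeff c A (Suc j + r)"
    unfolding Suc.IH by (simp add: mult.assoc)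
  also have "of_nat (Suc j) * pochhammer (of_nat (Suc (Suc j)) :: int) r = pochhammer (of_nat (Suc j)) (Suc r)"
    by (simp add: pochhammer_rec add.commute)
  finally show ?case by simp
qed simp

lemma not_dvd_pochhammer:
  fixes p :: int
  assumes p: "prime p" and "int (j + r) < p"
  shows "\<not> p dvd pochhammer (of_nat (Suc j)) r"
proof -
  have "\<not> p dvd of_nat (Suc j) + of_nat i" if "i < r" for i
    using assms that by (intro zdvd_not_zless) auto
  then show ?thesis
    unfolding pochhammer_prod using p by (auto simp: prime_dvd_prod_iff)
qed

text \<open>As a function of \<open>c\<close>, the \<open>r\<close>-th Taylor coefficient times
  \<open>r!\<close> is the \<open>r\<close>-th derivative of \<open>g\<close>. For
  \<open>p > d\<close> the factors produced by differentiation are units, so the coefficient of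
  order \<open>j \<ge> r\<close> prime to \<open>p\<close> survives and the derivative has at most
  \<open>d\<close> roots modulo \<open>p\<close>.\<close>

lemma card_bad_classes:
  fixes p :: int
  assumes p: "prime p" and d: "degree g \<le> d" "int d < p" and j: "j \<ge> r" "\<not> p dvd coeff g j"
  shows "card {c \<in> {0..<p}. p dvd taylor_coeff c g r} \<le> d"
proof -
  define D where "D = (pderiv ^^ r) g"
  have "j \<le> d" using j d by (metis coeff_eq_0 dvd_0_right le_trans not_le)
  then have "\<not> p dvd pochhammer (int (Suc (j - r))) r" using d j by (intro not_dvd_pochhammer p) auto
  then have "\<not> p dvd coeff D (j - r)"
    using p j by (simp add: D_def coeff_higher_pderiv prime_dvd_mult_iff)
  then have "card {c \<in> {0..<p}. p dvd poly D c} \<le> degree D" by (rule card_roots_mod_prime[OF p])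
  also have "\<dots> \<le> d" using d by (simp add: D_def degree_higher_pderiv)
  finally have le: "card {c \<in> {0..<p}. p dvd poly D c} \<le> d" .
  have "p dvd taylor_coeff c g r \<Longrightarrow> p dvd poly D c" for c
  proof -
    have "poly D c = taylor_coeff c D 0" by (simp add: taylor_coeff_def poly_0_coeff_0[symmetric] poly_pcompose)
    then show "p dvd taylor_coeff c g r \<Longrightarrow> p dvd poly D c" unfolding D_def taylor_coeff_higher_pderiv by simp
  qed
  then have "{c \<in> {0..<p}. p dvd taylor_coeff c g r} \<subseteq> {c \<in> {0..<p}. p dvd poly D c}" by auto
  moreover have "finite {c \<in> {0..<p}. p dvd poly D c}" by (rule finite_subset[of _ "{0..<p}"]) auto
  ultimately have "card {c \<in> {0..<p}. p dvd taylor_coeff c g r} \<le> card {c \<in> {0..<p}. p dvd poly D c}"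
    by (intro card_mono)
  with le show ?thesis by linarith
qed

lemma remove_prime_power:
  fixes H :: "int poly"
  assumes p: "p > 1" and H: "H \<noteq> 0"
  shows "\<exists>v H'. H = smult (p ^ v) H' \<and> (\<exists>j. \<not> p dvd coeff H' j)"
  using H
proof (induction "nat \<bar>lead_coeff H\<bar>" arbitrary: H rule: less_induct)
  case less
  show ?case
  proof (cases "\<exists>j. \<not> p dvd coeff H j")
    case True
    then show ?thesis by (intro exI[of _ 0] exI[of _ H]) auto
  next
    case False
    then have "[:p:] dvd H" by (simp add: const_poly_dvd_iff)
    then obtain H1 where H1: "H = smult p H1" by (auto elim!: dvdE)
    have ne: "H1 \<noteq> 0" using less.prems H1 by auto
    have "lead_coeff H = p * lead_coeff H1" using p by (simp add: H1 lead_coeff_smult)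
    then have "\<bar>lead_coeff H1\<bar> < \<bar>lead_coeff H\<bar>" using p ne by (simp add: abs_mult)
    then have "nat \<bar>lead_coeff H1\<bar> < nat \<bar>lead_coeff H\<bar>" by linarith
    from less.hyps[OF this ne] obtain v H' where "H1 = smult (p ^ v) H'" "\<exists>j. \<not> p dvd coeff H' j" by blast
    then show ?thesis using H1 by (intro exI[of _ "Suc v"] exI[of _ H']) auto
  qed
qed

text \<open>The powers below \<open>r\<close> accompany \<open>g\<close> because their equations
  make the system invariant under affine changes of the variable: all terms of \<open>g\<close> of
  degree below \<open>r\<close> become invisible.\<close>

definition vinogradov_system :: "nat \<Rightarrow> int poly \<Rightarrow> nat \<Rightarrow> int poly" where
  "vinogradov_system r g j = (if j < r then monom 1 j else g)"

definition vinogradov_sols :: "nat \<Rightarrow> int poly \<Rightarrow> int set \<Rightarrow> (nat \<Rightarrow> int) set" where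
  "vinogradov_sols r g S = {x \<in> tuples (tri r) S. \<forall>j\<in>{1..r}. signed_sum (tri r) x (poly (vinogradov_system r g j)) = 0}"

lemma poly_monom_fun: "poly (monom 1 j) = (\<lambda>n::int. n ^ j)"
  by (simp add: poly_monom fun_eq_iff)

lemma vinogradov_sols_iff:
  assumes "r \<ge> 1"
  shows "x \<in> vinogradov_sols r g S \<longleftrightarrow> x \<in> tuples (tri r) S \<and> (\<forall>j\<in>{1..<r}. signed_sum (tri r) x (\<lambda>n. n ^ j) = 0) \<and> signed_sum (tri r) x (poly g) = 0"
proof -
  have "{1..r} = insert r {1..<r}" using assms by auto
  then show ?thesis unfolding vinogradov_sols_def
    by (auto simp: vinogradov_system_def poly_monom_fun)
qed

lemma finite_vinogradov_sols [simp]: "finite S \<Longrightarrow> finite (vinogradov_sols r g S)"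
  by (simp add: vinogradov_sols_def)

text \<open>The values on the finite set \<open>S\<close> are bounded, so a congruence modulo a
  larger \<open>Q\<close> is an equality. The threshold is uniform in the subsets \<open>T\<close>
  and in the bounded shifts \<open>h\<close>.\<close>

lemma system_sols_eq_exact:
  assumes S: "finite S"
  shows "\<exists>Q0. \<forall>Q>Q0. \<forall>T\<subseteq>S. \<forall>h. (\<forall>i\<in>{1..k}. \<bar>h i\<bar> \<le> H) \<longrightarrow>
     system_sols s k Q P T h = {x \<in> tuples s T. \<forall>i\<in>{1..k}. signed_sum s x (poly (P i)) = h i}"
proof -
  define A where "A = (\<Sum>n\<in>S. \<Sum>i\<in>{1..k}. \<bar>poly (P i) n\<bar>)"
  have A: "\<bar>poly (P i) n\<bar> \<le> A" if "n \<in> S" "i \<in> {1..k}" for n i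
  proof -
    have "\<bar>poly (P i) n\<bar> \<le> (\<Sum>i\<in>{1..k}. \<bar>poly (P i) n\<bar>)" using that by (intro member_le_sum) auto
    also have "\<dots> \<le> A" unfolding A_def using that S
      by (intro member_le_sum[where f = "\<lambda>n. \<Sum>i\<in>{1..k}. \<bar>poly (P i) n\<bar>"]) (auto intro!: sum_nonneg)
    finally show ?thesis .
  qed
  have "system_sols s k Q P T h = {x \<in> tuples s T. \<forall>i\<in>{1..k}. signed_sum s x (poly (P i)) = h i}"
    if Q: "Q > 2 * int s * A + H" and T: "T \<subseteq> S" and h: "\<forall>i\<in>{1..k}. \<bar>h i\<bar> \<le> H" for Q T h
  proof -
    have "Q dvd signed_sum s x (poly (P i)) - h i \<longleftrightarrow> signed_sum s x (poly (P i)) = h i" if x: "x \<in> tuples s T" and i: "i \<in> {1..k}" for x i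
    proof
      assume d: "Q dvd signed_sum s x (poly (P i)) - h i"
      have "\<bar>signed_sum s x (poly (P i))\<bar> \<le> 2 * int s * A"
        using A T i by (intro signed_sum_bound[OF x]) auto
      then have "\<bar>signed_sum s x (poly (P i)) - h i\<bar> < Q" using Q h i by force
      then have "signed_sum s x (poly (P i)) - h i = 0" using dvd_imp_le_int[OF _ d] by linarith
      then show "signed_sum s x (poly (P i)) = h i" by simp
    qed simp
    then show ?thesis unfolding system_sols_def by auto
  qed
  then show ?thesis by blast
qed

lemma card_tuples_map_le:
  assumes u: "inj_on u S" and A: "A \<subseteq> tuples s S" and fin: "finite B"
    and map: "\<And>x. x \<in> A \<Longrightarrow> (\<lambda>i\<in>{..<2 * s}. u (x i)) \<in> B"
  shows "card A \<le> card B"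
proof (rule card_inj_on_le)
  show "inj_on (\<lambda>x. \<lambda>i\<in>{..<2 * s}. u (x i)) A"
  proof (rule inj_onI)
    fix x y assume xy: "x \<in> A" "y \<in> A" and eq: "(\<lambda>i\<in>{..<2 * s}. u (x i)) = (\<lambda>i\<in>{..<2 * s}. u (y i))"
    show "x = y"
    proof
      fix i
      show "x i = y i"
      proof (cases "i < 2 * s")
        case True
        then have "u (x i) = u (y i)" using fun_cong[OF eq, of i] by simp
        moreover have "x i \<in> S" "y i \<in> S" using xy A True by (auto simp: tuples_def)
        ultimately show ?thesis using u by (auto dest: inj_onD)
      next
        case False
        then have "z i = undefined" if "z \<in> A" for z
          using that A by (auto simp: tuples_def PiE_def extensional_def)
        from this[OF xy(1)] this[OF xy(2)] show ?thesis by simp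
      qed
    qed
  qed
qed (use map fin in auto)

lemma signed_sum_restrict: "signed_sum s (\<lambda>i\<in>{..<2 * s}. u (x i)) h = signed_sum s x (\<lambda>n. h (u n))"
  unfolding signed_sum_def by (intro sum.cong) auto

lemma class_param:
  assumes "(p::int) > 1" "n \<in> res_class p 1 c"
  shows "n = c + p * ((n - c) div p)"
  using assms by (auto simp: res_class_def cong_iff_dvd_diff)

text \<open>Translation-dilation invariance: powers of \<open>n - c\<close> are combinations of
  lower powers of \<open>n\<close>, and constants cancel because both signs occur equally
  often.\<close>

lemma class_power_sums:
  fixes p :: int
  assumes p: "p > 1" and r: "r \<ge> 1" and S: "S \<subseteq> res_class p 1 c" and x: "x \<in> vinogradov_sols r g S" and j: "j \<in> {1..<r}"
  shows "signed_sum (tri r) x (\<lambda>n. ((n - c) div p) ^ j) = 0"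
proof -
  have x': "x \<in> tuples (tri r) S" and h: "\<And>j. j \<in> {1..<r} \<Longrightarrow> signed_sum (tri r) x (\<lambda>n. n ^ j) = 0"
    using x vinogradov_sols_iff[OF r] by auto
  have "p ^ j * signed_sum (tri r) x (\<lambda>n. ((n - c) div p) ^ j) = signed_sum (tri r) x (\<lambda>n. (p * ((n - c) div p)) ^ j)"
    by (simp add: power_mult_distrib signed_sum_cmult)
  also have "\<dots> = signed_sum (tri r) x (\<lambda>n. poly ([:- c, 1:] ^ j) n)"
  proof (rule signed_sum_cong[OF x'])
    fix n assume "n \<in> S"
    then have "p * ((n - c) div p) = n - c" using class_param[OF p, of n c] S by auto
    then show "(p * ((n - c) div p)) ^ j = poly ([:- c, 1:] ^ j) n" by (simp add: poly_power)
  qed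
  also have "\<dots> = 0"
  proof (rule signed_sum_poly_zero[OF h])
    have "degree ([:- c, 1:] ^ j) \<le> j" by (rule order_trans[OF degree_power_le]) simp
    then show "degree ([:- c, 1:] ^ j) < r" using j by auto
  qed
  finally show ?thesis using p by simp
qed

text \<open>Substitute \<open>n = c + p * u\<close>. The power sum equations remove all terms of
  \<open>g\<close> below order \<open>r\<close>, and what is left is \<open>p^r\<close> times
  \<open>h * u^r + p * W(u)\<close> with \<open>h\<close> the \<open>r\<close>-th Taylor
  coefficient. Multiplication by an inverse of \<open>h\<close> modulo \<open>p^(r * B)\<close>
  gives a curve to which decoupling applies. The substitution uses up one factor \<open>p\<close> of
  the separation, hence \<open>Suc B\<close> in the hypothesis.\<close>

lemma good_class:
  fixes p :: int
  assumes p: "prime p" and r: "r \<ge> 1" and c: "\<not> p dvd taylor_coeff c g r" and S: "finite S" "S \<subseteq> res_class p 1 c"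
    and sep: "\<And>n n'. n \<in> S \<Longrightarrow> n' \<in> S \<Longrightarrow> [n = n'] (mod p ^ Suc B) \<Longrightarrow> n = n'"
    and D: "decoupling_bound p r B K"
  shows "real (card (vinogradov_sols r g S)) \<le> K * real_of_int p ^ (B * tri r)"
proof -
  have p1: "p > 1" using p prime_gt_1_int by blast
  define q where "q = p ^ (r * B)"
  define u where "u = (\<lambda>n. (n - c) div p)"
  have un: "n = c + p * u n" if "n \<in> S" for n using that S class_param[OF p1] by (auto simp: u_def)
  have inj: "inj_on u S" using un by (metis inj_onI)
  define R where "R = poly_shift (Suc r) (pcompose g [:c, 1:])"
  define h where "h = taylor_coeff c g r"
  have "coprime h q" unfolding h_def q_def using c p by (metis coprime_commute coprime_power_left_iff prime_imp_coprime)
  then obtain y where y: "[h * y = 1] (mod q)" using cong_solve_coprime_int by blast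
  define W where "W = monom 1 (Suc r) * pcompose R [:0, p:]"
  define \<phi> where "\<phi> = (\<lambda>j. if j < r then monom 1 j else monom 1 r + smult p (smult y W))"
  have moment_like: "moment_like p r \<phi>" unfolding moment_like_def
  proof
    fix i assume "i \<in> {1..r}"
    then have "\<phi> i = monom 1 i + smult p (if i < r then 0 else smult y W)"
      by (cases "i < r") (auto simp: \<phi>_def)
    then show "\<exists>C. \<phi> i = monom 1 i + smult p C" by blast
  qed
  have uS: "finite (u ` S)" using S by simp
  have sep': "n = n'" if "n \<in> u ` S" "n' \<in> u ` S" "[n = n'] (mod p ^ B)" for n n'
  proof -
    from that(1,2) obtain m m' where m: "m \<in> S" "m' \<in> S" "n = u m" "n' = u m'" by blast
    have "m - m' = p * (u m - u m')" using un m by (metis add_diff_cancel_left right_diff_distrib)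
    moreover have "p ^ B dvd u m - u m'" using that(3) m by (simp add: cong_iff_dvd_diff)
    ultimately have "p ^ Suc B dvd m - m'" by simp
    then show ?thesis using sep m by (metis cong_iff_dvd_diff)
  qed
  have "card (vinogradov_sols r g S) \<le> card (system_sols (tri r) r q \<phi> (u ` S) (\<lambda>_. 0))"
  proof (rule card_tuples_map_le[OF inj])
    show "vinogradov_sols r g S \<subseteq> tuples (tri r) S" by (auto simp: vinogradov_sols_def)
    show "finite (system_sols (tri r) r q \<phi> (u ` S) (\<lambda>_. 0))" using uS by (simp add: system_sols_def)
    fix x assume x: "x \<in> vinogradov_sols r g S"
    then have x': "x \<in> tuples (tri r) S" by (simp add: vinogradov_sols_def)
    note low = class_power_sums[OF p1 r S(2) x]
    let ?s = "signed_sum (tri r) x"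
    have g0: "?s (poly g) = 0" using x vinogradov_sols_iff[OF r] by blast
    have "?s (poly g) = ?s (\<lambda>n. poly g c + ((\<Sum>i=1..r. (taylor_coeff c g i * p ^ i) * u n ^ i) + p ^ r * (p * poly W (u n))))"
    proof (rule signed_sum_cong[OF x'])
      fix n assume "n \<in> S"
      have 1: "poly g n - poly g c = (\<Sum>i=1..r. taylor_coeff c g i * (p * u n) ^ i) + (p * u n) ^ Suc r * poly R (p * u n)"
        using taylor_coeff_taylor[of g c "p * u n" r] un[OF \<open>n \<in> S\<close>] unfolding R_def by simp
      have 2: "(p * u n) ^ Suc r * poly R (p * u n) = p ^ r * (p * poly W (u n))"
        by (simp add: W_def poly_monom poly_pcompose power_mult_distrib algebra_simps)
      have 3: "(\<Sum>i=1..r. taylor_coeff c g i * (p * u n) ^ i) = (\<Sum>i=1..r. (taylor_coeff c g i * p ^ i) * u n ^ i)"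
        by (simp only: power_mult_distrib mult.assoc)
      show "poly g n = poly g c + ((\<Sum>i=1..r. (taylor_coeff c g i * p ^ i) * u n ^ i) + p ^ r * (p * poly W (u n)))"
        using 1 unfolding 2 3 by linarith
    qed
    also have "\<dots> = (\<Sum>i=1..r. (taylor_coeff c g i * p ^ i) * ?s (\<lambda>n. u n ^ i)) + p ^ r * ?s (\<lambda>n. p * poly W (u n))"
      by (simp add: signed_sum_add signed_sum_sum signed_sum_cmult signed_sum_const)
    also have "(\<Sum>i=1..r. (taylor_coeff c g i * p ^ i) * ?s (\<lambda>n. u n ^ i)) = (\<Sum>i\<in>{r}. (taylor_coeff c g i * p ^ i) * ?s (\<lambda>n. u n ^ i))"
      using r low by (intro sum.mono_neutral_right) (auto simp: u_def)
    finally have "p ^ r * (h * ?s (\<lambda>n. u n ^ r) + ?s (\<lambda>n. p * poly W (u n))) = 0"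
      using g0 by (simp add: h_def algebra_simps)
    then have G: "h * ?s (\<lambda>n. u n ^ r) + ?s (\<lambda>n. p * poly W (u n)) = 0" using p1 by simp
    have "?s (\<lambda>n. poly (\<phi> r) (u n)) = ?s (\<lambda>n. u n ^ r + y * (p * poly W (u n)))"
      by (intro signed_sum_cong[OF x']) (simp add: \<phi>_def poly_monom algebra_simps)
    also have "\<dots> = ?s (\<lambda>n. u n ^ r) + y * ?s (\<lambda>n. p * poly W (u n))" by (simp add: signed_sum_add signed_sum_cmult)
    also have "?s (\<lambda>n. p * poly W (u n)) = - h * ?s (\<lambda>n. u n ^ r)" using G by simp
    also have "?s (\<lambda>n. u n ^ r) + y * (- h * ?s (\<lambda>n. u n ^ r)) = (1 - h * y) * ?s (\<lambda>n. u n ^ r)"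
      by (simp add: algebra_simps)
    finally have "q dvd ?s (\<lambda>n. poly (\<phi> r) (u n))"
      using y by (metis cong_iff_dvd_diff cong_sym dvd_mult2)
    moreover have "?s (\<lambda>n. poly (\<phi> j) (u n)) = 0" if "j \<in> {1..<r}" for j
      using low[OF that] that by (simp add: \<phi>_def poly_monom u_def)
    ultimately have "q dvd ?s (\<lambda>n. poly (\<phi> j) (u n))" if "j \<in> {1..r}" for j
      using that by (cases "j = r") auto
    moreover have "(\<lambda>i\<in>{..<2 * tri r}. u (x i)) \<in> tuples (tri r) (u ` S)"
      using x' by (auto simp: tuples_def)
    ultimately show "(\<lambda>i\<in>{..<2 * tri r}. u (x i)) \<in> system_sols (tri r) r q \<phi> (u ` S) (\<lambda>_. 0)"
      by (simp add: system_sols_def signed_sum_restrict)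
  qed
  then have "real (card (vinogradov_sols r g S)) \<le> real (card (system_sols (tri r) r q \<phi> (u ` S) (\<lambda>_. 0)))" by simp
  also have "\<dots> \<le> K * real_of_int p ^ (B * tri r)"
    unfolding q_def by (rule card_system_sols_decoupling[OF D moment_like p1 uS sep'])
  finally show ?thesis .
qed

text \<open>After \<open>n = c + p * u\<close> only the part \<open>u^r * H(u)\<close> of
  \<open>g\<close> remains, with \<open>H\<close> nonzero because \<open>g\<close> has degree at
  least \<open>r\<close>. Dividing by the full power of \<open>p\<close> in \<open>H\<close>
  restores the hypotheses on \<open>g\<close>: degree at most \<open>d\<close> and some coefficient
  of order at least \<open>r\<close> prime to \<open>p\<close>. What has improved is the range of
  the variable, shorter by a factor \<open>p\<close>.\<close>

lemma bad_class:
  fixes p :: int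
  assumes p: "p > 1" and r: "r \<ge> 1" and g: "degree g \<le> d" "j \<ge> r" "\<not> p dvd coeff g j"
  shows "\<exists>g'. degree g' \<le> d \<and> (\<exists>j\<ge>r. \<not> p dvd coeff g' j) \<and>
     (\<forall>S. finite S \<longrightarrow> S \<subseteq> res_class p 1 c \<longrightarrow> card (vinogradov_sols r g S) \<le> card (vinogradov_sols r g' ((\<lambda>n. (n - c) div p) ` S)))"
proof -
  define A where "A = pcompose g [:c, p:]"
  have degA: "degree A = degree g" using p by (simp add: A_def degree_pcompose)
  have "coeff g j \<noteq> 0" using g by auto
  then have "r \<le> degree g" using g by (meson le_degree le_trans)
  define H where "H = poly_shift r A"
  have "coeff H (degree A - r) = lead_coeff A" using \<open>r \<le> degree g\<close> by (simp add: H_def coeff_poly_shift degA)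
  moreover have "lead_coeff A \<noteq> 0"
  proof -
    have "g \<noteq> 0" using \<open>coeff g j \<noteq> 0\<close> by auto
    then have "A \<noteq> 0" using p unfolding A_def by (subst pcompose_eq_0_iff) auto
    then show ?thesis by simp
  qed
  ultimately have "H \<noteq> 0" by force
  from remove_prime_power[OF p this] obtain v H' j' where H: "H = smult (p ^ v) H'" and j': "\<not> p dvd coeff H' j'" by blast
  define g' where "g' = monom 1 r * H'"
  have "degree H \<le> degree A - r"
    by (rule degree_le) (auto simp: H_def coeff_poly_shift coeff_eq_0)
  then have "degree H' \<le> degree A - r" using p by (simp add: H)
  then have "degree g' \<le> d"
    using \<open>r \<le> degree g\<close> degA g degree_mult_le[of "monom 1 r" H'] by (simp add: g'_def degree_monom_eq)
  moreover have "\<exists>j\<ge>r. \<not> p dvd coeff g' j"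
    using j' by (intro exI[of _ "j' + r"]) (simp add: g'_def coeff_monom_mult)
  moreover have "card (vinogradov_sols r g S) \<le> card (vinogradov_sols r g' ((\<lambda>n. (n - c) div p) ` S))"
    if S: "finite S" "S \<subseteq> res_class p 1 c" for S
  proof -
    define u where "u = (\<lambda>n. (n - c) div p)"
    have un: "n = c + p * u n" if "n \<in> S" for n using that S class_param[OF p] by (auto simp: u_def)
    have inj: "inj_on u S" using un by (metis inj_onI)
    have "card (vinogradov_sols r g S) \<le> card (vinogradov_sols r g' (u ` S))"
    proof (rule card_tuples_map_le[OF inj])
      show "vinogradov_sols r g S \<subseteq> tuples (tri r) S" by (auto simp: vinogradov_sols_def)
      show "finite (vinogradov_sols r g' (u ` S))" using S by simp
      fix x assume x: "x \<in> vinogradov_sols r g S"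
      then have x': "x \<in> tuples (tri r) S" by (simp add: vinogradov_sols_def)
      note low = class_power_sums[OF p r S(2) x]
      let ?s = "signed_sum (tri r) x"
      have g0: "?s (poly g) = 0" using x vinogradov_sols_iff[OF r] by blast
      obtain l where l: "r = Suc l" using r by (cases r) auto
      have "?s (poly g) = ?s (\<lambda>n. (\<Sum>i\<le>l. coeff A i * u n ^ i) + p ^ v * poly g' (u n))"
      proof (rule signed_sum_cong[OF x'])
        fix n assume "n \<in> S"
        have "poly g n = poly A (u n)" using un[OF \<open>n \<in> S\<close>] by (simp add: A_def poly_pcompose mult.commute)
        also have "\<dots> = (\<Sum>i\<le>l. coeff A i * u n ^ i) + u n ^ r * poly H (u n)"
          using poly_shift_decomp[of A "u n" l] by (simp add: H_def l)
        also have "u n ^ r * poly H (u n) = p ^ v * poly g' (u n)"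
          by (simp add: H g'_def poly_monom)
        finally show "poly g n = (\<Sum>i\<le>l. coeff A i * u n ^ i) + p ^ v * poly g' (u n)" .
      qed
      also have "\<dots> = (\<Sum>i\<le>l. coeff A i * ?s (\<lambda>n. u n ^ i)) + p ^ v * ?s (\<lambda>n. poly g' (u n))"
        by (simp add: signed_sum_add signed_sum_sum signed_sum_cmult)
      also have "(\<Sum>i\<le>l. coeff A i * ?s (\<lambda>n. u n ^ i)) = 0"
      proof (intro sum.neutral ballI)
        fix i assume "i \<in> {..l}"
        then show "coeff A i * ?s (\<lambda>n. u n ^ i) = 0"
          using low[of i] signed_sum_const[of "tri r" x 1] by (cases "i = 0") (auto simp: u_def l)
      qed
      finally have G: "?s (\<lambda>n. poly g' (u n)) = 0" using g0 p by simp
      have "(\<lambda>i\<in>{..<2 * tri r}. u (x i)) \<in> tuples (tri r) (u ` S)"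
        using x' by (auto simp: tuples_def)
      then show "(\<lambda>i\<in>{..<2 * tri r}. u (x i)) \<in> vinogradov_sols r g' (u ` S)"
        unfolding vinogradov_sols_iff[OF r] signed_sum_restrict using low G by (auto simp: u_def)
    qed
    then show ?thesis by (simp add: u_def)
  qed
  ultimately show ?thesis by blast
qed

text \<open>Bad classes get weight \<open>1\<close> and good classes weight \<open>1/p\<close>: only the at most \<open>d\<close> bad classes
  contribute to the constant of the recursion, which is therefore a contraction for large \<open>p\<close>.\<close>

lemma split_classes:
  fixes p :: int
  assumes p: "p > 1" and r: "r \<ge> 1" and S: "finite S" and bad: "card {c \<in> {0..<p}. bad c} \<le> d"
  shows "real (card (vinogradov_sols r g S)) \<le> (real d + 1) ^ (2 * tri r - 1) *
     ((\<Sum>c\<in>{c \<in> {0..<p}. bad c}. real (card (vinogradov_sols r g (S \<inter> res_class p 1 c))))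
      + real_of_int p ^ (2 * tri r - 1) * (\<Sum>c\<in>{c \<in> {0..<p}. \<not> bad c}. real (card (vinogradov_sols r g (S \<inter> res_class p 1 c)))))"
proof -
  let ?s = "tri r"
  obtain n where n: "2 * ?s = Suc n" using tri_pos[OF r] by (cases "2 * ?s") auto
  obtain Q0 where Q0: "\<And>Q T. Q > Q0 \<Longrightarrow> T \<subseteq> S \<Longrightarrow> system_sols ?s r Q (vinogradov_system r g) T (\<lambda>_. 0) = vinogradov_sols r g T"
    using system_sols_eq_exact[OF S, of r 0 ?s "vinogradov_system r g"] unfolding vinogradov_sols_def by force
  define Q where "Q = max 1 (Q0 + 1)"
  have Q: "Q > 0" "Q > Q0" by (auto simp: Q_def)
  define F where "F = (\<lambda>T y. norm (exp_sum r Q (vinogradov_system r g) (\<lambda>_. 1) T y))"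
  have cnt: "real (card (vinogradov_sols r g T)) = avg r Q (\<lambda>y. F T y ^ Suc n)" if "T \<subseteq> S" for T
    using card_system_sols_0[OF Q(1) finite_subset[OF that S], of ?s r "vinogradov_system r g"] Q0[OF Q(2) that]
    by (simp add: F_def n[symmetric] del: power_Suc)
  define lam where "lam = (\<lambda>c. if bad c then 1 else 1 / real_of_int p)"
  let ?I = "{0..<p}"
  have lam: "lam c > 0" for c using p by (simp add: lam_def)
  have fin: "finite {c \<in> ?I. Pr c}" for Pr by (rule finite_subset[of _ ?I]) auto
  have split: "(\<Sum>c\<in>?I. G c) = (\<Sum>c\<in>{c \<in> ?I. bad c}. G c) + (\<Sum>c\<in>{c \<in> ?I. \<not> bad c}. G c)" for G :: "int \<Rightarrow> real"
  proof -
    have eq: "{c \<in> ?I. bad c} \<union> {c \<in> ?I. \<not> bad c} = ?I" by auto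
    have "(\<Sum>c\<in>{c \<in> ?I. bad c} \<union> {c \<in> ?I. \<not> bad c}. G c) = (\<Sum>c\<in>{c \<in> ?I. bad c}. G c) + (\<Sum>c\<in>{c \<in> ?I. \<not> bad c}. G c)"
      by (intro sum.union_disjoint fin) auto
    then show ?thesis unfolding eq .
  qed
  have sumlam: "(\<Sum>c\<in>?I. lam c) \<le> real d + 1"
  proof -
    have "(\<Sum>c\<in>{c \<in> ?I. bad c}. lam c) = real (card {c \<in> ?I. bad c})" by (simp add: lam_def)
    moreover have "(\<Sum>c\<in>{c \<in> ?I. \<not> bad c}. lam c) \<le> 1"
    proof -
      have "card {c \<in> ?I. \<not> bad c} \<le> card ?I" by (intro card_mono) auto
      then have "real (card {c \<in> ?I. \<not> bad c}) \<le> real_of_int p" using p by simp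
      then show ?thesis using p by (simp add: lam_def divide_le_eq)
    qed
    ultimately show ?thesis using bad unfolding split[of lam] by linarith
  qed
  have pt: "F S y ^ Suc n \<le> (real d + 1) ^ n * (\<Sum>c\<in>?I. F (S \<inter> res_class p 1 c) y ^ Suc n / lam c ^ n)" for y
  proof -
    have "F S y \<le> (\<Sum>c\<in>?I. F (S \<inter> res_class p 1 c) y)"
      using exp_sum_split[OF p _ S, of 0 1 r Q "vinogradov_system r g" "\<lambda>_. 1" 0 y] norm_sum by (simp add: F_def)
    then have "F S y ^ Suc n \<le> (\<Sum>c\<in>?I. F (S \<inter> res_class p 1 c) y) ^ Suc n"
      by (intro power_mono) (auto simp: F_def)
    also have "\<dots> \<le> (\<Sum>c\<in>?I. lam c) ^ n * (\<Sum>c\<in>?I. F (S \<inter> res_class p 1 c) y ^ Suc n / lam c ^ n)"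
      using p lam by (intro power_sum_le_weighted) (auto simp: F_def)
    also have "\<dots> \<le> (real d + 1) ^ n * (\<Sum>c\<in>?I. F (S \<inter> res_class p 1 c) y ^ Suc n / lam c ^ n)"
      using sumlam lam
      by (intro mult_right_mono power_mono sum_nonneg) (auto simp: F_def less_imp_le intro!: divide_nonneg_nonneg)
    finally show ?thesis .
  qed
  have "real (card (vinogradov_sols r g S)) \<le> avg r Q (\<lambda>y. (real d + 1) ^ n * (\<Sum>c\<in>?I. F (S \<inter> res_class p 1 c) y ^ Suc n / lam c ^ n))"
    unfolding cnt[OF order_refl] by (intro avg_mono Q pt)
  also have "\<dots> = (real d + 1) ^ n * (\<Sum>c\<in>?I. real (card (vinogradov_sols r g (S \<inter> res_class p 1 c))) / lam c ^ n)"
    unfolding avg_cmult avg_sum avg_cdiv using cnt by simp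
  also have "(\<Sum>c\<in>?I. real (card (vinogradov_sols r g (S \<inter> res_class p 1 c))) / lam c ^ n)
    = (\<Sum>c\<in>{c \<in> ?I. bad c}. real (card (vinogradov_sols r g (S \<inter> res_class p 1 c))))
      + real_of_int p ^ n * (\<Sum>c\<in>{c \<in> ?I. \<not> bad c}. real (card (vinogradov_sols r g (S \<inter> res_class p 1 c))))"
    unfolding split sum_distrib_left
    by (intro arg_cong2[where f = "(+)"] sum.cong) (auto simp: lam_def power_one_over)
  finally show ?thesis by (simp add: n)
qed

section \<open>Vinogradov's mean value\<close>

lemma ex_power_between:
  fixes p :: nat
  assumes "p \<ge> 2" "L \<ge> 1"
  shows "\<exists>B. L \<le> p ^ B \<and> p ^ B \<le> p * L"
proof -
  have "L < 2 ^ L" by simp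
  also have "(2::nat) ^ L \<le> p ^ L" using assms by (intro power_mono) auto
  finally have ex: "\<exists>B. L \<le> p ^ B" by (intro exI[of _ L]) simp
  define B where "B = (LEAST B. L \<le> p ^ B)"
  have 1: "L \<le> p ^ B" unfolding B_def using ex by (rule LeastI_ex)
  have "p ^ B \<le> p * L"
  proof (cases B)
    case 0
    then show ?thesis using assms by simp
  next
    case (Suc B')
    then have "\<not> L \<le> p ^ B'" unfolding B_def by (intro not_less_Least) simp
    then show ?thesis using Suc by simp
  qed
  with 1 show ?thesis by blast
qed

lemma class_interval:
  fixes p :: int
  assumes p: "p > 1" and S: "S \<subseteq> {a + 1..a + int L}"
  shows "(\<lambda>n. (n - c) div p) ` (S \<inter> res_class p 1 c) \<subseteq> {(a - c) div p + 1..(a - c) div p + int (L div nat p + 1)}"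
proof
  fix u assume "u \<in> (\<lambda>n. (n - c) div p) ` (S \<inter> res_class p 1 c)"
  then obtain n where n: "n \<in> S" "n \<in> res_class p 1 c" "u = (n - c) div p" by blast
  have nu: "n = c + p * u" using class_param[OF p n(2)] n(3) by simp
  have n1: "a + 1 \<le> n" "n \<le> a + int L" using n(1) S by auto
  define t where "t = (a - c) div p"
  have t: "p * t \<le> a - c" "a - c < p * t + p"
    unfolding t_def using p pos_mod_bound[of p "a - c"] pos_mod_sign[of p "a - c"] mult_div_mod_eq[of p "a - c"]
    by linarith+
  define w where "w = int L div p"
  have w: "int L < p * w + p"
    unfolding w_def using p pos_mod_bound[of p "int L"] mult_div_mod_eq[of p "int L"] by linarith
  have "p * t < p * u" using nu n1 t by linarith
  then have "t < u" using p by simp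
  moreover have "p * u < p * (t + w + 2)" using nu n1 t w by (simp add: algebra_simps)
  then have "u < t + w + 2" using p by (simp only: mult_less_cancel_left_pos)
  moreover have "int (L div nat p + 1) = w + 1" using p by (simp add: w_def zdiv_int)
  ultimately show "u \<in> {(a - c) div p + 1..(a - c) div p + int (L div nat p + 1)}"
    unfolding t_def[symmetric] by simp
qed

text \<open>Strong induction on \<open>L\<close>, with a bound uniform in \<open>g\<close> since bad
  classes change the polynomial. Passing to length at most \<open>2L/p\<close>, the bad classes
  contribute a factor at most \<open>(d+1)^(2s) * (2/p)^s\<close>, which is at most
  \<open>1/2\<close> by the size of \<open>p\<close>. On good classes decoupling is used at a scale
  with \<open>L \<le> p^B \<le> p * L\<close>.\<close>

lemma vinogradov_sols_bound:
  fixes p :: int and \<epsilon> :: real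
  assumes p: "prime p" "4 * (int d + 1)\<^sup>2 \<le> p" and r: "1 \<le> r" "r \<le> d" and \<epsilon>: "\<epsilon> > 0"
  shows "\<exists>A\<ge>0. \<forall>L\<ge>1. \<forall>g a S. degree g \<le> d \<longrightarrow> (\<exists>j\<ge>r. \<not> p dvd coeff g j) \<longrightarrow> S \<subseteq> {a + 1..a + int L} \<longrightarrow>
     real (card (vinogradov_sols r g S)) \<le> A * real L powr (real (tri r) + \<epsilon>)"
proof -
  have p1: "p > 1" using p prime_gt_1_int by blast
  define s where "s = tri r"
  have s: "s \<ge> 1" using tri_pos[OF r(1)] by (simp add: s_def)
  define q where "q = real_of_int p"
  define D where "D = real d + 1"
  have D: "D \<ge> 1" by (simp add: D_def)
  have qD: "4 * D\<^sup>2 \<le> q"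
  proof -
    have "real_of_int (4 * (int d + 1)\<^sup>2) \<le> q" using p(2) unfolding q_def of_int_le_iff .
    then show ?thesis by (simp add: D_def)
  qed
  have D2: "D \<le> D\<^sup>2" using D by (simp add: power2_eq_square)
  have q: "q \<ge> 4" using qD D D2 by linarith
  have dp: "int d < p"
  proof -
    have "real d < q" using qD D2 by (simp add: D_def)
    then show ?thesis by (simp add: q_def)
  qed
  have "valid_exponent p r \<epsilon>" using decoupling[OF p(1) _ r(1) \<epsilon>] dp r by simp
  then obtain C' where C': "\<And>B. decoupling_bound p r B (C' * q powr (\<epsilon> * B))" by (auto simp: valid_exponent_def q_def)
  define C where "C = max C' 0"
  have C: "C \<ge> 0" and DecC: "decoupling_bound p r B (C * q powr (\<epsilon> * B))" for B
  proof -
    show "C \<ge> 0" by (simp add: C_def)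
    have "C' * q powr (\<epsilon> * B) \<le> C * q powr (\<epsilon> * B)" by (intro mult_right_mono) (auto simp: C_def)
    then show "decoupling_bound p r B (C * q powr (\<epsilon> * B))" using C' decoupling_bound_mono by blast
  qed
  define E where "E = real s + \<epsilon>"
  have E: "E > 0" using \<epsilon> by (simp add: E_def)
  \<comment> \<open>The first summand covers \<open>L < p\<close>, where all tuples are counted; the
    second is twice the contribution of the good classes, the other half being left for the bad
    ones.\<close>
  define A where "A = q ^ (2 * s) + 2 * (D ^ (2 * s - 1) * (q ^ (2 * s - 1) * (q * (C * q powr E))))"
  have A0: "A \<ge> 0" using D q C by (simp add: A_def)
  have good: "real (card (vinogradov_sols r g (S \<inter> res_class p 1 c))) \<le> (C * q powr E) * real L powr E"
    if L: "L \<ge> 1" and S: "S \<subseteq> {a + 1..a + int L}" and c: "\<not> p dvd taylor_coeff c g r" for L g a S c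
  proof -
    obtain B where B: "L \<le> nat p ^ B" "nat p ^ B \<le> nat p * L" using ex_power_between[OF _ L, of "nat p"] p1 by force
    have B1: "int L \<le> p ^ B" using B(1) p1 by (metis int_nat_eq le_less_trans less_le not_less of_nat_le_iff of_nat_power zero_less_one)
    have "real (nat p ^ B) \<le> real (nat p * L)" using B(2) by (simp only: of_nat_le_iff)
    then have B2: "q ^ B \<le> q * L" using p1 by (simp add: q_def)
    have fin: "finite (S \<inter> res_class p 1 c)" using S finite_subset by blast
    have sep: "n = n'" if "n \<in> S \<inter> res_class p 1 c" "n' \<in> S \<inter> res_class p 1 c" "[n = n'] (mod p ^ Suc B)" for n n'
    proof (rule ccontr)
      assume ne: "n \<noteq> n'"
      have "p ^ B dvd p ^ Suc B" by simp
      then have "p ^ B dvd n - n'" using that(3) by (meson cong_iff_dvd_diff dvd_trans)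
      then have "\<bar>p ^ B\<bar> \<le> \<bar>n - n'\<bar>" using ne by (intro dvd_imp_le_int) auto
      moreover have "n \<in> {a + 1..a + int L}" "n' \<in> {a + 1..a + int L}" using that(1,2) S by blast+
      then have "\<bar>n - n'\<bar> < int L" by auto
      ultimately show False using B1 by simp
    qed
    have "real (card (vinogradov_sols r g (S \<inter> res_class p 1 c))) \<le> (C * q powr (\<epsilon> * B)) * real_of_int p ^ (B * tri r)"
      by (rule good_class[OF p(1) r(1) c fin _ sep DecC]) auto
    also have "\<dots> = C * (q ^ B) powr E"
      using q by (simp add: q_def[symmetric] s_def[symmetric] E_def powr_add powr_powr powr_realpow[symmetric] mult_ac)
    also have "\<dots> \<le> C * (q * L) powr E" using C B2 q E by (intro mult_left_mono powr_mono2) auto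
    also have "\<dots> = (C * q powr E) * real L powr E" using q by (simp add: powr_mult)
    finally show ?thesis .
  qed
  have main: "\<forall>g a S. degree g \<le> d \<longrightarrow> (\<exists>j\<ge>r. \<not> p dvd coeff g j) \<longrightarrow> S \<subseteq> {a + 1..a + int L} \<longrightarrow>
     real (card (vinogradov_sols r g S)) \<le> A * real L powr E" if "L \<ge> 1" for L
    using that
  proof (induction L rule: less_induct)
    case (less L)
    show ?case
    proof (intro allI impI)
      fix g :: "int poly" and a S assume g: "degree g \<le> d" "\<exists>j\<ge>r. \<not> p dvd coeff g j" and S: "S \<subseteq> {a + 1..a + int L}"
      have fin: "finite S" using S finite_subset by blast
      have LE: "real L powr E \<ge> 1" using less.prems E by (intro ge_one_powr_ge_zero) auto
      show "real (card (vinogradov_sols r g S)) \<le> A * real L powr E"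
      proof (cases "int L < p")
        case True
        have "card (vinogradov_sols r g S) \<le> card (tuples s S)" unfolding s_def
          by (intro card_mono) (auto simp: vinogradov_sols_def fin)
        also have "\<dots> = card S ^ (2 * s)" by (rule card_tuples[OF fin])
        also have "\<dots> \<le> card {a + 1..a + int L} ^ (2 * s)" using S by (intro power_mono card_mono) auto
        also have "\<dots> = L ^ (2 * s)" by simp
        finally have "real (card (vinogradov_sols r g S)) \<le> real L ^ (2 * s)" by (metis of_nat_le_iff of_nat_power)
        also have "\<dots> \<le> q ^ (2 * s)" using True by (intro power_mono) (auto simp: q_def)
        also have "\<dots> \<le> A * 1" using D q C by (simp add: A_def)
        also have "\<dots> \<le> A * real L powr E" using A0 LE by (intro mult_left_mono)
        finally show ?thesis .
      next
        case False
        then have Lq: "q \<le> real L" by (simp add: q_def)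
        define L' where "L' = L div nat p + 1"
        have L'q: "real L' \<le> 2 * L / q"
        proof -
          have "real (L div nat p) \<le> real L / real (nat p)" by (rule of_nat_div_le_of_nat)
          then have "real (L div nat p) \<le> real L / q" using p1 by (simp add: q_def)
          moreover have "1 \<le> real L / q" using Lq q by simp
          ultimately show ?thesis by (simp add: L'_def)
        qed
        have "2 * L / q < L" using q less.prems by (simp add: divide_less_eq)
        then have L'L: "L' < L" using L'q by linarith
        have L'1: "L' \<ge> 1" by (simp add: L'_def)
        define bad where "bad = (\<lambda>c. p dvd taylor_coeff c g r)"
        obtain j where j: "j \<ge> r" "\<not> p dvd coeff g j" using g by blast
        have cardbad: "card {c \<in> {0..<p}. bad c} \<le> d"
          unfolding bad_def by (rule card_bad_classes[OF p(1) g(1) dp j])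
        have bad1: "real (card (vinogradov_sols r g (S \<inter> res_class p 1 c))) \<le> A * real L' powr E" for c
        proof -
          obtain g' where g': "degree g' \<le> d" "\<exists>j\<ge>r. \<not> p dvd coeff g' j"
            "card (vinogradov_sols r g (S \<inter> res_class p 1 c)) \<le> card (vinogradov_sols r g' ((\<lambda>n. (n - c) div p) ` (S \<inter> res_class p 1 c)))"
            using bad_class[OF p1 r(1) g(1) j, of c] fin by (metis finite_Int inf_le2)
          have "(\<lambda>n. (n - c) div p) ` (S \<inter> res_class p 1 c) \<subseteq> {(a - c) div p + 1..(a - c) div p + int L'}"
            using class_interval[OF p1 S, of c] by (simp add: L'_def)
          then have "real (card (vinogradov_sols r g' ((\<lambda>n. (n - c) div p) ` (S \<inter> res_class p 1 c)))) \<le> A * real L' powr E"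
            using less.IH[OF L'L L'1] g' by blast
          with g'(3) show ?thesis by (meson of_nat_le_iff order_trans)
        qed
        have "real (card (vinogradov_sols r g S)) \<le> D ^ (2 * s - 1) *
          ((\<Sum>c\<in>{c \<in> {0..<p}. bad c}. real (card (vinogradov_sols r g (S \<inter> res_class p 1 c))))
           + q ^ (2 * s - 1) * (\<Sum>c\<in>{c \<in> {0..<p}. \<not> bad c}. real (card (vinogradov_sols r g (S \<inter> res_class p 1 c)))))"
          unfolding D_def s_def q_def by (rule split_classes[OF p1 r(1) fin cardbad])
        also have "\<dots> \<le> D ^ (2 * s - 1) * (D * (A * real L' powr E) + q ^ (2 * s - 1) * (q * ((C * q powr E) * real L powr E)))"
        proof (intro mult_left_mono add_mono)
          have "(\<Sum>c\<in>{c \<in> {0..<p}. bad c}. real (card (vinogradov_sols r g (S \<inter> res_class p 1 c))))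
             \<le> (\<Sum>c\<in>{c \<in> {0..<p}. bad c}. A * real L' powr E)" by (intro sum_mono bad1)
          also have "\<dots> = real (card {c \<in> {0..<p}. bad c}) * (A * real L' powr E)" by simp
          also have "\<dots> \<le> D * (A * real L' powr E)"
            using cardbad A0 by (intro mult_right_mono) (auto simp: D_def)
          finally show "(\<Sum>c\<in>{c \<in> {0..<p}. bad c}. real (card (vinogradov_sols r g (S \<inter> res_class p 1 c)))) \<le> D * (A * real L' powr E)" .
          have "card {c \<in> {0..<p}. \<not> bad c} \<le> card {0..<p}" by (intro card_mono) auto
          then have cg: "real (card {c \<in> {0..<p}. \<not> bad c}) \<le> q" using p1 by (simp add: q_def)
          have "(\<Sum>c\<in>{c \<in> {0..<p}. \<not> bad c}. real (card (vinogradov_sols r g (S \<inter> res_class p 1 c))))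
             \<le> (\<Sum>c\<in>{c \<in> {0..<p}. \<not> bad c}. (C * q powr E) * real L powr E)"
            using good[OF less.prems S] by (intro sum_mono) (auto simp: bad_def)
          also have "\<dots> = real (card {c \<in> {0..<p}. \<not> bad c}) * ((C * q powr E) * real L powr E)" by simp
          also have "\<dots> \<le> q * ((C * q powr E) * real L powr E)"
            using cg C by (intro mult_right_mono) auto
          finally show "(\<Sum>c\<in>{c \<in> {0..<p}. \<not> bad c}. real (card (vinogradov_sols r g (S \<inter> res_class p 1 c)))) \<le> q * ((C * q powr E) * real L powr E)" .
        qed (use D q in auto)
        also have "\<dots> = D ^ (2 * s) * (A * real L' powr E) + (D ^ (2 * s - 1) * (q ^ (2 * s - 1) * (q * (C * q powr E)))) * real L powr E"
          using s by (simp add: algebra_simps power_eq_if)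
        also have "D ^ (2 * s) * (A * real L' powr E) \<le> (A / 2) * real L powr E"
        proof -
          have "real L' powr E \<le> (2 / q * L) powr E" using L'q E by (intro powr_mono2) auto
          also have "\<dots> = (2 / q) powr E * real L powr E" using q by (intro powr_mult)
          also have "\<dots> \<le> (2 / q) ^ s * real L powr E"
          proof (intro mult_right_mono)
            have "(2 / q) powr E \<le> (2 / q) powr (real s)"
              using q \<epsilon> by (intro powr_mono') (auto simp: E_def)
            also have "\<dots> = (2 / q) ^ s" using q by (intro powr_realpow) auto
            finally show "(2 / q) powr E \<le> (2 / q) ^ s" .
          qed auto
          finally have "D ^ (2 * s) * (A * real L' powr E) \<le> D ^ (2 * s) * (A * ((2 / q) ^ s * real L powr E))"
            using D A0 by (intro mult_left_mono) auto
          also have "\<dots> = (D\<^sup>2 * (2 / q)) ^ s * (A * real L powr E)"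
            unfolding power_mult[of D 2 s] power_mult_distrib by (simp only: mult_ac)
          also have "\<dots> \<le> (1 / 2) ^ 1 * (A * real L powr E)"
          proof (intro mult_right_mono)
            have "D\<^sup>2 * (2 / q) \<le> 1 / 2" using qD q by (simp add: field_simps)
            then have "(D\<^sup>2 * (2 / q)) ^ s \<le> (1 / 2) ^ s" using q by (intro power_mono) auto
            also have "\<dots> \<le> (1 / 2) ^ 1" using s by (intro power_decreasing) auto
            finally show "(D\<^sup>2 * (2 / q)) ^ s \<le> (1 / 2) ^ 1" .
          qed (use A0 in auto)
          finally show ?thesis by simp
        qed
        also have "(A / 2) * real L powr E + (D ^ (2 * s - 1) * (q ^ (2 * s - 1) * (q * (C * q powr E)))) * real L powr E
           \<le> A * real L powr E"
          unfolding distrib_right[symmetric] using q by (intro mult_right_mono) (auto simp: A_def)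
        finally show ?thesis by simp
      qed
    qed
  qed
  show ?thesis
    using main A0 unfolding E_def s_def by blast
qed

lemma sum_lessThan_tri: assumes "r \<ge> 1" shows "(\<Sum>j\<in>{1..<r}. j) + r = tri r"
proof -
  have "{0..r} = insert 0 (insert r {1..<r})" using assms by auto
  then have "(\<Sum>j\<in>{0..r}. j) = (\<Sum>j\<in>{1..<r}. j) + r" using assms by simp
  then show ?thesis by (simp add: tri_def gauss_sum_nat)
qed

text \<open>Solutions of the single equation for \<open>f\<close> are sorted by the values
  \<open>h\<close> of the power sums of degree below \<open>r\<close>. There are about
  \<open>L\<close> to the power \<open>tri r - r\<close> possible values, and none has more
  solutions than \<open>h = 0\<close>. Powers of \<open>n - c\<close> are taken, so that the number
  of values depends on \<open>L\<close> only and not on the position of the interval.\<close>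

theorem vinogradov_mean_value:
  fixes f :: "int poly" and \<epsilon> :: real
  assumes r: "1 \<le> r" "r \<le> degree f" and \<epsilon>: "\<epsilon> > 0"
  shows "\<exists>C\<ge>0. \<forall>c. \<forall>L\<ge>1. real (card {x \<in> tuples (tri r) {c + 1..c + int L}. signed_sum (tri r) x (poly f) = 0})
     \<le> C * real L powr (real (2 * tri r) - r + \<epsilon>)"
proof -
  define d where "d = degree f"
  define s where "s = tri r"
  have s: "s \<ge> 1" using tri_pos[OF r(1)] by (simp add: s_def)
  have lc: "lead_coeff f \<noteq> 0" using r by auto
  \<comment> \<open>Besides being large in terms of \<open>d\<close>, the prime exceeds the leading
    coefficient, which thus serves as the coefficient of order at least \<open>r\<close> prime to
    \<open>p\<close>.\<close>
  obtain p0 :: nat where p0: "prime p0" "4 * (d + 1)\<^sup>2 + nat \<bar>lead_coeff f\<bar> < p0"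
    using bigger_prime by blast
  define p where "p = int p0"
  have p: "prime p" using p0 by (simp add: p_def)
  have pd: "4 * (int d + 1)\<^sup>2 \<le> p"
  proof -
    have "int (4 * (d + 1)\<^sup>2) \<le> p" using p0(2) unfolding p_def by linarith
    then show ?thesis by (simp add: add.commute)
  qed
  have "\<bar>lead_coeff f\<bar> < p" using p0(2) unfolding p_def by linarith
  then have nd: "\<not> p dvd lead_coeff f" using lc dvd_imp_le_int[of "lead_coeff f" p] by auto
  obtain A where A: "A \<ge> 0" and bound: "\<And>L g a S. L \<ge> 1 \<Longrightarrow> degree g \<le> d \<Longrightarrow> (\<exists>j\<ge>r. \<not> p dvd coeff g j) \<Longrightarrow> S \<subseteq> {a + 1..a + int L} \<Longrightarrow>
     real (card (vinogradov_sols r g S)) \<le> A * real L powr (real (tri r) + \<epsilon>)"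
    using vinogradov_sols_bound[OF p pd r(1) _ \<epsilon>] r(2) unfolding d_def by blast
  have "real (card {x \<in> tuples s {c + 1..c + int L}. signed_sum s x (poly f) = 0}) \<le> ((5 * real s) ^ (r - 1) * A) * real L powr (real (2 * s) - r + \<epsilon>)"
    if L: "L \<ge> 1" for c L
  proof -
    define S where "S = {c + 1..c + int L}"
    have fin: "finite S" by (simp add: S_def)
    define P where "P = (\<lambda>j. if j < r then [:- c, 1:] ^ j else f)"
    define h' where "h' = (\<lambda>h j. if j < r then h j else 0 :: int)"
    define Z where "Z = (\<lambda>h. {x \<in> tuples s S. \<forall>i\<in>{1..r}. signed_sum s x (poly (P i)) = h' h i})"
    define Hs where "Hs = PiE {1..<r} (\<lambda>j. {- (2 * int s * int L ^ j)..2 * int s * int L ^ j})"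
    have finH: "finite Hs" unfolding Hs_def by (intro finite_PiE) auto
    have r_split: "{1..r} = insert r {1..<r}" using r by auto
    have sub: "{x \<in> tuples s S. signed_sum s x (poly f) = 0} \<subseteq> (\<Union>h\<in>Hs. Z h)"
    proof
      fix x assume x: "x \<in> {x \<in> tuples s S. signed_sum s x (poly f) = 0}"
      define h where "h = (\<lambda>j\<in>{1..<r}. signed_sum s x (poly (P j)))"
      have "\<bar>signed_sum s x (poly (P j))\<bar> \<le> 2 * int s * int L ^ j" if "j \<in> {1..<r}" for j
      proof (rule signed_sum_bound)
        show "x \<in> tuples s S" using x by simp
        fix n assume "n \<in> S"
        then have "\<bar>n - c\<bar> \<le> int L" by (auto simp: S_def)
        then have "\<bar>n - c\<bar> ^ j \<le> int L ^ j" by (intro power_mono) auto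
        then show "\<bar>poly (P j) n\<bar> \<le> int L ^ j" using that by (simp add: P_def poly_power power_abs)
      qed
      then have "h \<in> Hs" unfolding Hs_def h_def by (fastforce simp: abs_le_iff)
      moreover have "x \<in> Z h" using x unfolding Z_def r_split by (auto simp: h'_def h_def P_def)
      ultimately show "x \<in> (\<Union>h\<in>Hs. Z h)" by blast
    qed
    obtain Q0 where "\<forall>Q>Q0. \<forall>T\<subseteq>S. \<forall>h. (\<forall>i\<in>{1..r}. \<bar>h i\<bar> \<le> 2 * int s * int L ^ r) \<longrightarrow>
       system_sols s r Q P T h = {x \<in> tuples s T. \<forall>i\<in>{1..r}. signed_sum s x (poly (P i)) = h i}"
      using system_sols_eq_exact[OF fin] by (rule exE)
    note Q0 = this[rule_format]
    define Q where "Q = max 1 (Q0 + 1)"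
    have Q: "Q > 0" "Q > Q0" by (auto simp: Q_def)
    have Zle: "real (card (Z h)) \<le> real (card (Z (\<lambda>_. 0)))" if h: "h \<in> Hs" for h
    proof -
      have "\<bar>h' h i\<bar> \<le> 2 * int s * int L ^ r" if i: "i \<in> {1..r}" for i
      proof (cases "i < r")
        case True
        then have "h i \<in> {- (2 * int s * int L ^ i)..2 * int s * int L ^ i}" using h i by (auto simp: Hs_def)
        then have "\<bar>h i\<bar> \<le> 2 * int s * int L ^ i" by auto
        also have "\<dots> \<le> 2 * int s * int L ^ r" using L i by (intro mult_left_mono power_increasing) auto
        finally show ?thesis using True by (simp add: h'_def)
      qed (simp add: h'_def)
      then have "Z h = system_sols s r Q P S (h' h)" unfolding Z_def using Q0[OF Q(2) order_refl] by simp
      moreover have "Z (\<lambda>_. 0) = system_sols s r Q P S (\<lambda>_. 0)"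
        unfolding Z_def using Q0[OF Q(2) order_refl, of "\<lambda>_. 0"] by (simp add: h'_def)
      ultimately show ?thesis using card_system_sols_le[OF Q(1) fin] by simp
    qed
    have Z0: "Z (\<lambda>_. 0) \<subseteq> vinogradov_sols r f S"
    proof
      fix x assume x: "x \<in> Z (\<lambda>_. 0)"
      have z: "signed_sum s x (poly (P j)) = 0" if "j \<in> {1..r}" for j using x that by (auto simp: Z_def h'_def)
      have low: "signed_sum s x (\<lambda>n. (n - c) ^ j) = 0" if "j \<in> {1..<r}" for j
      proof -
        have "poly (P j) = (\<lambda>n. (n - c) ^ j)" using that by (auto simp: P_def poly_power)
        then show ?thesis using z[of j] that by simp
      qed
      have "signed_sum s x (\<lambda>n. n ^ j) = 0" if j: "j \<in> {1..<r}" for j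
      proof -
        have "signed_sum s x (\<lambda>n. poly ([:c, 1:] ^ j) (n - c)) = 0"
        proof (rule signed_sum_poly_zero[OF low])
          have "degree ([:c, 1:] ^ j) \<le> j" by (rule order_trans[OF degree_power_le]) simp
          then show "degree ([:c, 1:] ^ j) < r" using j by auto
        qed
        then show ?thesis by (simp add: poly_power)
      qed
      moreover have "signed_sum s x (poly f) = 0" using z[of r] r by (simp add: P_def)
      ultimately show "x \<in> vinogradov_sols r f S" unfolding vinogradov_sols_iff[OF r(1)] using x by (auto simp: Z_def s_def)
    qed
    have cardH: "real (card Hs) \<le> (5 * real s) ^ (r - 1) * real L powr (real s - r)"
    proof -
      have "real (card Hs) = (\<Prod>j\<in>{1..<r}. real (card {- (2 * int s * int L ^ j)..2 * int s * int L ^ j}))"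
        unfolding Hs_def by (subst card_PiE) auto
      also have "\<dots> \<le> (\<Prod>j\<in>{1..<r}. 5 * real s * real L ^ j)"
      proof (intro prod_mono conjI)
        fix j
        have "1 \<le> real s * real L ^ j" using s L by (intro mult_ge1_I) auto
        moreover have "real (card {- (2 * int s * int L ^ j)..2 * int s * int L ^ j}) = 4 * (real s * real L ^ j) + 1"
        proof -
          have "card {- (2 * int s * int L ^ j)..2 * int s * int L ^ j} = nat (4 * (int s * int L ^ j) + 1)" by simp
          also have "real \<dots> = real_of_int (4 * (int s * int L ^ j) + 1)" by (intro of_nat_nat) simp
          finally show ?thesis by simp
        qed
        ultimately show "real (card {- (2 * int s * int L ^ j)..2 * int s * int L ^ j}) \<le> 5 * real s * real L ^ j" by simp
      qed simp
      also have "\<dots> = (5 * real s) ^ (r - 1) * real L ^ (\<Sum>j\<in>{1..<r}. j)"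
        by (simp add: prod.distrib power_sum)
      also have "real L ^ (\<Sum>j\<in>{1..<r}. j) = real L powr (real s - r)"
      proof -
        have "real (\<Sum>j\<in>{1..<r}. j) = real s - r"
          using sum_lessThan_tri[OF r(1)] unfolding s_def by linarith
        then show ?thesis using L by (metis gr0I of_nat_0_less_iff not_one_le_zero powr_realpow)
      qed
      finally show ?thesis .
    qed
    have finZ: "finite (Z h)" for h using fin by (simp add: Z_def)
    have "card {x \<in> tuples s S. signed_sum s x (poly f) = 0} \<le> card (\<Union>h\<in>Hs. Z h)"
      using finH finZ sub by (intro card_mono) auto
    also have "\<dots> \<le> (\<Sum>h\<in>Hs. card (Z h))" by (rule card_UN_le[OF finH])
    finally have "real (card {x \<in> tuples s S. signed_sum s x (poly f) = 0}) \<le> real (\<Sum>h\<in>Hs. card (Z h))"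
      by (simp only: of_nat_le_iff)
    also have "\<dots> = (\<Sum>h\<in>Hs. real (card (Z h)))" by (rule of_nat_sum)
    also have "\<dots> \<le> (\<Sum>h\<in>Hs. real (card (Z (\<lambda>_. 0))))" by (rule sum_mono[OF Zle])
    also have "\<dots> = real (card Hs) * real (card (Z (\<lambda>_. 0)))" by simp
    also have "\<dots> \<le> ((5 * real s) ^ (r - 1) * real L powr (real s - r)) * (A * real L powr (real s + \<epsilon>))"
    proof (intro mult_mono cardH)
      have "card (Z (\<lambda>_. 0)) \<le> card (vinogradov_sols r f S)" using Z0 fin by (intro card_mono) auto
      then have "real (card (Z (\<lambda>_. 0))) \<le> real (card (vinogradov_sols r f S))" by simp
      also have "\<dots> \<le> A * real L powr (real s + \<epsilon>)"
        unfolding s_def using r nd L by (intro bound[of L f S c]) (auto simp: d_def S_def)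
      finally show "real (card (Z (\<lambda>_. 0))) \<le> A * real L powr (real s + \<epsilon>)" .
    qed auto
    also have "\<dots> = ((5 * real s) ^ (r - 1) * A) * real L powr (real (2 * s) - r + \<epsilon>)"
    proof -
      have "real (2 * s) - r + \<epsilon> = (real s - r) + (real s + \<epsilon>)" by simp
      then show ?thesis by (simp only: powr_add mult_ac)
    qed
    finally show ?thesis unfolding S_def .
  qed
  then show ?thesis using A unfolding s_def by (intro exI[of _ "(5 * real (tri r)) ^ (r - 1) * A"]) auto
qed

section \<open>Hua's lemma\<close>

lemma card_divisors_prime_power_mult:
  fixes p m a :: nat
  assumes p: "prime p" and m: "m > 0"
  shows "card {d. d dvd p ^ a * m} \<le> (a + 1) * card {d. d dvd m}"
proof -
  have fin: "finite {d. d dvd m}" using m by simp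
  have "{d. d dvd p ^ a * m} \<subseteq> (\<lambda>(i, d). p ^ i * d) ` ({..a} \<times> {d. d dvd m})"
  proof
    fix d assume "d \<in> {d. d dvd p ^ a * m}"
    then obtain b' c' where d: "d = b' * c'" "b' dvd p ^ a" "c' dvd m" using division_decomp by blast
    then obtain i where "b' = p ^ i" "i \<le> a" using divides_primepow_nat[OF p] by blast
    then show "d \<in> (\<lambda>(i, d). p ^ i * d) ` ({..a} \<times> {d. d dvd m})" using d by force
  qed
  then have "card {d. d dvd p ^ a * m} \<le> card ((\<lambda>(i, d). p ^ i * d) ` ({..a} \<times> {d. d dvd m}))"
    using fin by (intro card_mono) auto
  also have "\<dots> \<le> card ({..a} \<times> {d. d dvd m})" using fin by (intro card_image_le) auto
  also have "\<dots> = (a + 1) * card {d. d dvd m}" by (simp only: card_cartesian_product card_atMost) simp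
  finally show ?thesis .
qed

text \<open>A prime power \<open>p^a\<close> exactly dividing \<open>n\<close> contributes
  \<open>a + 1\<close> divisors against \<open>p^(a\<epsilon>)\<close>. For
  \<open>p \<ge> 2^(1/\<epsilon>)\<close> the ratio is at most one, and each smaller prime costs at
  most \<open>C0\<close>; \<open>sp n\<close> keeps track of these while prime powers are stripped
  off.\<close>

lemma card_divisors_bound:
  fixes \<epsilon> :: real
  assumes \<epsilon>: "\<epsilon> > 0"
  shows "\<exists>C\<ge>1. \<forall>n::nat. n \<ge> 1 \<longrightarrow> real (card {d. d dvd n}) \<le> C * real n powr \<epsilon>"
proof -
  define t where "t = \<epsilon> * ln 2"
  have t: "t > 0" using \<epsilon> by (simp add: t_def)
  define C0 where "C0 = 1 + 1 / t"
  have C0: "C0 \<ge> 1" using t by (simp add: C0_def)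
  have small: "real a + 1 \<le> C0 * 2 powr (a * \<epsilon>)" for a :: nat
  proof -
    have "2 powr (a * \<epsilon>) = exp (a * t)" by (simp add: powr_def t_def mult_ac)
    moreover have "1 + a * t \<le> exp (a * t)" by simp
    moreover have "real a + 1 \<le> C0 * (1 + a * t)"
    proof -
      have "C0 * (1 + a * t) = 1 + a + a * t + 1 / t" using t by (simp add: C0_def field_simps)
      moreover have "0 \<le> a * t + 1 / t" using t by simp
      ultimately show ?thesis by linarith
    qed
    ultimately show ?thesis using C0 by (smt (verit) mult_left_mono)
  qed
  obtain P0 :: nat where P0: "real P0 \<ge> 2 powr (1 / \<epsilon>)" by (meson real_arch_simple)
  have large: "2 \<le> real p powr \<epsilon>" if "p \<ge> P0" for p :: nat
  proof -
    have "2 = (2 powr (1 / \<epsilon>)) powr \<epsilon>" using \<epsilon> by (simp add: powr_powr)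
    also have "\<dots> \<le> real p powr \<epsilon>" using P0 that \<epsilon> by (intro powr_mono2) auto
    finally show ?thesis .
  qed
  define sp where "sp = (\<lambda>n. {p. p < P0 \<and> prime p \<and> p dvd n})"
  have finsp: "finite (sp n)" for n unfolding sp_def by (rule finite_subset[of _ "{..<P0}"]) auto
  have main: "real (card {d. d dvd n}) \<le> C0 ^ card (sp n) * real n powr \<epsilon>" if "n \<ge> 1" for n :: nat
    using that
  proof (induction n rule: less_induct)
    case (less n)
    show ?case
    proof (cases "n = 1")
      case True
      then show ?thesis using C0 by simp
    next
      case False
      then obtain p where p: "prime p" "p dvd n" using prime_factor_nat by blast
      define a where "a = multiplicity p n"
      obtain m where m: "n = p ^ a * m" "\<not> p dvd m"
        using multiplicity_decompose'[of n p] less.prems p unfolding a_def by (metis not_one_le_zero not_prime_unit)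
      have m0: "m \<ge> 1" using m less.prems by (cases m) auto
      have p2: "p \<ge> 2" using p(1) prime_ge_2_nat by blast
      have a1: "a \<ge> 1" using p m by (cases a) auto
      have pa: "p ^ a > 1" using p2 a1 by (metis less_le_trans one_less_numeral_iff one_less_power semiring_norm(76) zero_less_one)
      then have mn: "m < n" using m m0 by simp
      have IH: "real (card {d. d dvd m}) \<le> C0 ^ card (sp m) * real m powr \<epsilon>" using less.IH[OF mn m0] .
      have pr: "x dvd n \<longleftrightarrow> x = p \<or> x dvd m" if "prime x" for x
      proof -
        have "x dvd p ^ a \<longleftrightarrow> x = p"
          using that p(1) a1 by (metis dvd_power prime_dvd_power primes_dvd_imp_eq less_le_trans zero_less_one)
        then show ?thesis using that by (simp add: m(1) prime_dvd_mult_iff)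
      qed
      have n_eq: "real n powr \<epsilon> = real p powr (a * \<epsilon>) * real m powr \<epsilon>"
        using p2 by (simp add: m(1) powr_mult powr_powr powr_realpow[symmetric])
      have "real (card {d. d dvd n}) \<le> (real a + 1) * real (card {d. d dvd m})"
      proof -
        have "card {d. d dvd n} \<le> (a + 1) * card {d. d dvd m}"
          using card_divisors_prime_power_mult[OF p(1), of m a] m0 m(1) by simp
        then have "real (card {d. d dvd n}) \<le> real ((a + 1) * card {d. d dvd m})" by (simp only: of_nat_le_iff)
        then show ?thesis by (simp add: algebra_simps)
      qed
      also have "\<dots> \<le> (real a + 1) * (C0 ^ card (sp m) * real m powr \<epsilon>)"
        using IH by (intro mult_left_mono) auto
      also have "\<dots> \<le> C0 ^ card (sp n) * real n powr \<epsilon>"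
      proof (cases "p < P0")
        case True
        have "sp n = insert p (sp m)" "p \<notin> sp m"
          using True p(1) m(2) pr by (auto simp: sp_def)
        then have cs: "card (sp n) = Suc (card (sp m))" using finsp by simp
        have "real a + 1 \<le> C0 * real p powr (a * \<epsilon>)"
        proof -
          have "2 powr (a * \<epsilon>) \<le> real p powr (a * \<epsilon>)" using p2 \<epsilon> by (intro powr_mono2) auto
          then show ?thesis using small[of a] C0 by (smt (verit) mult_left_mono)
        qed
        then have "(real a + 1) * (C0 ^ card (sp m) * real m powr \<epsilon>)
           \<le> (C0 * real p powr (a * \<epsilon>)) * (C0 ^ card (sp m) * real m powr \<epsilon>)"
          using C0 by (intro mult_right_mono) auto
        then show ?thesis by (simp add: cs n_eq mult_ac)
      next
        case False
        have "sp n = sp m"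
          using False p(1) m(2) pr by (auto simp: sp_def)
        moreover have "real a + 1 \<le> real p powr (a * \<epsilon>)"
        proof -
          have "a + 1 \<le> 2 ^ a" by (induction a) auto
          then have "real (a + 1) \<le> real (2 ^ a)" by (simp only: of_nat_le_iff)
          then have "real a + 1 \<le> 2 ^ a" by simp
          also have "\<dots> \<le> (real p powr \<epsilon>) ^ a" using large[of p] False by (intro power_mono) auto
          also have "\<dots> = real p powr (a * \<epsilon>)" using p2 by (simp add: powr_powr powr_realpow[symmetric] mult.commute)
          finally show ?thesis .
        qed
        then have "(real a + 1) * (C0 ^ card (sp m) * real m powr \<epsilon>)
           \<le> real p powr (a * \<epsilon>) * (C0 ^ card (sp m) * real m powr \<epsilon>)"
          using C0 by (intro mult_right_mono) auto
        ultimately show ?thesis by (simp add: n_eq mult_ac)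
      qed
      finally show ?thesis .
    qed
  qed
  have "real (card {d. d dvd n}) \<le> C0 ^ P0 * real n powr \<epsilon>" if "n \<ge> 1" for n :: nat
  proof -
    have "card (sp n) \<le> card {..<P0}" unfolding sp_def by (intro card_mono) auto
    then have "C0 ^ card (sp n) \<le> C0 ^ P0" using C0 by (intro power_increasing) auto
    then have "C0 ^ card (sp n) * real n powr \<epsilon> \<le> C0 ^ P0 * real n powr \<epsilon>" by (intro mult_right_mono) auto
    with main[OF that] show ?thesis by linarith
  qed
  then show ?thesis using C0 by (intro exI[of _ "C0 ^ P0"]) auto
qed

lemma card_int_divisors_le:
  fixes v :: int
  assumes "v \<noteq> 0"
  shows "finite {h. h dvd v}" "card {h. h dvd v} \<le> 2 * card {d. d dvd nat \<bar>v\<bar>}"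
proof -
  let ?D = "{d. d dvd nat \<bar>v\<bar>}"
  have fin: "finite ?D" using assms by (intro finite_divisors_nat) simp
  have sub: "{h. h dvd v} \<subseteq> int ` ?D \<union> (\<lambda>d. - int d) ` ?D"
  proof
    fix h assume "h \<in> {h. h dvd v}"
    then have "nat \<bar>h\<bar> \<in> ?D" by (simp add: nat_abs_dvd_iff)
    moreover have "h = int (nat \<bar>h\<bar>) \<or> h = - int (nat \<bar>h\<bar>)" by auto
    ultimately show "h \<in> int ` ?D \<union> (\<lambda>d. - int d) ` ?D" by blast
  qed
  then show "finite {h. h dvd v}" using fin finite_subset by blast
  have "card {h. h dvd v} \<le> card (int ` ?D \<union> (\<lambda>d. - int d) ` ?D)" using sub fin by (intro card_mono) auto
  also have "\<dots> \<le> card (int ` ?D) + card ((\<lambda>d. - int d) ` ?D)" by (rule card_Un_le)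
  also have "\<dots> \<le> card ?D + card ?D" using fin by (intro add_mono card_image_le)
  finally show "card {h. h dvd v} \<le> 2 * card ?D" by simp
qed

section \<open>Weyl differencing\<close>

definition fwd_diff :: "int \<Rightarrow> int poly \<Rightarrow> int poly" where
  "fwd_diff h f = pcompose f [:h, 1:] - f"

lemma poly_fwd_diff: "poly (fwd_diff h f) n = poly f (n + h) - poly f n"
  by (simp add: fwd_diff_def poly_pcompose add.commute)

lemma fwd_diff_smult: "fwd_diff h (smult a f) = smult a (fwd_diff h f)"
  by (simp add: fwd_diff_def pcompose_smult smult_diff_right)

lemma fwd_diff_multiple: "\<exists>g. fwd_diff h f = smult h g"
proof -
  have "\<exists>g. pcompose f [:h, 1:] - f = smult h g"
  proof (induction f)
    case (pCons a f)
    then obtain g where g: "pcompose f [:h, 1:] = f + smult h g" by (metis diff_add_cancel add.commute)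
    have "pcompose (pCons a f) [:h, 1:] - pCons a f = smult h (pcompose f [:h, 1:] + pCons 0 g)"
      by (simp add: pcompose_pCons g smult_add_right)
    then show ?case by blast
  qed simp
  then show ?thesis by (simp add: fwd_diff_def)
qed

text \<open>Let \<open>g\<close> be the derivative of order one below the degree, which is linear
  with nonzero slope. Up to the factor \<open>n!\<close>, the relevant coefficient of the difference
  is \<open>poly g h - poly g 0\<close>, nonzero for \<open>h \<noteq> 0\<close>.\<close>

lemma degree_fwd_diff_ge:
  assumes h: "h \<noteq> 0"
  shows "degree f \<le> Suc (degree (fwd_diff h f))"
proof (cases "degree f")
  case (Suc n)
  define g where "g = (pderiv ^^ n) f"
  have deg: "degree g \<le> 1" using Suc by (simp add: g_def degree_higher_pderiv)
  have lc: "coeff f (Suc n) \<noteq> 0" using Suc by (metis coeff_0 degree_0 leading_coeff_0_iff nat.distinct(1))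
  have "poly g h = coeff g 0 + coeff g 1 * h"
    using arg_cong[OF poly_as_sum_of_monoms'[OF deg], of "\<lambda>A. poly A h"] by (simp add: poly_monom)
  moreover have "coeff g 1 \<noteq> 0"
    using lc by (simp add: g_def coeff_higher_pderiv pochhammer_prod)
  ultimately have ne: "poly g h \<noteq> coeff g 0" using h by simp
  have "poly g h = taylor_coeff h g 0" by (simp add: taylor_coeff_def poly_0_coeff_0[symmetric] poly_pcompose)
  also have "\<dots> = fact n * taylor_coeff h f n"
    unfolding g_def taylor_coeff_higher_pderiv by (simp add: pochhammer_fact)
  finally have "fact n * taylor_coeff h f n \<noteq> fact n * coeff f n"
    using ne by (simp add: g_def coeff_higher_pderiv pochhammer_fact)
  then have "coeff (fwd_diff h f) n \<noteq> 0" by (auto simp: fwd_diff_def taylor_coeff_def)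
  then have "n \<le> degree (fwd_diff h f)" by (rule le_degree)
  then show ?thesis using Suc by simp
qed simp

lemma degree_fwd_diff_le: "degree (fwd_diff h f) \<le> degree f"
  unfolding fwd_diff_def by (intro degree_diff_le) (auto simp: degree_pcompose)

definition shift_meet :: "int \<Rightarrow> int set \<Rightarrow> int set" where
  "shift_meet h S = {n \<in> S. n + h \<in> S}"

lemma shift_meet_subset: "shift_meet h S \<subseteq> S"
  by (auto simp: shift_meet_def)

fun wdiff :: "int set \<Rightarrow> int \<Rightarrow> nat \<Rightarrow> int poly \<Rightarrow> int set \<Rightarrow> int \<Rightarrow> complex" where
  "wdiff H Q 0 f S t = (\<Sum>n\<in>S. add_char Q (t * poly f n))"
| "wdiff H Q (Suc j) f S t = (\<Sum>h\<in>H. wdiff H Q j (fwd_diff h f) (shift_meet h S) t)"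

text \<open>Counts pairs of a vector of \<open>j\<close> differences in \<open>H\<close> and a
  surviving point at which the \<open>j\<close>-fold difference satisfies \<open>R\<close>. Repeated
  differences and zero are included, since \<open>H\<close> is the same at every stage.\<close>

fun wcount :: "int set \<Rightarrow> nat \<Rightarrow> int poly \<Rightarrow> int set \<Rightarrow> (int \<Rightarrow> bool) \<Rightarrow> nat" where
  "wcount H 0 f S R = card {n \<in> S. R (poly f n)}"
| "wcount H (Suc j) f S R = (\<Sum>h\<in>H. wcount H j (fwd_diff h f) (shift_meet h S) R)"

lemma weyl_square:
  assumes S: "finite S" and H: "finite H" "\<And>n n'. n \<in> S \<Longrightarrow> n' \<in> S \<Longrightarrow> n' - n \<in> H"
  shows "complex_of_real ((norm (\<Sum>n\<in>S. add_char Q (t * poly f n)))\<^sup>2) = (\<Sum>h\<in>H. \<Sum>n\<in>shift_meet h S. add_char Q (t * poly (fwd_diff h f) n))"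
proof -
  have "complex_of_real ((norm (\<Sum>n\<in>S. add_char Q (t * poly f n)))\<^sup>2)
     = (\<Sum>n'\<in>S. \<Sum>n\<in>S. add_char Q (t * poly f n' - t * poly f n))"
    unfolding complex_norm_square cnj_sum sum_product by (intro sum.cong refl) (rule add_char_diff)
  also have "\<dots> = (\<Sum>n\<in>S. \<Sum>n'\<in>S. add_char Q (t * poly f n' - t * poly f n))" by (rule sum.swap)
  also have "\<dots> = (\<Sum>n\<in>S. \<Sum>h\<in>{h \<in> H. n + h \<in> S}. add_char Q (t * poly (fwd_diff h f) n))"
  proof (rule sum.cong[OF refl])
    fix n assume n: "n \<in> S"
    show "(\<Sum>n'\<in>S. add_char Q (t * poly f n' - t * poly f n)) = (\<Sum>h\<in>{h \<in> H. n + h \<in> S}. add_char Q (t * poly (fwd_diff h f) n))"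
      by (rule sum.reindex_bij_witness[where i = "\<lambda>h. n + h" and j = "\<lambda>n'. n' - n"])
         (use H(2) n in \<open>auto simp: poly_fwd_diff algebra_simps\<close>)
  qed
  also have "\<dots> = (\<Sum>h\<in>H. \<Sum>n\<in>{n \<in> S. n + h \<in> S}. add_char Q (t * poly (fwd_diff h f) n))"
    by (rule sum.swap_restrict[OF S H(1)])
  finally show ?thesis by (simp add: shift_meet_def)
qed

text \<open>Squaring alternates with Hoelder's inequality over the at most \<open>K\<close>
  differences. With \<open>J = Suc j\<close> the exponent \<open>2^J - J - 1\<close> starts at zero
  and grows by \<open>2^J - 1\<close> in each round.\<close>

lemma weyl_differencing:
  assumes "finite S" "finite H" "\<And>n n'. n \<in> S \<Longrightarrow> n' \<in> S \<Longrightarrow> n' - n \<in> H" "card H \<le> K"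
  shows "norm (\<Sum>n\<in>S. add_char Q (t * poly f n)) ^ (2 ^ Suc j) \<le> real K ^ (2 ^ Suc j - Suc j - 1) * Re (wdiff H Q (Suc j) f S t)"
  using assms(1,3)
proof (induction j arbitrary: f S)
  case 0
  have "complex_of_real ((norm (\<Sum>n\<in>S. add_char Q (t * poly f n)))\<^sup>2) = wdiff H Q (Suc 0) f S t"
    by (simp only: weyl_square[OF 0(1) assms(2) 0(2)] wdiff.simps)
  from arg_cong[OF this, of Re] have "(norm (\<Sum>n\<in>S. add_char Q (t * poly f n)))\<^sup>2 = Re (wdiff H Q (Suc 0) f S t)"
    by (simp only: Re_complex_of_real)
  then show ?case by (simp del: wdiff.simps)
next
  case (Suc j)
  obtain e where e: "(2::nat) ^ Suc j = Suc e" by (cases "(2::nat) ^ Suc j") auto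
  let ?V = "\<lambda>f S. \<Sum>n\<in>S. add_char Q (t * poly f n)"
  have j2: "Suc j < 2 ^ Suc j" by (rule less_exp)
  have "(norm (?V f S))\<^sup>2 = norm (\<Sum>h\<in>H. ?V (fwd_diff h f) (shift_meet h S))"
    using arg_cong[OF weyl_square[OF Suc.prems(1) assms(2) Suc.prems(2), where Q = Q and t = t and f = f], of norm]
    by (simp add: norm_power)
  also have "\<dots> \<le> (\<Sum>h\<in>H. norm (?V (fwd_diff h f) (shift_meet h S)))" by (rule norm_sum)
  finally have "((norm (?V f S))\<^sup>2) ^ 2 ^ Suc j \<le> (\<Sum>h\<in>H. norm (?V (fwd_diff h f) (shift_meet h S))) ^ 2 ^ Suc j"
    by (intro power_mono) auto
  also have "\<dots> \<le> real (card H) ^ e * (\<Sum>h\<in>H. norm (?V (fwd_diff h f) (shift_meet h S)) ^ 2 ^ Suc j)"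
    unfolding e by (intro power_sum_le_card assms(2)) auto
  also have "\<dots> \<le> real K ^ e * (\<Sum>h\<in>H. real K ^ (2 ^ Suc j - Suc j - 1) * Re (wdiff H Q (Suc j) (fwd_diff h f) (shift_meet h S) t))"
  proof (intro mult_mono power_mono sum_mono)
    fix h
    show "norm (?V (fwd_diff h f) (shift_meet h S)) ^ 2 ^ Suc j \<le> real K ^ (2 ^ Suc j - Suc j - 1) * Re (wdiff H Q (Suc j) (fwd_diff h f) (shift_meet h S) t)"
    proof (rule Suc.IH)
      show "finite (shift_meet h S)" using Suc.prems(1) shift_meet_subset finite_subset by blast
      show "n' - n \<in> H" if "n \<in> shift_meet h S" "n' \<in> shift_meet h S" for n n'
        using that Suc.prems(2) by (auto simp: shift_meet_def)
    qed
  qed (use assms(4) in \<open>auto intro: sum_nonneg\<close>)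
  also have "\<dots> = real K ^ (e + (2 ^ Suc j - Suc j - 1)) * Re (wdiff H Q (Suc (Suc j)) f S t)"
    unfolding power_add wdiff.simps(2)[of H Q "Suc j"] Re_sum by (simp only: sum_distrib_left mult.assoc)
  also have "e + (2 ^ Suc j - Suc j - 1) = 2 ^ Suc (Suc j) - Suc (Suc j) - 1" using e j2 by simp
  finally show ?case by (simp add: power_mult[symmetric])
qed

lemma sum_wdiff_add_char:
  assumes Q: "Q > 0" and H: "finite H" and S: "finite S"
  shows "(\<Sum>t\<in>{0..<Q}. wdiff H Q j f S t * add_char Q (t * w)) = of_int Q * of_nat (wcount H j f S (\<lambda>v. Q dvd v + w))"
  using S
proof (induction j arbitrary: f S)
  case 0
  have "(\<Sum>t\<in>{0..<Q}. wdiff H Q 0 f S t * add_char Q (t * w)) = (\<Sum>t\<in>{0..<Q}. \<Sum>n\<in>S. add_char Q (t * (poly f n + w)))"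
    by (simp add: sum_distrib_right distrib_left add_char_add)
  also have "\<dots> = (\<Sum>n\<in>S. \<Sum>t\<in>{0..<Q}. add_char Q (t * (poly f n + w)))" by (rule sum.swap)
  also have "\<dots> = (\<Sum>n\<in>S. if Q dvd poly f n + w then of_int Q else 0)" by (simp only: add_char_orth[OF Q])
  also have "\<dots> = of_int Q * of_nat (wcount H 0 f S (\<lambda>v. Q dvd v + w))"
    using 0 by (simp add: sum.If_cases Int_def mult.commute)
  finally show ?case .
next
  case (Suc j)
  have fin: "finite (shift_meet h S)" for h using Suc.prems shift_meet_subset finite_subset by blast
  have "(\<Sum>t\<in>{0..<Q}. wdiff H Q (Suc j) f S t * add_char Q (t * w))
     = (\<Sum>h\<in>H. \<Sum>t\<in>{0..<Q}. wdiff H Q j (fwd_diff h f) (shift_meet h S) t * add_char Q (t * w))"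
    unfolding wdiff.simps sum_distrib_right by (rule sum.swap)
  also have "\<dots> = (\<Sum>h\<in>H. of_int Q * of_nat (wcount H j (fwd_diff h f) (shift_meet h S) (\<lambda>v. Q dvd v + w)))"
    using Suc.IH[OF fin] by simp
  finally show ?case by (simp add: sum_distrib_left)
qed

lemma wcount_exact:
  fixes W :: int
  assumes H: "finite H" and S: "finite S"
  shows "\<exists>Q0. \<forall>Q>Q0. \<forall>w. \<bar>w\<bar> \<le> W \<longrightarrow> wcount H j f S (\<lambda>v. Q dvd v + w) = wcount H j f S (\<lambda>v. v = - w)"
  using S
proof (induction j arbitrary: f S)
  case 0
  define A where "A = (\<Sum>n\<in>S. \<bar>poly f n\<bar>)"
  have "wcount H 0 f S (\<lambda>v. Q dvd v + w) = wcount H 0 f S (\<lambda>v. v = - w)" if "Q > A + W" "\<bar>w\<bar> \<le> W" for Q w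
  proof -
    have "Q dvd poly f n + w \<longleftrightarrow> poly f n = - w" if n: "n \<in> S" for n
    proof
      assume d: "Q dvd poly f n + w"
      have "\<bar>poly f n\<bar> \<le> A" unfolding A_def using 0 n by (intro member_le_sum) auto
      then have "\<bar>poly f n + w\<bar> < Q" using \<open>Q > A + W\<close> \<open>\<bar>w\<bar> \<le> W\<close> by linarith
      then have "poly f n + w = 0" using dvd_imp_le_int[OF _ d] by linarith
      then show "poly f n = - w" by linarith
    qed simp
    then have "{n \<in> S. Q dvd poly f n + w} = {n \<in> S. poly f n = - w}" by blast
    then show ?thesis by simp
  qed
  then show ?case by blast
next
  case (Suc j)
  have fin: "finite (shift_meet h S)" for h using Suc.prems shift_meet_subset finite_subset by blast
  have "\<forall>h. \<exists>Q0. \<forall>Q>Q0. \<forall>w. \<bar>w\<bar> \<le> W \<longrightarrow>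
     wcount H j (fwd_diff h f) (shift_meet h S) (\<lambda>v. Q dvd v + w) = wcount H j (fwd_diff h f) (shift_meet h S) (\<lambda>v. v = - w)"
    using Suc.IH[OF fin] by blast
  then obtain Q0 where Q0: "\<And>h Q w. Q > Q0 h \<Longrightarrow> \<bar>w\<bar> \<le> W \<Longrightarrow>
     wcount H j (fwd_diff h f) (shift_meet h S) (\<lambda>v. Q dvd v + w) = wcount H j (fwd_diff h f) (shift_meet h S) (\<lambda>v. v = - w)" by metis
  have "wcount H (Suc j) f S (\<lambda>v. Q dvd v + w) = wcount H (Suc j) f S (\<lambda>v. v = - w)"
    if Q: "Q > (\<Sum>h\<in>H. \<bar>Q0 h\<bar>)" and w: "\<bar>w\<bar> \<le> W" for Q w
  proof -
    have "Q > Q0 h" if "h \<in> H" for h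
    proof -
      have "\<bar>Q0 h\<bar> \<le> (\<Sum>h\<in>H. \<bar>Q0 h\<bar>)" using that H by (intro member_le_sum) auto
      then show ?thesis using Q by linarith
    qed
    then show ?thesis using Q0 w by simp
  qed
  then show ?case by blast
qed

lemma wcount_smult:
  assumes "\<not> h dvd v"
  shows "wcount H j (smult h g) S (\<lambda>y. y = v) = 0"
proof (induction j arbitrary: g S)
  case 0
  have eq: "{n \<in> S. poly (smult h g) n = v} = {}" using assms by auto
  show ?case unfolding wcount.simps eq by simp
qed (simp add: fwd_diff_smult)

lemma wcount_le_total:
  assumes S: "finite S" and L: "card S \<le> L" and H: "card H \<le> K"
  shows "wcount H j f S R \<le> K ^ j * L"
  using S L
proof (induction j arbitrary: f S)
  case 0
  have "card {n \<in> S. R (poly f n)} \<le> card S" using 0 by (intro card_mono) auto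
  then show ?case using 0 by simp
next
  case (Suc j)
  have le: "wcount H j (fwd_diff h f) (shift_meet h S) R \<le> K ^ j * L" for h
  proof (rule Suc.IH)
    show "finite (shift_meet h S)" using Suc.prems shift_meet_subset finite_subset by blast
    have "card (shift_meet h S) \<le> card S" using Suc.prems shift_meet_subset by (intro card_mono) auto
    then show "card (shift_meet h S) \<le> L" using Suc.prems by linarith
  qed
  have "wcount H (Suc j) f S R \<le> (\<Sum>h\<in>H. K ^ j * L)" unfolding wcount.simps by (intro sum_mono le)
  also have "\<dots> = card H * (K ^ j * L)" by simp
  also have "\<dots> \<le> K * (K ^ j * L)" using H by (intro mult_right_mono) auto
  finally show ?case by simp
qed

lemma card_poly_value_le:
  fixes f :: "int poly"
  assumes "degree f \<ge> 1"
  shows "card {n \<in> S. poly f n = v} \<le> degree f"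
proof -
  define g where "g = f + [:- v:]"
  have "degree g = degree f" unfolding g_def using assms by (intro degree_add_eq_left) simp
  then have g: "g \<noteq> 0" "degree g = degree f" using assms by auto
  have "{n \<in> S. poly f n = v} \<subseteq> {n. poly g n = 0}" by (auto simp: g_def)
  then have "card {n \<in> S. poly f n = v} \<le> card {n. poly g n = 0}"
    using poly_roots_finite[OF g(1)] by (intro card_mono)
  also have "\<dots> \<le> degree g" by (rule card_poly_roots_bound[OF g(1)])
  finally show ?thesis using g by simp
qed

text \<open>Each difference \<open>h\<close> divides the difference polynomial it creates, and
  further differencing keeps this factor; so only divisors of \<open>v\<close> occur. As none of
  them is zero, the final polynomial has positive degree and takes the value \<open>v\<close> at
  most \<open>d\<close> times.\<close>

lemma wcount_nonzero:
  assumes v: "v \<noteq> 0" and H: "finite H" and f: "j < degree f" "degree f \<le> d"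
  shows "wcount H j f S (\<lambda>y. y = v) \<le> (2 * card {e. e dvd nat \<bar>v\<bar>}) ^ j * d"
  using f
proof (induction j arbitrary: f S)
  case 0
  then show ?case using card_poly_value_le[of f S v] by simp
next
  case (Suc j)
  let ?D = "2 * card {e. e dvd nat \<bar>v\<bar>}"
  have "wcount H (Suc j) f S (\<lambda>y. y = v) = (\<Sum>h\<in>{h \<in> H. h dvd v}. wcount H j (fwd_diff h f) (shift_meet h S) (\<lambda>y. y = v))"
    unfolding wcount.simps
  proof (rule sum.mono_neutral_right[OF H])
    show "\<forall>h\<in>H - {h \<in> H. h dvd v}. wcount H j (fwd_diff h f) (shift_meet h S) (\<lambda>y. y = v) = 0"
    proof
      fix h assume "h \<in> H - {h \<in> H. h dvd v}"
      moreover obtain g where "fwd_diff h f = smult h g" using fwd_diff_multiple by blast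
      ultimately show "wcount H j (fwd_diff h f) (shift_meet h S) (\<lambda>y. y = v) = 0" using wcount_smult by simp
    qed
  qed auto
  also have "\<dots> \<le> (\<Sum>h\<in>{h \<in> H. h dvd v}. ?D ^ j * d)"
  proof (intro sum_mono Suc.IH)
    fix h assume "h \<in> {h \<in> H. h dvd v}"
    then have "h \<noteq> 0" using v by auto
    then show "j < degree (fwd_diff h f)" using degree_fwd_diff_ge[of h f] Suc.prems by linarith
    show "degree (fwd_diff h f) \<le> d" using degree_fwd_diff_le[of h f] Suc.prems by linarith
  qed
  also have "\<dots> = card {h \<in> H. h dvd v} * (?D ^ j * d)" by simp
  also have "\<dots> \<le> ?D * (?D ^ j * d)"
  proof (intro mult_right_mono)
    have "card {h \<in> H. h dvd v} \<le> card {h. h dvd v}" using card_int_divisors_le(1)[OF v] by (intro card_mono) auto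
    then show "card {h \<in> H. h dvd v} \<le> ?D" using card_int_divisors_le(2)[OF v] by linarith
  qed auto
  finally show ?case by simp
qed

text \<open>For vectors without a zero entry at most \<open>d\<close> points remain. A zero entry
  kills the polynomial, so all points count, but fixing the entry saves one factor \<open>K\<close>;
  there are \<open>j\<close> places for it, hence the constant \<open>d + j\<close>.\<close>

lemma wcount_zero:
  assumes H: "finite H" "card H \<le> K" and S: "finite S" "card S \<le> K" and f: "j < degree f" "degree f \<le> d"
  shows "wcount H j f S (\<lambda>y. y = 0) \<le> (d + j) * K ^ j"
  using S f
proof (induction j arbitrary: f S)
  case 0
  then show ?case using card_poly_value_le[of f S 0] by simp
next
  case (Suc j)
  have finS: "finite (shift_meet h S)" for h using Suc.prems shift_meet_subset finite_subset by blast
  have cS: "card (shift_meet h S) \<le> K" for h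
  proof -
    have "card (shift_meet h S) \<le> card S" using Suc.prems shift_meet_subset by (intro card_mono) auto
    then show ?thesis using Suc.prems by linarith
  qed
  let ?c = "\<lambda>h. wcount H j (fwd_diff h f) (shift_meet h S) (\<lambda>y. y = 0)"
  have "wcount H (Suc j) f S (\<lambda>y. y = 0) \<le> (\<Sum>h\<in>insert 0 (H - {0}). ?c h)"
    unfolding wcount.simps using H by (intro sum_mono2) auto
  also have "\<dots> = ?c 0 + (\<Sum>h\<in>H - {0}. ?c h)" using H by (simp add: sum.insert_remove)
  also have "\<dots> \<le> K ^ j * K + (\<Sum>h\<in>H - {0}. (d + j) * K ^ j)"
  proof (intro add_mono sum_mono)
    show "?c 0 \<le> K ^ j * K" by (rule wcount_le_total[OF finS cS H(2)])
    fix h assume h: "h \<in> H - {0}"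
    show "?c h \<le> (d + j) * K ^ j"
    proof (rule Suc.IH[OF finS cS])
      show "j < degree (fwd_diff h f)" using degree_fwd_diff_ge[of h f] Suc.prems h by auto
      show "degree (fwd_diff h f) \<le> d" using degree_fwd_diff_le[of h f] Suc.prems by linarith
    qed
  qed
  also have "(\<Sum>h\<in>H - {0}. (d + j) * K ^ j) = card (H - {0}) * ((d + j) * K ^ j)" by simp
  also have "\<dots> \<le> K * ((d + j) * K ^ j)"
  proof (intro mult_right_mono)
    have "card (H - {0}) \<le> card H" using H by (intro card_mono) auto
    then show "card (H - {0}) \<le> K" using H by linarith
  qed auto
  finally show ?case by (simp add: algebra_simps)
qed

section \<open>Mean values in short intervals\<close>

definition equation_sols :: "nat \<Rightarrow> int poly \<Rightarrow> int set \<Rightarrow> (nat \<Rightarrow> int) set" where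
  "equation_sols s f S = {x \<in> tuples s S. signed_sum s x (poly f) = 0}"

lemma sum_norm_power_eq_card:
  assumes Q: "Q > 0" and S: "finite S"
  shows "(\<Sum>t\<in>{0..<Q}. norm (\<Sum>n\<in>S. add_char Q (t * poly f n)) ^ (2 * s))
     = of_int Q * real (card {x \<in> tuples s S. Q dvd signed_sum s x (poly f)})"
proof -
  have "complex_of_real (\<Sum>t\<in>{0..<Q}. norm (\<Sum>n\<in>S. add_char Q (t * poly f n)) ^ (2 * s))
     = (\<Sum>t\<in>{0..<Q}. \<Sum>x\<in>tuples s S. add_char Q (t * signed_sum s x (poly f)))"
    unfolding of_real_sum norm_power_eq_sum_tuples[OF S] signed_sum_cmult ..
  also have "\<dots> = (\<Sum>x\<in>tuples s S. \<Sum>t\<in>{0..<Q}. add_char Q (t * signed_sum s x (poly f)))" by (rule sum.swap)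
  also have "\<dots> = (\<Sum>x\<in>tuples s S. if Q dvd signed_sum s x (poly f) then of_int Q else 0)" by (simp only: add_char_orth[OF Q])
  also have "\<dots> = complex_of_real (of_int Q * real (card {x \<in> tuples s S. Q dvd signed_sum s x (poly f)}))"
    using S by (simp add: sum.If_cases Int_def mult.commute)
  finally show ?thesis using of_real_eq_iff by blast
qed

lemma equation_sols_exact:
  assumes S: "finite S"
  shows "\<exists>Q0. \<forall>Q>Q0. \<forall>T\<subseteq>S. {x \<in> tuples s T. Q dvd signed_sum s x (poly f)} = equation_sols s f T"
proof -
  obtain Q0 where "\<forall>Q>Q0. \<forall>T\<subseteq>S. \<forall>h. (\<forall>i\<in>{1..1}. \<bar>h i\<bar> \<le> 0) \<longrightarrow>
     system_sols s 1 Q (\<lambda>_. f) T h = {x \<in> tuples s T. \<forall>i\<in>{1..1}. signed_sum s x (poly f) = h i}"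
    using system_sols_eq_exact[OF S, of 1 0 s "\<lambda>_. f"] by (rule exE)
  from this[rule_format, where h = "\<lambda>_. 0"] show ?thesis
    unfolding system_sols_def equation_sols_def by (intro exI[of _ Q0]) simp
qed

text \<open>The power \<open>2 * 2^J\<close> with \<open>J = Suc j\<close> splits into two halves.
  Differencing acts on one half; the other is expanded into tuples of \<open>2^J\<close> variables.
  Orthogonality then matches a value of the \<open>J\<close>-fold difference with a signed sum, for
  \<open>Q\<close> above both thresholds.\<close>

lemma hua_recursion:
  assumes S: "finite S" and H: "finite H" "\<And>n n'. n \<in> S \<Longrightarrow> n' \<in> S \<Longrightarrow> n' - n \<in> H" "card H \<le> K"
  shows "real (card (equation_sols (2 ^ Suc j) f S)) \<le> real K ^ (2 ^ Suc j - Suc j - 1) *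
     (\<Sum>x\<in>tuples (2 ^ j) S. real (wcount H (Suc j) f S (\<lambda>v. v = - signed_sum (2 ^ j) x (poly f))))"
proof -
  define A where "A = (\<Sum>n\<in>S. \<bar>poly f n\<bar>)"
  define W where "W = 2 * int (2 ^ j) * A"
  have W: "\<bar>signed_sum (2 ^ j) x (poly f)\<bar> \<le> W" if "x \<in> tuples (2 ^ j) S" for x
    unfolding W_def using S by (intro signed_sum_bound[OF that]) (auto simp: A_def intro: member_le_sum)
  obtain Q1 where Q1: "\<forall>Q>Q1. \<forall>T\<subseteq>S. {x \<in> tuples (2 ^ Suc j) T. Q dvd signed_sum (2 ^ Suc j) x (poly f)} = equation_sols (2 ^ Suc j) f T"
    using equation_sols_exact[OF S] by blast
  obtain Q2 where Q2: "\<forall>Q>Q2. \<forall>w. \<bar>w\<bar> \<le> W \<longrightarrow> wcount H (Suc j) f S (\<lambda>v. Q dvd v + w) = wcount H (Suc j) f S (\<lambda>v. v = - w)"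
    using wcount_exact[OF H(1) S] by blast
  define Q where "Q = max 1 (max (Q1 + 1) (Q2 + 1))"
  have Q: "Q > 0" "Q > Q1" "Q > Q2" by (auto simp: Q_def)
  define F where "F = (\<lambda>t. \<Sum>n\<in>S. add_char Q (t * poly f n))"
  define e where "e = (2::nat) ^ Suc j - Suc j - 1"
  have "of_int Q * real (card (equation_sols (2 ^ Suc j) f S)) = (\<Sum>t\<in>{0..<Q}. norm (F t) ^ (2 * 2 ^ Suc j))"
    using sum_norm_power_eq_card[OF Q(1) S, of f "2 ^ Suc j"] Q1 Q(2) by (simp add: F_def)
  also have "\<dots> = (\<Sum>t\<in>{0..<Q}. norm (F t) ^ 2 ^ Suc j * norm (F t) ^ (2 * 2 ^ j))"
    by (simp add: power_add[symmetric])
  also have "\<dots> \<le> (\<Sum>t\<in>{0..<Q}. (real K ^ e * Re (wdiff H Q (Suc j) f S t)) * norm (F t) ^ (2 * 2 ^ j))"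
    unfolding F_def e_def by (intro sum_mono mult_right_mono weyl_differencing S H zero_le_power norm_ge_zero)
  also have "\<dots> = real K ^ e * Re (\<Sum>t\<in>{0..<Q}. wdiff H Q (Suc j) f S t * complex_of_real (norm (F t) ^ (2 * 2 ^ j)))"
    unfolding Re_sum sum_distrib_left by (intro sum.cong refl) (simp del: of_real_power wdiff.simps)
  also have "(\<Sum>t\<in>{0..<Q}. wdiff H Q (Suc j) f S t * complex_of_real (norm (F t) ^ (2 * 2 ^ j)))
     = (\<Sum>t\<in>{0..<Q}. \<Sum>x\<in>tuples (2 ^ j) S. wdiff H Q (Suc j) f S t * add_char Q (t * signed_sum (2 ^ j) x (poly f)))"
    unfolding F_def norm_power_eq_sum_tuples[OF S] signed_sum_cmult sum_distrib_left ..
  also have "\<dots> = (\<Sum>x\<in>tuples (2 ^ j) S. \<Sum>t\<in>{0..<Q}. wdiff H Q (Suc j) f S t * add_char Q (t * signed_sum (2 ^ j) x (poly f)))"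
    by (rule sum.swap)
  also have "\<dots> = (\<Sum>x\<in>tuples (2 ^ j) S. of_int Q * of_nat (wcount H (Suc j) f S (\<lambda>v. Q dvd v + signed_sum (2 ^ j) x (poly f))))"
    by (simp only: sum_wdiff_add_char[OF Q(1) H(1) S])
  also have "\<dots> = (\<Sum>x\<in>tuples (2 ^ j) S. of_int Q * of_nat (wcount H (Suc j) f S (\<lambda>v. v = - signed_sum (2 ^ j) x (poly f))))"
    using Q2[rule_format, OF Q(3) W] by (intro sum.cong refl) (simp del: wcount.simps)
  also have "Re \<dots> = of_int Q * (\<Sum>x\<in>tuples (2 ^ j) S. real (wcount H (Suc j) f S (\<lambda>v. v = - signed_sum (2 ^ j) x (poly f))))"
    unfolding Re_sum sum_distrib_left by (intro sum.cong refl) (simp del: wcount.simps)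
  finally show ?thesis using Q(1) unfolding e_def by (simp del: wcount.simps add: mult.left_commute[of "real K ^ _"])
qed

lemma poly_abs_bound:
  fixes f :: "int poly"
  shows "\<exists>A\<ge>1. \<forall>N n. N \<ge> 1 \<longrightarrow> 0 \<le> n \<longrightarrow> n \<le> int N \<longrightarrow> \<bar>poly f n\<bar> \<le> A * int N ^ degree f"
proof -
  define A where "A = 1 + (\<Sum>i\<le>degree f. \<bar>coeff f i\<bar>)"
  have "\<bar>poly f n\<bar> \<le> A * int N ^ degree f" if "N \<ge> 1" "0 \<le> n" "n \<le> int N" for N n
  proof -
    have "\<bar>poly f n\<bar> \<le> (\<Sum>i\<le>degree f. \<bar>coeff f i * n ^ i\<bar>)"
      unfolding poly_altdef by (rule sum_abs)
    also have "\<dots> \<le> (\<Sum>i\<le>degree f. \<bar>coeff f i\<bar> * int N ^ degree f)"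
    proof (intro sum_mono)
      fix i assume "i \<in> {..degree f}"
      have "n ^ i \<le> int N ^ i" using that by (intro power_mono) auto
      also have "\<dots> \<le> int N ^ degree f" using that \<open>i \<in> _\<close> by (intro power_increasing) auto
      finally show "\<bar>coeff f i * n ^ i\<bar> \<le> \<bar>coeff f i\<bar> * int N ^ degree f"
        using that by (simp add: abs_mult mult_left_mono)
    qed
    also have "\<dots> \<le> A * int N ^ degree f" unfolding sum_distrib_right[symmetric] by (intro mult_right_mono) (auto simp: A_def)
    finally show ?thesis .
  qed
  moreover have "A \<ge> 1" by (simp add: A_def sum_nonneg)
  ultimately show ?thesis by blast
qed

text \<open>The bound gains in the length \<open>L\<close> of an arbitrary subinterval, because the
  maximal inequality descends to all dyadic pieces. The position enters only through
  \<open>N\<close> to a small power, which is what the divisor bound costs for values of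
  \<open>f\<close> of size a power of \<open>N\<close>.\<close>

definition mean_value_bound :: "nat \<Rightarrow> real \<Rightarrow> int poly \<Rightarrow> bool" where
  "mean_value_bound s \<rho> f \<longleftrightarrow> (\<forall>\<epsilon>>0. \<exists>C\<ge>0. \<forall>N::nat. N \<ge> 1 \<longrightarrow> (\<forall>c L. L \<ge> 1 \<longrightarrow> c + L \<le> N \<longrightarrow>
     real (card (equation_sols s f {int c + 1..int c + int L})) \<le> C * real N powr \<epsilon> * real L powr \<rho>))"

lemma mean_value_vinogradov:
  assumes "1 \<le> r" "r \<le> degree f"
  shows "mean_value_bound (tri r) (real (2 * tri r) - r) f"
  unfolding mean_value_bound_def
proof (intro allI impI)
  fix \<epsilon> :: real assume \<epsilon>: "\<epsilon> > 0"
  obtain C where C: "C \<ge> 0" "\<And>c L. L \<ge> 1 \<Longrightarrow> real (card {x \<in> tuples (tri r) {c + 1..c + int L}. signed_sum (tri r) x (poly f) = 0})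
     \<le> C * real L powr (real (2 * tri r) - r + \<epsilon>)"
    using vinogradov_mean_value[OF assms \<epsilon>] by blast
  have "real (card (equation_sols (tri r) f {int c + 1..int c + int L})) \<le> C * real N powr \<epsilon> * real L powr (real (2 * tri r) - r)"
    if "L \<ge> 1" "c + L \<le> N" for N c L :: nat
  proof -
    have "real (card (equation_sols (tri r) f {int c + 1..int c + int L})) \<le> C * real L powr (real (2 * tri r) - r + \<epsilon>)"
      unfolding equation_sols_def by (rule C(2)[OF that(1)])
    also have "\<dots> = C * (real L powr \<epsilon> * real L powr (real (2 * tri r) - r))" by (simp add: powr_add mult.commute)
    also have "\<dots> \<le> C * (real N powr \<epsilon> * real L powr (real (2 * tri r) - r))"
      using C(1) \<epsilon> that by (intro mult_left_mono mult_right_mono powr_mono2) auto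
    finally show ?thesis by (simp add: mult.assoc)
  qed
  then show "\<exists>C\<ge>0. \<forall>N::nat. N \<ge> 1 \<longrightarrow> (\<forall>c L. L \<ge> 1 \<longrightarrow> c + L \<le> N \<longrightarrow>
     real (card (equation_sols (tri r) f {int c + 1..int c + int L})) \<le> C * real N powr \<epsilon> * real L powr (real (2 * tri r) - r))"
    using C(1) by blast
qed

lemma card_equation_sols_1:
  assumes S: "finite S" and f: "degree f \<ge> 1"
  shows "card (equation_sols 1 f S) \<le> card S * degree f"
proof -
  have sub: "(\<lambda>x. (x 0, x 1)) ` equation_sols 1 f S \<subseteq> Sigma S (\<lambda>a. {b \<in> S. poly f b = poly f a})"
    by (auto simp: equation_sols_def signed_sum_def tuples_def lessThan_Suc numeral_2_eq_2)
  have "inj_on (\<lambda>x. (x 0, x 1)) (equation_sols 1 f S)"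
  proof (rule inj_onI)
    fix x y assume xy: "x \<in> equation_sols 1 f S" "y \<in> equation_sols 1 f S" "(x 0, x 1) = (y 0, y 1)"
    have ext: "x \<in> extensional {..<2}" "y \<in> extensional {..<2}" using xy by (auto simp: equation_sols_def tuples_def PiE_def)
    show "x = y"
    proof (rule extensionalityI[OF ext])
      fix i :: nat assume "i \<in> {..<2}"
      then have "i = 0 \<or> i = 1" by auto
      then show "x i = y i" using xy(3) by auto
    qed
  qed
  then have "card (equation_sols 1 f S) \<le> card (Sigma S (\<lambda>a. {b \<in> S. poly f b = poly f a}))"
    using sub S by (intro card_inj_on_le) auto
  also have "\<dots> = (\<Sum>a\<in>S. card {b \<in> S. poly f b = poly f a})" using S by simp
  also have "\<dots> \<le> (\<Sum>a\<in>S. degree f)" using card_poly_value_le[OF f] by (intro sum_mono)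
  finally show ?thesis by simp
qed

text \<open>Tuples with signed sum zero are bounded by the induction hypothesis and meet about
  \<open>L^(j+1)\<close> difference vectors and points; all other tuples are counted trivially and
  meet at most a small power of \<open>N\<close>. With exponent \<open>2^(j+1)\<close> of
  \<open>L\<close> both contributions agree.\<close>

theorem hua_lemma:
  "j < degree f \<Longrightarrow> mean_value_bound (2 ^ j) (real (2 ^ Suc j - Suc j)) f"
proof (induction j)
  case 0
  have "real (card (equation_sols 1 f {int c + 1..int c + int L})) \<le> real (degree f) * real N powr \<epsilon> * real L powr 1"
    if "L \<ge> 1" "c + L \<le> N" "\<epsilon> > 0" for c L N and \<epsilon> :: real
  proof -
    have "card (equation_sols 1 f {int c + 1..int c + int L}) \<le> L * degree f"
      using card_equation_sols_1[of "{int c + 1..int c + int L}" f] 0 by simp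
    then have "real (card (equation_sols 1 f {int c + 1..int c + int L})) \<le> real L * real (degree f)"
      by (simp flip: of_nat_mult)
    also have "\<dots> = real (degree f) * 1 * real L powr 1" using that by simp
    also have "\<dots> \<le> real (degree f) * real N powr \<epsilon> * real L powr 1"
      using that by (intro mult_right_mono mult_left_mono ge_one_powr_ge_zero) auto
    finally show ?thesis .
  qed
  then show ?case unfolding mean_value_bound_def by (auto intro!: exI[of _ "real (degree f)"])
next
  case (Suc j)
  define d where "d = degree f"
  have jd: "Suc j < d" using Suc.prems by (simp add: d_def)
  have IH: "mean_value_bound (2 ^ j) (real (2 ^ Suc j - Suc j)) f" using Suc by simp
  have j2: "Suc j < 2 ^ Suc j" by (rule less_exp)
  show ?case
    unfolding mean_value_bound_def
  proof (intro allI impI)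
    fix \<epsilon> :: real assume \<epsilon>: "\<epsilon> > 0"
    obtain C where C_IH: "C \<ge> 0 \<and> (\<forall>N::nat. N \<ge> 1 \<longrightarrow> (\<forall>c L. L \<ge> 1 \<longrightarrow> c + L \<le> N \<longrightarrow>
      real (card (equation_sols (2 ^ j) f {int c + 1..int c + int L})) \<le> C * real N powr \<epsilon> * real L powr (real (2 ^ Suc j - Suc j))))"
      using IH[unfolded mean_value_bound_def, THEN spec, THEN mp, OF \<epsilon>] by (rule exE)
    note C = conjunct1[OF C_IH] and IHb = conjunct2[OF C_IH, rule_format]
    \<comment> \<open>The divisor function is raised to the power \<open>Suc j\<close> and evaluated
      at integers of size \<open>N^d\<close>; this choice makes the total exponent equal to
      \<epsilon>.\<close>
    define \<delta> where "\<delta> = \<epsilon> / (real d * Suc j)"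
    have \<delta>: "\<delta> > 0" using \<epsilon> jd by (simp add: \<delta>_def)
    obtain C1 where C1: "C1 \<ge> 1" "\<And>n::nat. n \<ge> 1 \<Longrightarrow> real (card {e. e dvd n}) \<le> C1 * real n powr \<delta>"
      using card_divisors_bound[OF \<delta>] by blast
    obtain A where A: "A \<ge> 1" "\<And>N n. N \<ge> 1 \<Longrightarrow> 0 \<le> n \<Longrightarrow> n \<le> int N \<Longrightarrow> \<bar>poly f n\<bar> \<le> A * int N ^ d"
      using poly_abs_bound[of f] unfolding d_def by blast
    define X where "X = 2 * 2 ^ j * real_of_int A"
    have X: "X \<ge> 1" using A(1) one_le_power[of "2::real" j] unfolding X_def
      by (smt (verit) mult_le_cancel_left1 of_int_1_le_iff mult_less_cancel_right2)
    define C2 where "C2 = (2 * (C1 * X powr \<delta>)) ^ Suc j * d"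
    have C2: "C2 \<ge> 0" using C1 by (simp add: C2_def)
    define C3 where "C3 = 2 ^ (2 ^ Suc j - Suc j - 1) * (C * (real (d + Suc j) * 2 ^ Suc j) + C2)"
    have "real (card (equation_sols (2 ^ Suc j) f {int c + 1..int c + int L})) \<le> C3 * real N powr \<epsilon> * real L powr (real (2 ^ Suc (Suc j) - Suc (Suc j)))"
      if N: "N \<ge> 1" and L: "L \<ge> 1" and cL: "c + L \<le> N" for N c L
    proof -
      define S where "S = {int c + 1..int c + int L}"
      define H where "H = {- int L<..<int L}"
      have S: "finite S" "card S = L" by (auto simp: S_def)
      have H: "finite H" "card H \<le> 2 * L" by (auto simp: H_def)
      have HS: "n' - n \<in> H" if "n \<in> S" "n' \<in> S" for n n' using that by (auto simp: S_def H_def)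
      let ?signed_sum = "\<lambda>x. signed_sum (2 ^ j) x (poly f)"
      let ?w = "\<lambda>x. real (wcount H (Suc j) f S (\<lambda>v. v = - ?signed_sum x))"
      have fS: "\<bar>poly f n\<bar> \<le> A * int N ^ d" if "n \<in> S" for n
        using that cL N by (intro A(2)) (auto simp: S_def)
      have w0: "?w x \<le> real (d + Suc j) * 2 ^ Suc j * real L ^ Suc j" if "?signed_sum x = 0" for x
      proof -
        have "wcount H (Suc j) f S (\<lambda>v. v = 0) \<le> (d + Suc j) * (2 * L) ^ Suc j"
          using jd by (intro wcount_zero H S(1)) (auto simp: d_def S)
        then have "real (wcount H (Suc j) f S (\<lambda>v. v = 0)) \<le> real ((d + Suc j) * (2 * L) ^ Suc j)"
          by (simp only: of_nat_le_iff)
        also have "\<dots> = real (d + Suc j) * 2 ^ Suc j * real L ^ Suc j"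
          by (simp only: of_nat_mult of_nat_power of_nat_numeral power_mult_distrib mult.assoc)
        finally show ?thesis using that by simp
      qed
      have w1: "?w x \<le> C2 * real N powr \<epsilon>" if x: "x \<in> tuples (2 ^ j) S" and ne: "?signed_sum x \<noteq> 0" for x
      proof -
        let ?v = "- ?signed_sum x"
        let ?\<tau> = "card {e. e dvd nat \<bar>?v\<bar>}"
        have "\<bar>?signed_sum x\<bar> \<le> 2 * int (2 ^ j) * (A * int N ^ d)" by (rule signed_sum_bound[OF x fS])
        then have "real_of_int \<bar>?v\<bar> \<le> real_of_int (2 * int (2 ^ j) * (A * int N ^ d))" by (simp only: of_int_le_iff abs_minus_cancel)
        also have "\<dots> = X * real N ^ d" by (simp add: X_def)
        finally have v: "real (nat \<bar>?v\<bar>) \<le> X * real N ^ d" by simp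
        have "nat \<bar>?v\<bar> \<ge> 1" using ne by linarith
        then have "real ?\<tau> \<le> C1 * real (nat \<bar>?v\<bar>) powr \<delta>" by (rule C1(2))
        also have "\<dots> \<le> C1 * (X * real N ^ d) powr \<delta>" using C1 v \<delta> by (intro mult_left_mono powr_mono2) auto
        also have "\<dots> = C1 * X powr \<delta> * real N powr (d * \<delta>)"
          using N X by (simp add: powr_mult powr_powr powr_realpow[symmetric])
        finally have \<tau>: "real ?\<tau> \<le> C1 * X powr \<delta> * real N powr (d * \<delta>)" .
        have "wcount H (Suc j) f S (\<lambda>v. v = ?v) \<le> (2 * ?\<tau>) ^ Suc j * d"
          using ne jd by (intro wcount_nonzero H) (auto simp: d_def)
        then have "?w x \<le> real ((2 * ?\<tau>) ^ Suc j * d)" by (simp only: of_nat_le_iff)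
        also have "\<dots> = (2 * real ?\<tau>) ^ Suc j * d" by (simp only: of_nat_mult of_nat_power of_nat_numeral)
        also have "\<dots> \<le> (2 * (C1 * X powr \<delta> * real N powr (d * \<delta>))) ^ Suc j * d"
          using \<tau> by (intro mult_right_mono power_mono) auto
        also have "\<dots> = C2 * (real N powr (d * \<delta>)) ^ Suc j"
          unfolding C2_def by (simp only: power_mult_distrib mult_ac)
        also have "(real N powr (d * \<delta>)) ^ Suc j = real N powr (d * \<delta> * Suc j)"
          using N by (simp add: powr_powr powr_realpow[symmetric] del: power_Suc of_nat_Suc)
        also have "d * \<delta> * Suc j = \<epsilon>" using jd by (simp add: \<delta>_def)
        finally show ?thesis .
      qed
      let ?T = "tuples (2 ^ j) S"
      have finT: "finite ?T" using S by simp
      have Zb: "real (card (equation_sols (2 ^ j) f S)) \<le> C * real N powr \<epsilon> * real L ^ (2 ^ Suc j - Suc j)"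
        using IHb[OF N L cL] L by (simp add: S_def powr_realpow del: of_nat_diff)
      have N\<epsilon>: "real N powr \<epsilon> \<ge> 0" by simp
      have "(\<Sum>x\<in>?T. ?w x) = (\<Sum>x\<in>{x \<in> ?T. ?signed_sum x = 0}. ?w x) + (\<Sum>x\<in>{x \<in> ?T. ?signed_sum x \<noteq> 0}. ?w x)"
      proof -
        have eq: "{x \<in> ?T. ?signed_sum x = 0} \<union> {x \<in> ?T. ?signed_sum x \<noteq> 0} = ?T" by blast
        have "(\<Sum>x\<in>{x \<in> ?T. ?signed_sum x = 0} \<union> {x \<in> ?T. ?signed_sum x \<noteq> 0}. ?w x)
          = (\<Sum>x\<in>{x \<in> ?T. ?signed_sum x = 0}. ?w x) + (\<Sum>x\<in>{x \<in> ?T. ?signed_sum x \<noteq> 0}. ?w x)"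
          using finT by (intro sum.union_disjoint) auto
        then show ?thesis unfolding eq .
      qed
      also have "\<dots> \<le> (\<Sum>x\<in>{x \<in> ?T. ?signed_sum x = 0}. real (d + Suc j) * 2 ^ Suc j * real L ^ Suc j)
          + (\<Sum>x\<in>{x \<in> ?T. ?signed_sum x \<noteq> 0}. C2 * real N powr \<epsilon>)"
        using w0 w1 by (intro add_mono sum_mono) blast+
      also have "\<dots> = real (card (equation_sols (2 ^ j) f S)) * (real (d + Suc j) * 2 ^ Suc j * real L ^ Suc j)
          + real (card {x \<in> ?T. ?signed_sum x \<noteq> 0}) * (C2 * real N powr \<epsilon>)" by (simp add: equation_sols_def)
      also have "\<dots> \<le> (C * real N powr \<epsilon> * real L ^ (2 ^ Suc j - Suc j)) * (real (d + Suc j) * 2 ^ Suc j * real L ^ Suc j)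
          + real L ^ (2 ^ Suc j) * (C2 * real N powr \<epsilon>)"
      proof (intro add_mono mult_right_mono Zb)
        have "card {x \<in> ?T. ?signed_sum x \<noteq> 0} \<le> card ?T" using finT by (intro card_mono) auto
        also have "\<dots> = L ^ (2 ^ Suc j)" using card_tuples[OF S(1), of "2 ^ j"] S(2) by simp
        finally show "real (card {x \<in> ?T. ?signed_sum x \<noteq> 0}) \<le> real L ^ (2 ^ Suc j)" by (simp flip: of_nat_power)
      qed (use C2 in auto)
      also have "\<dots> = (C * (real (d + Suc j) * 2 ^ Suc j) + C2) * real N powr \<epsilon> * real L ^ (2 ^ Suc j)"
      proof -
        have "real L ^ (2 ^ Suc j) = real L ^ (2 ^ Suc j - Suc j) * real L ^ Suc j"
          using j2 by (simp only: power_add[symmetric] le_add_diff_inverse2 less_imp_le)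
        then show ?thesis by (simp only: distrib_left distrib_right mult_ac)
      qed
      finally have sumw: "(\<Sum>x\<in>?T. ?w x) \<le> (C * (real (d + Suc j) * 2 ^ Suc j) + C2) * real N powr \<epsilon> * real L ^ (2 ^ Suc j)" .
      have "real (card (equation_sols (2 ^ Suc j) f S)) \<le> real (2 * L) ^ (2 ^ Suc j - Suc j - 1) * (\<Sum>x\<in>?T. ?w x)"
        by (rule hua_recursion[OF S(1) H(1) HS H(2)])
      also have "\<dots> \<le> real (2 * L) ^ (2 ^ Suc j - Suc j - 1) * ((C * (real (d + Suc j) * 2 ^ Suc j) + C2) * real N powr \<epsilon> * real L ^ (2 ^ Suc j))"
        by (intro mult_left_mono sumw) auto
      also have "\<dots> = C3 * real N powr \<epsilon> * (real L ^ (2 ^ Suc j - Suc j - 1) * real L ^ (2 ^ Suc j))"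
        unfolding C3_def by (simp only: of_nat_mult of_nat_numeral power_mult_distrib mult_ac)
      also have "real L ^ (2 ^ Suc j - Suc j - 1) * real L ^ (2 ^ Suc j) = real L ^ (2 ^ Suc (Suc j) - Suc (Suc j))"
      proof -
        have "2 ^ Suc j - Suc j - 1 + 2 ^ Suc j = 2 ^ Suc (Suc j) - Suc (Suc j)" using j2 by simp
        then show ?thesis by (simp only: power_add[symmetric])
      qed
      finally show ?thesis using L by (simp add: S_def powr_realpow del: of_nat_diff)
    qed
    moreover have "C3 \<ge> 0" using C C2 by (simp add: C3_def)
    ultimately show "\<exists>C\<ge>0. \<forall>N::nat. N \<ge> 1 \<longrightarrow> (\<forall>c L. L \<ge> 1 \<longrightarrow> c + L \<le> N \<longrightarrow>
     real (card (equation_sols (2 ^ Suc j) f {int c + 1..int c + int L})) \<le> C * real N powr \<epsilon> * real L powr (real (2 ^ Suc (Suc j) - Suc (Suc j))))"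
      by blast
  qed
qed

section \<open>Maximal sums and coverings\<close>

text \<open>Convexity with weights \<open>1\<close> and \<eta>, where
  \<open>(1 + \<eta>)^n = \<kappa>\<close>. The coefficient of the first term can be as close to one
  as desired, which keeps the repeated halving of intervals affordable.\<close>

lemma two_term_power:
  fixes \<kappa> :: real
  assumes \<kappa>: "\<kappa> > 1" and s: "s \<ge> 1"
  shows "\<exists>C\<ge>0. \<forall>a b. a \<ge> 0 \<longrightarrow> b \<ge> 0 \<longrightarrow> (a + b) ^ (2 * s) \<le> \<kappa> * a ^ (2 * s) + C * b ^ (2 * s)"
proof -
  obtain n where n: "2 * s = Suc n" "n \<ge> 1" using s by (cases "2 * s") auto
  define \<eta> where "\<eta> = root n \<kappa> - 1"
  have \<eta>: "\<eta> > 0" using \<kappa> n by (simp add: \<eta>_def)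
  have \<eta>n: "(1 + \<eta>) ^ n = \<kappa>" using \<kappa> n by (simp add: \<eta>_def)
  define C where "C = \<kappa> / \<eta> ^ n"
  have "(a + b) ^ Suc n \<le> \<kappa> * a ^ Suc n + C * b ^ Suc n" if "a \<ge> 0" "b \<ge> 0" for a b
  proof -
    have "(\<Sum>i\<in>{True, False}. if i then a else b) ^ Suc n \<le> (\<Sum>i\<in>{True, False}. if i then 1 else \<eta>) ^ n *
        (\<Sum>i\<in>{True, False}. (if i then a else b) ^ Suc n / (if i then 1 else \<eta>) ^ n)"
      using that \<eta> by (intro power_sum_le_weighted) auto
    then have "(a + b) ^ Suc n \<le> \<kappa> * (a ^ Suc n + b ^ Suc n / \<eta> ^ n)"
      by (simp add: \<eta>n del: power_Suc)
    then show ?thesis by (simp add: C_def distrib_left del: power_Suc)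
  qed
  moreover have "C \<ge> 0" using \<kappa> \<eta> by (simp add: C_def)
  ultimately show ?thesis unfolding n by blast
qed

definition wsum :: "int \<Rightarrow> int poly \<Rightarrow> int \<Rightarrow> nat \<Rightarrow> nat \<Rightarrow> real" where
  "wsum Q f t c L = norm (\<Sum>n\<in>{int c + 1..int c + int L}. add_char Q (t * poly f n))"

definition wmax :: "int \<Rightarrow> int poly \<Rightarrow> int \<Rightarrow> nat \<Rightarrow> nat \<Rightarrow> real" where
  "wmax Q f t c j = Max (wsum Q f t c ` {..2 ^ j})"

lemma wsum_nonneg [simp]: "wsum Q f t c L \<ge> 0" by (simp add: wsum_def)

lemma wsum_le_wmax: "L \<le> 2 ^ j \<Longrightarrow> wsum Q f t c L \<le> wmax Q f t c j"
  unfolding wmax_def by (intro Max_ge) auto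

lemma wmax_nonneg [simp]: "wmax Q f t c j \<ge> 0"
  using wsum_le_wmax[of 0 j Q f t c] wsum_nonneg[of Q f t c 0] by linarith

lemma wsum_add: "wsum Q f t c (L + M) \<le> wsum Q f t c L + wsum Q f t (c + L) M"
proof -
  have eq: "{int c + 1..int c + int (L + M)} = {int c + 1..int c + int L} \<union> {int (c + L) + 1..int (c + L) + int M}"
    by auto
  show ?thesis
    unfolding wsum_def eq by (subst sum.union_disjoint) (auto intro: norm_triangle_ineq)
qed

text \<open>Halving the interval: the loss per step is a factor slightly larger than \<open>2\<close> in the
  \<open>2s\<close>-th moment, while the mean values grow by at least this factor as \<open>\<rho> \<ge> 1\<close>.\<close>

lemma wmax_Suc: "wmax Q f t c (Suc j) \<le> max (wmax Q f t c j) (wmax Q f t (c + 2 ^ j) j) + wsum Q f t c (2 ^ j)"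
proof -
  have "wsum Q f t c M \<le> max (wmax Q f t c j) (wmax Q f t (c + 2 ^ j) j) + wsum Q f t c (2 ^ j)"
    if M: "M \<le> 2 ^ Suc j" for M
  proof (cases "M \<le> 2 ^ j")
    case True
    then have "wsum Q f t c M \<le> wmax Q f t c j" by (rule wsum_le_wmax)
    then show ?thesis using wsum_nonneg[of Q f t c "2 ^ j"] by linarith
  next
    case False
    then have "wsum Q f t c M \<le> wsum Q f t c (2 ^ j) + wsum Q f t (c + 2 ^ j) (M - 2 ^ j)"
      using wsum_add[of Q f t c "2 ^ j" "M - 2 ^ j"] by simp
    moreover have "wsum Q f t (c + 2 ^ j) (M - 2 ^ j) \<le> wmax Q f t (c + 2 ^ j) j"
      using M by (intro wsum_le_wmax) simp
    ultimately show ?thesis by linarith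
  qed
  then show ?thesis unfolding wmax_def[of Q f t c "Suc j"] by (intro Max.boundedI) auto
qed

lemma maximal_mean_value:
  fixes \<rho> \<epsilon> :: real
  assumes mv: "mean_value_bound s \<rho> f" and s: "s \<ge> 1" and \<rho>: "\<rho> \<ge> 1" and \<epsilon>: "\<epsilon> > 0"
  shows "\<exists>K\<ge>0. \<forall>N::nat. N \<ge> 1 \<longrightarrow> (\<exists>Q0. \<forall>Q>Q0. \<forall>j c. c + 2 ^ j \<le> N \<longrightarrow>
     (\<Sum>t\<in>{0..<Q}. wmax Q f t c j ^ (2 * s)) \<le> of_int Q * (K * real N powr \<epsilon> * (2 ^ j) powr (\<rho> + \<epsilon>)))"
proof -
  obtain C where "C \<ge> 0 \<and> (\<forall>N::nat. N \<ge> 1 \<longrightarrow> (\<forall>c L. L \<ge> 1 \<longrightarrow> c + L \<le> N \<longrightarrow>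
     real (card (equation_sols s f {int c + 1..int c + int L})) \<le> C * real N powr \<epsilon> * real L powr \<rho>))"
    using mv[unfolded mean_value_bound_def, THEN spec, THEN mp, OF \<epsilon>] by (rule exE)
  then have C: "C \<ge> 0" and Cb: "\<And>N c L. N \<ge> 1 \<Longrightarrow> L \<ge> 1 \<Longrightarrow> c + L \<le> N \<Longrightarrow>
     real (card (equation_sols s f {int c + 1..int c + int L})) \<le> C * real N powr \<epsilon> * real L powr \<rho>" by auto
  define \<kappa> :: real where "\<kappa> = 2 powr (\<epsilon> / 2)"
  have \<kappa>: "\<kappa> > 1" "\<kappa> < 2 powr \<epsilon>" using \<epsilon> by (auto simp: \<kappa>_def)
  obtain C' where C': "C' \<ge> 0" "\<And>a b. a \<ge> 0 \<Longrightarrow> b \<ge> 0 \<Longrightarrow> (a + b) ^ (2 * s) \<le> \<kappa> * a ^ (2 * s) + C' * b ^ (2 * s)"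
    using two_term_power[OF \<kappa>(1) s] by blast
  \<comment> \<open>\<open>K\<close> satisfies
    \<open>2 * \<kappa> * K + C' * C \<le> 2 * 2 powr \<epsilon> * K\<close>, the inequality that
    closes the induction. It exists since \<kappa> is smaller than \<open>2 powr \<epsilon>\<close>,
    the room left by the exponent \<open>\<rho> + \<epsilon>\<close>.\<close>
  define K where "K = max 1 (C' * C / (2 * (2 powr \<epsilon> - \<kappa>)))"
  have K: "K \<ge> 1" "2 * \<kappa> * K + C' * C \<le> 2 * 2 powr \<epsilon> * K"
  proof -
    have "C' * C / (2 * (2 powr \<epsilon> - \<kappa>)) \<le> K" by (simp add: K_def)
    then have "C' * C \<le> K * (2 * (2 powr \<epsilon> - \<kappa>))" using \<kappa> by (simp add: pos_divide_le_eq)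
    then show "2 * \<kappa> * K + C' * C \<le> 2 * 2 powr \<epsilon> * K" by (simp add: algebra_simps)
  qed (simp add: K_def)
  have "\<exists>Q0. \<forall>Q>Q0. \<forall>j c. c + 2 ^ j \<le> N \<longrightarrow>
     (\<Sum>t\<in>{0..<Q}. wmax Q f t c j ^ (2 * s)) \<le> of_int Q * (K * real N powr \<epsilon> * (2 ^ j) powr (\<rho> + \<epsilon>))"
    if N: "N \<ge> 1" for N :: nat
  proof -
    have N\<epsilon>: "real N powr \<epsilon> \<ge> 1" using N \<epsilon> by (intro ge_one_powr_ge_zero) auto
    obtain Q1 where Q1: "\<forall>Q>Q1. \<forall>T\<subseteq>{1..int N}. {x \<in> tuples s T. Q dvd signed_sum s x (poly f)} = equation_sols s f T"
      using equation_sols_exact[of "{1..int N}" s f] by blast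
    have mom: "(\<Sum>t\<in>{0..<Q}. wsum Q f t c (2 ^ j) ^ (2 * s)) \<le> of_int Q * (C * real N powr \<epsilon> * (2 ^ j) powr \<rho>)"
      if Q: "Q > max 0 Q1" and c: "c + 2 ^ j \<le> N" for Q c j
    proof -
      let ?T = "{int c + 1..int c + int (2 ^ j)}"
      have "int c + int (2 ^ j) \<le> int N" using c by linarith
      then have "?T \<subseteq> {1..int N}" by auto
      then have "{x \<in> tuples s ?T. Q dvd signed_sum s x (poly f)} = equation_sols s f ?T" using Q1 Q by simp
      then have "(\<Sum>t\<in>{0..<Q}. wsum Q f t c (2 ^ j) ^ (2 * s)) = of_int Q * real (card (equation_sols s f ?T))"
        unfolding wsum_def using sum_norm_power_eq_card[of Q ?T f s] Q by simp
      also have "\<dots> \<le> of_int Q * (C * real N powr \<epsilon> * real (2 ^ j) powr \<rho>)"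
        using Q c N by (intro mult_left_mono Cb) auto
      finally show ?thesis by simp
    qed
    have "\<forall>c. c + 2 ^ j \<le> N \<longrightarrow>
       (\<Sum>t\<in>{0..<Q}. wmax Q f t c j ^ (2 * s)) \<le> of_int Q * (K * real N powr \<epsilon> * (2 ^ j) powr (\<rho> + \<epsilon>))"
      if Q: "Q > max 0 Q1" for Q j
    proof (induction j)
      case 0
      have le1: "wmax Q f t c 0 \<le> 1" for t c
      proof -
        have "wsum Q f t c M \<le> 1" if "M \<le> 1" for M
          using that by (cases M) (auto simp: wsum_def)
        then show ?thesis unfolding wmax_def by (intro Max.boundedI) auto
      qed
      show ?case
      proof (intro allI impI)
        fix c
        have "(\<Sum>t\<in>{0..<Q}. wmax Q f t c 0 ^ (2 * s)) \<le> (\<Sum>t\<in>{0..<Q}. 1)"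
          using le1 by (intro sum_mono power_le_one) auto
        also have "\<dots> = of_int Q * 1" using Q by simp
        also have "\<dots> \<le> of_int Q * (K * real N powr \<epsilon>)"
          using Q K N\<epsilon> by (intro mult_left_mono mult_ge1_I) auto
        finally show "(\<Sum>t\<in>{0..<Q}. wmax Q f t c 0 ^ (2 * s)) \<le> of_int Q * (K * real N powr \<epsilon> * (2 ^ 0) powr (\<rho> + \<epsilon>))"
          by simp
      qed
    next
      case (Suc j)
      show ?case
      proof (intro allI impI)
        fix c assume c: "c + 2 ^ Suc j \<le> N"
        define X where "X = of_int Q * (real N powr \<epsilon> * (2 ^ j) powr (\<rho> + \<epsilon>))"
        have X: "X \<ge> 0" using Q by (simp add: X_def)
        have IH1: "(\<Sum>t\<in>{0..<Q}. wmax Q f t c j ^ (2 * s)) \<le> K * X"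
          using Suc.IH c by (simp add: X_def mult_ac)
        have IH2: "(\<Sum>t\<in>{0..<Q}. wmax Q f t (c + 2 ^ j) j ^ (2 * s)) \<le> K * X"
          using Suc.IH[rule_format, of "c + 2 ^ j"] c by (simp add: X_def mult_ac)
        have M1: "(\<Sum>t\<in>{0..<Q}. wsum Q f t c (2 ^ j) ^ (2 * s)) \<le> C * X"
        proof -
          have "(2 ^ j :: real) powr \<rho> \<le> (2 ^ j) powr (\<rho> + \<epsilon>)" using \<epsilon> by (intro powr_mono) auto
          then have "of_int Q * (C * real N powr \<epsilon> * (2 ^ j) powr \<rho>) \<le> of_int Q * (C * real N powr \<epsilon> * (2 ^ j) powr (\<rho> + \<epsilon>))"
            using Q C by (intro mult_left_mono) auto
          then show ?thesis using mom[OF Q, of c j] c by (simp add: X_def mult_ac)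
        qed
        have "(\<Sum>t\<in>{0..<Q}. wmax Q f t c (Suc j) ^ (2 * s))
          \<le> (\<Sum>t\<in>{0..<Q}. \<kappa> * (wmax Q f t c j ^ (2 * s) + wmax Q f t (c + 2 ^ j) j ^ (2 * s)) + C' * wsum Q f t c (2 ^ j) ^ (2 * s))"
        proof (intro sum_mono)
          fix t
          let ?m = "max (wmax Q f t c j) (wmax Q f t (c + 2 ^ j) j)"
          have m0: "?m \<ge> 0" using wmax_nonneg[of Q f t c j] by linarith
          have "wmax Q f t c (Suc j) ^ (2 * s) \<le> (?m + wsum Q f t c (2 ^ j)) ^ (2 * s)"
            by (intro power_mono wmax_Suc wmax_nonneg)
          also have "\<dots> \<le> \<kappa> * ?m ^ (2 * s) + C' * wsum Q f t c (2 ^ j) ^ (2 * s)"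
            using m0 by (intro C'(2)) auto
          also have "?m ^ (2 * s) \<le> wmax Q f t c j ^ (2 * s) + wmax Q f t (c + 2 ^ j) j ^ (2 * s)"
            by (auto simp: max_def)
          finally show "wmax Q f t c (Suc j) ^ (2 * s) \<le>
             \<kappa> * (wmax Q f t c j ^ (2 * s) + wmax Q f t (c + 2 ^ j) j ^ (2 * s)) + C' * wsum Q f t c (2 ^ j) ^ (2 * s)"
            using \<kappa> by simp
        qed
        also have "\<dots> = \<kappa> * ((\<Sum>t\<in>{0..<Q}. wmax Q f t c j ^ (2 * s)) + (\<Sum>t\<in>{0..<Q}. wmax Q f t (c + 2 ^ j) j ^ (2 * s)))
            + C' * (\<Sum>t\<in>{0..<Q}. wsum Q f t c (2 ^ j) ^ (2 * s))"
          by (simp only: sum.distrib sum_distrib_left distrib_left)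
        also have "\<dots> \<le> \<kappa> * (K * X + K * X) + C' * (C * X)"
          using IH1 IH2 M1 \<kappa> C' by (intro add_mono mult_left_mono) auto
        also have "\<dots> = (2 * \<kappa> * K + C' * C) * X" by (simp add: algebra_simps)
        also have "\<dots> \<le> (2 * 2 powr \<epsilon> * K) * X" using K X by (intro mult_right_mono)
        also have "\<dots> = (2 powr 1 * 2 powr \<epsilon>) * (K * X)" by simp
        also have "\<dots> \<le> 2 powr (\<rho> + \<epsilon>) * (K * X)"
        proof (intro mult_right_mono)
          show "2 powr 1 * 2 powr \<epsilon> \<le> (2::real) powr (\<rho> + \<epsilon>)"
            unfolding powr_add[symmetric] using \<rho> by (intro powr_mono) auto
        qed (use K X in auto)
        also have "\<dots> = of_int Q * (K * real N powr \<epsilon> * (2 ^ Suc j) powr (\<rho> + \<epsilon>))"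
          by (simp add: X_def powr_mult mult_ac)
        finally show "(\<Sum>t\<in>{0..<Q}. wmax Q f t c (Suc j) ^ (2 * s)) \<le> of_int Q * (K * real N powr \<epsilon> * (2 ^ Suc j) powr (\<rho> + \<epsilon>))" .
      qed
    qed
    then show ?thesis by blast
  qed
  then show ?thesis using K(1) by (intro exI[of _ K]) auto
qed

section \<open>From rational grid points to intervals\<close>

lemma norm_e_diff: "norm (e a - e b) \<le> 2 * pi * \<bar>a - b\<bar>"
proof -
  have "e a - e b = e b * (e (a - b) - 1)"
    by (simp add: algebra_simps flip: e_add)
  then have "norm (e a - e b) = norm (e (a - b) - 1)" by (simp add: norm_mult)
  also have "e (a - b) = exp (\<i> * of_real (2 * pi * (a - b)))"
    by (simp add: e_def algebra_simps)
  also have "norm (\<dots> - 1) = 2 * \<bar>sin (2 * pi * (a - b) / 2)\<bar>" by (rule dist_exp_i_1)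
  also have "\<dots> \<le> 2 * \<bar>2 * pi * (a - b) / 2\<bar>" by (intro mult_left_mono abs_sin_x_le_abs_x) auto
  finally show ?thesis by (simp add: abs_mult)
qed

abbreviation pseq :: "int poly \<Rightarrow> nat \<Rightarrow> real" where
  "pseq f \<equiv> \<lambda>n. real_of_int (poly f (int n))"

lemma V_grid: "norm (V (pseq f) (of_int t / of_int Q) M) = wsum Q f t 0 M"
proof -
  have "V (pseq f) (of_int t / of_int Q) M = (\<Sum>n\<in>{1..M}. add_char Q (t * poly f (int n)))"
    by (simp add: V_def add_char_def)
  also have "\<dots> = (\<Sum>n\<in>int ` {1..M}. add_char Q (t * poly f n))" by (subst sum.reindex) auto
  also have "int ` {1..M} = {int 0 + 1..int 0 + int M}" by (simp add: image_int_atLeastAtMost)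
  finally show ?thesis by (simp add: wsum_def)
qed

lemma V_lipschitz:
  assumes A: "\<And>n. 1 \<le> n \<Longrightarrow> n \<le> M \<Longrightarrow> \<bar>F n\<bar> \<le> A"
  shows "norm (V F x M - V F y M) \<le> 2 * pi * \<bar>x - y\<bar> * (real M * A)"
proof -
  have "norm (V F x M - V F y M) \<le> (\<Sum>n = 1..M. norm (e (x * F n) - e (y * F n)))"
    unfolding V_def sum_subtractf[symmetric] by (rule norm_sum)
  also have "\<dots> \<le> (\<Sum>n = 1..M. 2 * pi * (\<bar>x - y\<bar> * A))"
  proof (intro sum_mono)
    fix n assume n: "n \<in> {1..M}"
    have "norm (e (x * F n) - e (y * F n)) \<le> 2 * pi * \<bar>x * F n - y * F n\<bar>" by (rule norm_e_diff)
    also have "\<bar>x * F n - y * F n\<bar> = \<bar>x - y\<bar> * \<bar>F n\<bar>" by (simp add: abs_mult flip: left_diff_distrib)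
    also have "2 * pi * (\<bar>x - y\<bar> * \<bar>F n\<bar>) \<le> 2 * pi * (\<bar>x - y\<bar> * A)"
      using A n by (intro mult_left_mono) auto
    finally show "norm (e (x * F n) - e (y * F n)) \<le> 2 * pi * (\<bar>x - y\<bar> * A)" .
  qed
  finally show ?thesis by (simp add: mult_ac)
qed

text \<open>The block \<open>2^(j-1) < M \<le> 2^j\<close>, written so that \<open>j = 0\<close> is
  covered as well.\<close>

definition large_at :: "(nat \<Rightarrow> real) \<Rightarrow> real \<Rightarrow> nat \<Rightarrow> real set" where
  "large_at F \<alpha> j = {x \<in> {0..1}. \<exists>M. 2 ^ j < 2 * M \<and> M \<le> 2 ^ j \<and> norm (V F x M) \<ge> real M powr \<alpha>}"

lemma large_sums_subset:
  assumes "x \<in> large_sums F \<alpha>"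
  shows "\<exists>j\<ge>j0. x \<in> large_at F \<alpha> j"
proof -
  have x: "x \<in> {0..1}" and inf: "infinite {N :: nat. norm (V F x N) \<ge> real N powr \<alpha>}"
    using assms by (auto simp: large_sums_def)
  from inf obtain M where M: "M > 2 ^ j0" "norm (V F x M) \<ge> real M powr \<alpha>"
    unfolding infinite_nat_iff_unbounded by blast
  then have "M \<ge> 1" by (metis less_one not_le not_less_zero)
  then obtain j where j: "M \<le> 2 ^ j" "2 ^ j \<le> 2 * M" using ex_power_between[of 2 M] by auto
  show ?thesis
  proof (cases "2 ^ j < 2 * M")
    case True
    have "2 ^ j0 < (2::nat) ^ j" using M j by linarith
    then have "j0 < j" by simp
    then show ?thesis using True j M x by (intro exI[of _ j]) (auto simp: large_at_def)
  next
    case False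
    \<comment> \<open>Equality means that \<open>M\<close> is itself a power of two, which closes
      the previous block instead of opening this one.\<close>
    then have e: "2 ^ j = 2 * M" using j by simp
    then obtain j' where j': "j = Suc j'" by (cases j) auto
    then have "M = 2 ^ j'" using e by simp
    then have "j0 < j'" using M by simp
    moreover have "x \<in> large_at F \<alpha> j'"
      unfolding large_at_def using \<open>M = 2 ^ j'\<close> M(2) x by (auto intro!: exI[of _ M])
    ultimately show ?thesis by (intro exI[of _ j']) simp
  qed
qed

text \<open>A large sum at one point of a mesh interval of length \<open>1/m\<close> forces the
  maximal sum to be large at all grid points \<open>t/Q\<close> of this interval. Chebyshev's
  inequality for the \<open>2s\<close>-th moment over \<open>Z/Q\<close> therefore bounds the number
  of intervals that meet the set.\<close>

lemma cover_large_at: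
  fixes f :: "int poly" and \<alpha> \<rho> \<epsilon> :: real
  assumes mv: "mean_value_bound s \<rho> f" and s: "s \<ge> 1" and \<rho>: "\<rho> \<ge> 1" and \<epsilon>: "\<epsilon> > 0" and \<alpha>: "0 < \<alpha>" "\<alpha> < 1"
  defines "D \<equiv> real (degree f) + 1 - \<alpha>"
  shows "\<exists>C\<ge>0. \<forall>j. \<exists>m\<ge>1. \<exists>b. finite b \<and> large_at (pseq f) \<alpha> j \<subseteq> (\<Union>i\<in>b. {real i / real m..(real i + 1) / real m}) \<and>
     1 / real m \<le> (2 ^ j) powr (- D) \<and> real (card b) \<le> C * (2 ^ j) powr (D + \<rho> - 2 * real s * \<alpha> + \<epsilon>)"
proof -
  obtain K where K: "K \<ge> 0" and Kb: "\<forall>N::nat. N \<ge> 1 \<longrightarrow> (\<exists>Q0. \<forall>Q>Q0. \<forall>j c. c + 2 ^ j \<le> N \<longrightarrow>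
     (\<Sum>t\<in>{0..<Q}. wmax Q f t c j ^ (2 * s)) \<le> of_int Q * (K * real N powr (\<epsilon> / 2) * (2 ^ j) powr (\<rho> + \<epsilon> / 2)))"
    using maximal_mean_value[OF mv s \<rho>, of "\<epsilon> / 2"] \<epsilon> by auto
  obtain A0 where A0: "A0 \<ge> 1" "\<And>N n. N \<ge> 1 \<Longrightarrow> 0 \<le> n \<Longrightarrow> n \<le> int N \<Longrightarrow> \<bar>poly f n\<bar> \<le> A0 * int N ^ degree f"
    using poly_abs_bound[of f] by blast
  define A where "A = real_of_int A0"
  have A: "A \<ge> 1" using A0 by (simp add: A_def)
  have pA: "8 * pi * A \<ge> 1"
  proof -
    have "1 * 1 \<le> (8 * pi) * A" using A pi_gt3 by (intro mult_mono) auto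
    then show ?thesis by simp
  qed
  define C where "C = (8 * pi * A + 1) * K * 4 ^ (2 * s)"
  have C: "C \<ge> 0" using A K by (simp add: C_def)
  have "\<exists>m\<ge>1. \<exists>b. finite b \<and> large_at (pseq f) \<alpha> j \<subseteq> (\<Union>i\<in>b. {real i / real m..(real i + 1) / real m}) \<and>
     1 / real m \<le> (2 ^ j) powr (- D) \<and> real (card b) \<le> C * (2 ^ j) powr (D + \<rho> - 2 * real s * \<alpha> + \<epsilon>)" for j
  proof -
    define N where "N = (2::nat) ^ j"
    define n where "n = real N"
    have n: "n \<ge> 1" "n = 2 ^ j" by (auto simp: n_def N_def)
    have D0: "D > 0" using \<alpha> by (simp add: D_def)
    have nD: "n powr D \<ge> 1" using n D0 by (intro ge_one_powr_ge_zero) auto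
    \<comment> \<open>In the block, \<open>M\<close> exceeds \<open>n/2\<close>, so the sum at
      \<open>x\<close> is at least half of \<open>n powr \<alpha>\<close>. Moving by
      \<open>1/m\<close> changes it by at most \<open>(2 * pi / m) * n * A * n^d\<close>; the factor
      \<open>8 * pi * A\<close> makes this at most a quarter of \<open>n powr \<alpha>\<close>, and
      \<open>D\<close> is the exponent for which this works.\<close>
    define m where "m = nat \<lceil>8 * pi * A * n powr D\<rceil>"
    have m_ge: "real m \<ge> 8 * pi * A * n powr D" unfolding m_def by linarith
    have z1: "8 * pi * A * n powr D \<ge> 1" using mult_ge1_I[OF pA nD] .
    then have m1: "real m \<ge> 1" using m_ge by linarith
    then have m: "m \<ge> 1" by simp
    have m_le: "real m \<le> (8 * pi * A + 1) * n powr D"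
    proof -
      have "real m \<le> 8 * pi * A * n powr D + 1" unfolding m_def using z1 by linarith
      also have "\<dots> \<le> (8 * pi * A + 1) * n powr D" using nD by (simp add: algebra_simps)
      finally show ?thesis .
    qed
    define I where "I = (\<lambda>i. {real i / real m..(real i + 1) / real m})"
    define b where "b = {i. i < m \<and> I i \<inter> large_at (pseq f) \<alpha> j \<noteq> {}}"
    have finb: "finite b" unfolding b_def by simp
    have cover: "large_at (pseq f) \<alpha> j \<subseteq> (\<Union>i\<in>b. I i)"
    proof
      fix x assume x: "x \<in> large_at (pseq f) \<alpha> j"
      then have x01: "0 \<le> x" "x \<le> 1" by (auto simp: large_at_def)
      have "\<exists>i<m. x \<in> I i"
      proof (cases "x = 1")
        case True
        then show ?thesis using m1 m by (intro exI[of _ "m - 1"]) (auto simp: I_def field_simps of_nat_diff)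
      next
        case False
        define i where "i = nat \<lfloor>x * real m\<rfloor>"
        have i: "real i \<le> x * real m" "x * real m < real i + 1" using x01 m1 unfolding i_def by (auto simp: of_nat_nat)
        have "x * real m < real m" using False x01 m1 by simp
        then have "i < m" using i by linarith
        moreover have "x \<in> I i" using i m1 by (auto simp: I_def field_simps)
        ultimately show ?thesis by blast
      qed
      then show "x \<in> (\<Union>i\<in>b. I i)" using x by (auto simp: b_def)
    qed
    obtain Q0 where Q0: "\<forall>Q>Q0. \<forall>j c. c + 2 ^ j \<le> N \<longrightarrow>
     (\<Sum>t\<in>{0..<Q}. wmax Q f t c j ^ (2 * s)) \<le> of_int Q * (K * real N powr (\<epsilon> / 2) * (2 ^ j) powr (\<rho> + \<epsilon> / 2))"
      using Kb[rule_format, of N] by (auto simp: N_def)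
    \<comment> \<open>Cutting each mesh interval into \<open>k\<close> parts lifts the modulus
      \<open>Q = m * k\<close> above the threshold while the grid stays aligned with the
      mesh.\<close>
    define k where "k = nat (max Q0 0) + 1"
    have k: "k \<ge> 1" "int k > Q0" by (auto simp: k_def)
    define Q where "Q = int (m * k)"
    have kQ: "int k \<le> Q" unfolding Q_def using m by (metis mult_le_mono1 nat_mult_1 of_nat_le_iff)
    have Q: "Q > Q0" "Q > 0" using k kQ by linarith+
    have point: "wmax Q f (int t) 0 j \<ge> n powr \<alpha> / 4" if i: "i \<in> b" and t: "t \<in> {i * k..<i * k + k}" for i t
    proof -
      from i obtain x where x: "x \<in> I i" "x \<in> large_at (pseq f) \<alpha> j" by (auto simp: b_def)
      then obtain M where M: "2 ^ j < 2 * M" "M \<le> 2 ^ j" "norm (V (pseq f) x M) \<ge> real M powr \<alpha>"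
        by (auto simp: large_at_def)
      define y where "y = real_of_int (int t) / real_of_int Q"
      have y: "y = real t / (real m * real k)" by (simp add: y_def Q_def)
      have mk: "real m * real k > 0" using m1 k by simp
      have "real (i * k) \<le> real t" "real t \<le> real (i * k + k)" using t by (auto simp flip: of_nat_mult of_nat_add)
      then have "real i * real k \<le> real t" "real t \<le> (real i + 1) * real k" by (auto simp: algebra_simps)
      then have "real i / real m \<le> y" "y \<le> (real i + 1) / real m"
        unfolding y using m1 k by (auto simp: field_simps)
      then have xy: "\<bar>x - y\<bar> \<le> 1 / real m" using x(1) by (auto simp: I_def add_divide_distrib)
      have "norm (V (pseq f) x M - V (pseq f) y M) \<le> 2 * pi * \<bar>x - y\<bar> * (real M * (A * n ^ degree f))"
      proof (rule V_lipschitz)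
        fix u assume u: "1 \<le> u" "u \<le> M"
        have "\<bar>poly f (int u)\<bar> \<le> A0 * int N ^ degree f" using M u by (intro A0(2)) (auto simp: N_def)
        then have "real_of_int \<bar>poly f (int u)\<bar> \<le> real_of_int (A0 * int N ^ degree f)" by (simp only: of_int_le_iff)
        then show "\<bar>real_of_int (poly f (int u))\<bar> \<le> A * n ^ degree f" by (simp add: A_def n_def)
      qed
      also have "\<dots> \<le> 2 * pi * (1 / real m) * (n * (A * n ^ degree f))"
      proof (intro mult_mono)
        show "real M \<le> n" using M(2) unfolding n(2) by (metis numeral_power_le_of_nat_cancel_iff of_nat_le_iff of_nat_numeral of_nat_power)
      qed (use xy A n m1 in auto)
      also have "\<dots> \<le> 2 * pi * (1 / (8 * pi * A * n powr D)) * (n * (A * n ^ degree f))"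
        using m_ge A n nD m1 by (intro mult_right_mono mult_left_mono divide_left_mono) auto
      also have "\<dots> = (n powr (real (degree f) + 1) / n powr D) / 4"
        using A n by (simp add: powr_add powr_realpow field_simps)
      also have "n powr (real (degree f) + 1) / n powr D = n powr \<alpha>"
        using n by (simp add: D_def flip: powr_diff)
      finally have close: "norm (V (pseq f) x M - V (pseq f) y M) \<le> n powr \<alpha> / 4" .
      have "n powr \<alpha> / 2 \<le> real M powr \<alpha>"
      proof -
        have "real (2 ^ j) < real (2 * M)" using M(1) by (simp only: of_nat_less_iff)
        then have "n / 2 \<le> real M" unfolding n(2) by simp
        then have "(n / 2) powr \<alpha> \<le> real M powr \<alpha>" using n \<alpha> by (intro powr_mono2) auto
        moreover have "(n / 2) powr \<alpha> = n powr \<alpha> / 2 powr \<alpha>" by (rule powr_divide)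
        moreover have "2 powr \<alpha> \<le> 2 powr (1::real)" using \<alpha> by (intro powr_mono) auto
        then have "n powr \<alpha> / 2 \<le> n powr \<alpha> / 2 powr \<alpha>" by (intro divide_left_mono) auto
        ultimately show ?thesis by linarith
      qed
      then have "n powr \<alpha> / 2 \<le> norm (V (pseq f) x M)" using M(3) by linarith
      also have "\<dots> \<le> norm (V (pseq f) y M) + norm (V (pseq f) x M - V (pseq f) y M)"
        using norm_triangle_sub[of "V (pseq f) x M" "V (pseq f) y M"] by simp
      finally have "n powr \<alpha> / 4 \<le> norm (V (pseq f) y M)" using close by linarith
      also have "\<dots> = wsum Q f (int t) 0 M" unfolding y_def by (rule V_grid)
      also have "\<dots> \<le> wmax Q f (int t) 0 j" by (rule wsum_le_wmax[OF M(2)])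
      finally show ?thesis .
    qed
    define P where "P = (n powr \<alpha> / 4) ^ (2 * s)"
    have P0: "P > 0" using n by (simp add: P_def)
    have "real (card b) * (real k * P) = (\<Sum>i\<in>b. \<Sum>t\<in>{i * k..<i * k + k}. P)" by simp
    also have "\<dots> \<le> (\<Sum>i\<in>b. \<Sum>t\<in>{i * k..<i * k + k}. wmax Q f (int t) 0 j ^ (2 * s))"
      unfolding P_def using point n by (intro sum_mono power_mono) auto
    also have "\<dots> \<le> (\<Sum>i<m. \<Sum>t\<in>{i * k..<i * k + k}. wmax Q f (int t) 0 j ^ (2 * s))"
      by (intro sum_mono2) (auto simp: b_def intro!: sum_nonneg)
    also have "\<dots> = (\<Sum>t<m * k. wmax Q f (int t) 0 j ^ (2 * s))" by (rule sum.nat_group)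
    also have "\<dots> = (\<Sum>t\<in>int ` {..<m * k}. wmax Q f t 0 j ^ (2 * s))" by (subst sum.reindex) auto
    also have "int ` {..<m * k} = {0..<Q}" by (simp add: Q_def lessThan_atLeast0 image_int_atLeastLessThan)
    also have "(\<Sum>t\<in>{0..<Q}. wmax Q f t 0 j ^ (2 * s)) \<le> of_int Q * (K * real N powr (\<epsilon> / 2) * (2 ^ j) powr (\<rho> + \<epsilon> / 2))"
      using Q0[rule_format, OF Q(1), of 0 j] by (simp add: N_def)
    also have "\<dots> = real k * (real m * (K * n powr (\<rho> + \<epsilon>)))"
    proof -
      have "n powr (\<rho> + \<epsilon>) = n powr (\<epsilon> / 2) * n powr (\<rho> + \<epsilon> / 2)" by (simp add: add.commute flip: powr_add)
      then show ?thesis by (simp add: Q_def n_def[symmetric] n(2)[symmetric])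
    qed
    finally have "real k * (real (card b) * P) \<le> real k * (real m * (K * n powr (\<rho> + \<epsilon>)))" by (simp only: mult_ac)
    then have "real (card b) * P \<le> real m * (K * n powr (\<rho> + \<epsilon>))"
      by (rule mult_left_le_imp_le) (use k in simp)
    also have "\<dots> \<le> ((8 * pi * A + 1) * n powr D) * (K * n powr (\<rho> + \<epsilon>))"
      using m_le K by (intro mult_right_mono) auto
    finally have "real (card b) \<le> ((8 * pi * A + 1) * n powr D) * (K * n powr (\<rho> + \<epsilon>)) / P"
      using P0 by (simp add: pos_le_divide_eq)
    also have "\<dots> = C * n powr (D + \<rho> - 2 * real s * \<alpha> + \<epsilon>)"
    proof -
      have "P = n powr (2 * real s * \<alpha>) / 4 ^ (2 * s)"
        unfolding P_def power_divide using n by (simp add: powr_powr mult_ac flip: powr_realpow)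
      then have "1 / P = 4 ^ (2 * s) / n powr (2 * real s * \<alpha>)" by simp
      moreover have "n powr (D + \<rho> - 2 * real s * \<alpha> + \<epsilon>) = n powr D * n powr (\<rho> + \<epsilon>) / n powr (2 * real s * \<alpha>)"
        by (simp flip: powr_add powr_diff) (simp add: algebra_simps)
      moreover have "a * x * (K * y) * (r / z) = a * K * r * (x * y / z)" for a x y r z :: real
        by simp
      moreover have "a * x * (K * y) / P = a * x * (K * y) * (1 / P)" for a x y :: real by simp
      ultimately show ?thesis unfolding C_def by presburger
    qed
    finally have card: "real (card b) \<le> C * (2 ^ j) powr (D + \<rho> - 2 * real s * \<alpha> + \<epsilon>)" unfolding n(2) .
    have "1 / real m \<le> (2 ^ j) powr (- D)"
    proof -
      have "n powr D \<le> 8 * pi * A * n powr D" using pA nD by (simp add: mult_le_cancel_right1)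
      then have "n powr D \<le> real m" using m_ge by linarith
      then have "1 / real m \<le> 1 / n powr D" using n m1 by (intro divide_left_mono mult_pos_pos) auto
      then show ?thesis by (simp add: n(2) powr_minus_divide)
    qed
    then show ?thesis using m finb cover card unfolding I_def by blast
  qed
  then show ?thesis using C by blast
qed

section \<open>Hausdorff measure and dimension\<close>

text \<open>Coverings arise with two indices, scale and position; pairing enumerates them as one
  sequence without changing the sum of nonnegative terms.\<close>

lemma hausdorff_measure_eq_0I:
  fixes A :: "'a::metric_space set"
  assumes cover: "\<And>\<delta> \<eta>. \<delta> > 0 \<Longrightarrow> \<eta> > 0 \<Longrightarrow> \<exists>U :: nat \<times> nat \<Rightarrow> 'a set. A \<subseteq> (\<Union>z. U z) \<and> (\<forall>z. bounded (U z) \<and> diameter (U z) \<le> \<delta>) \<and>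
      (\<Sum>j. \<Sum>i. ennreal (diameter (U (j, i)) powr s)) \<le> ennreal \<eta>"
  shows "hausdorff_measure s A = 0"
proof -
  have "hausdorff_delta s \<delta> A \<le> 0" if \<delta>: "\<delta> > 0" for \<delta>
  proof (rule ennreal_le_epsilon)
    fix \<eta> :: real assume \<eta>: "\<eta> > 0"
    obtain U :: "nat \<times> nat \<Rightarrow> 'a set" where U: "A \<subseteq> (\<Union>z. U z)" "\<forall>z. bounded (U z) \<and> diameter (U z) \<le> \<delta>"
      "(\<Sum>j. \<Sum>i. ennreal (diameter (U (j, i)) powr s)) \<le> ennreal \<eta>"
      using cover[OF \<delta> \<eta>] by blast
    define W where "W = (\<lambda>n. U (prod_decode n))"
    have "(\<Union>n. W n) = (\<Union>z. U z)" unfolding W_def by (metis surj_prod_decode image_image)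
    then have "A \<subseteq> (\<Union>n. W n)" using U(1) by simp
    moreover have "\<forall>n. bounded (W n) \<and> diameter (W n) \<le> \<delta>" using U(2) unfolding W_def by blast
    ultimately have "W \<in> {U. A \<subseteq> (\<Union>i. U i) \<and> (\<forall>i. bounded (U i) \<and> diameter (U i) \<le> \<delta>)}"
      by blast
    then have "hausdorff_delta s \<delta> A \<le> (\<Sum>n. ennreal (diameter (W n) powr s))"
      unfolding hausdorff_delta_def by (rule INF_lower)
    also have "\<dots> = (\<Sum>j. \<Sum>i. ennreal (diameter (U (j, i)) powr s))"
      unfolding W_def by (rule suminf_ennreal_2dimen[where f = "\<lambda>z. ennreal (diameter (U z) powr s)"]) (rule refl)
    also note U(3)
    finally show "hausdorff_delta s \<delta> A \<le> 0 + ennreal \<eta>" by simp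
  qed
  then show ?thesis unfolding hausdorff_measure_def by (intro antisym SUP_least) auto
qed

text \<open>Convergence part of the Borel-Cantelli argument: level \<open>j\<close> costs at most
  \<open>C * 2^(-j\<epsilon>)\<close> once \<sigma> exceeds \<open>\<beta> / D\<close>, where
  \<epsilon> is half of the excess \<open>\<sigma> * D - \<beta>\<close>. The tails of this
  geometric series are coverings of the limsup set. The sign condition on the numerator makes the
  exponents \<open>\<beta> / D + \<tau>\<close> positive, as the definition of dimension
  demands.\<close>

lemma hausdorff_dim_large_sums:
  fixes f :: "int poly" and \<alpha> \<rho> :: real
  assumes mv: "mean_value_bound s \<rho> f" and s: "s \<ge> 1" and \<rho>: "\<rho> \<ge> 1" and \<alpha>: "0 < \<alpha>" "\<alpha> < 1"
  defines "D \<equiv> real (degree f) + 1 - \<alpha>"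
  assumes nonneg: "D + \<rho> - 2 * real s * \<alpha> \<ge> 0"
  shows "hausdorff_dim (large_sums (pseq f) \<alpha>) \<le> ereal ((D + \<rho> - 2 * real s * \<alpha>) / D)"
proof -
  define \<beta> where "\<beta> = D + \<rho> - 2 * real s * \<alpha>"
  have D: "D > 0" using \<alpha> by (simp add: D_def)
  have zero: "hausdorff_measure \<sigma> (large_sums (pseq f) \<alpha>) = 0" if \<sigma>: "\<sigma> > \<beta> / D" "\<sigma> > 0" for \<sigma>
  proof (rule hausdorff_measure_eq_0I)
    fix \<delta> \<eta> :: real assume \<delta>: "\<delta> > 0" and \<eta>: "\<eta> > 0"
    define \<epsilon> where "\<epsilon> = (\<sigma> * D - \<beta>) / 2"
    have \<epsilon>: "\<epsilon> > 0" using \<sigma> D by (simp add: \<epsilon>_def pos_divide_less_eq)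
    obtain C where C: "C \<ge> 0" and Cj: "\<forall>j. \<exists>m\<ge>1. \<exists>b. finite b \<and> large_at (pseq f) \<alpha> j \<subseteq> (\<Union>i\<in>b. {real i / real m..(real i + 1) / real m}) \<and>
     1 / real m \<le> (2 ^ j) powr (- D) \<and> real (card b) \<le> C * (2 ^ j) powr (\<beta> + \<epsilon>)"
      using cover_large_at[OF mv s \<rho> \<epsilon> \<alpha>] unfolding D_def[symmetric] \<beta>_def by blast
    from choice[OF Cj] obtain m where "\<forall>j. m j \<ge> 1 \<and> (\<exists>b. finite b \<and> large_at (pseq f) \<alpha> j \<subseteq> (\<Union>i\<in>b. {real i / real (m j)..(real i + 1) / real (m j)}) \<and>
     1 / real (m j) \<le> (2 ^ j) powr (- D) \<and> real (card b) \<le> C * (2 ^ j) powr (\<beta> + \<epsilon>))" by blast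
    then have m: "\<And>j. m j \<ge> 1" and mb: "\<forall>j. \<exists>b. finite b \<and> large_at (pseq f) \<alpha> j \<subseteq> (\<Union>i\<in>b. {real i / real (m j)..(real i + 1) / real (m j)}) \<and>
     1 / real (m j) \<le> (2 ^ j) powr (- D) \<and> real (card b) \<le> C * (2 ^ j) powr (\<beta> + \<epsilon>)" by auto
    from choice[OF mb] obtain b where b: "\<And>j. finite (b j)"
      "\<And>j. large_at (pseq f) \<alpha> j \<subseteq> (\<Union>i\<in>b j. {real i / real (m j)..(real i + 1) / real (m j)})"
      "\<And>j. 1 / real (m j) \<le> (2 ^ j) powr (- D)" "\<And>j. real (card (b j)) \<le> C * (2 ^ j) powr (\<beta> + \<epsilon>)" by blast
    define \<theta> where "\<theta> = 2 powr (- \<epsilon>)"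
    have \<theta>: "0 < \<theta>" "\<theta> < 1" using \<epsilon> by (auto simp: \<theta>_def powr_less_one)
    define \<psi> where "\<psi> = 2 powr (- D)"
    have \<psi>: "0 < \<psi>" "\<psi> < 1" using D by (auto simp: \<psi>_def powr_less_one)
    have level: "real (card (b j)) * (1 / real (m j)) powr \<sigma> \<le> C * \<theta> ^ j" for j
    proof -
      have "(1 / real (m j)) powr \<sigma> \<le> ((2 ^ j) powr (- D)) powr \<sigma>"
        using b(3)[of j] \<sigma> by (intro powr_mono2) auto
      then have "real (card (b j)) * (1 / real (m j)) powr \<sigma> \<le> (C * (2 ^ j) powr (\<beta> + \<epsilon>)) * ((2 ^ j) powr (- D)) powr \<sigma>"
        using b(4)[of j] C by (intro mult_mono) auto
      also have "\<dots> = C * (2 ^ j) powr (\<beta> + \<epsilon> - D * \<sigma>)" by (simp add: powr_powr flip: powr_add)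
      also have "\<beta> + \<epsilon> - D * \<sigma> = - \<epsilon>" by (simp add: \<epsilon>_def field_simps)
      also have "(2 ^ j) powr (- \<epsilon>) = \<theta> ^ j"
        by (simp add: \<theta>_def powr_powr mult.commute flip: powr_realpow)
      finally show ?thesis .
    qed
    obtain j0 where j0: "C * \<theta> ^ j0 / (1 - \<theta>) < \<eta>" "\<psi> ^ j0 < \<delta>"
    proof -
      have "(\<lambda>j. C * \<theta> ^ j / (1 - \<theta>)) \<longlonglongrightarrow> C * 0 / (1 - \<theta>)"
        using \<theta> by (intro tendsto_intros LIMSEQ_power_zero) auto
      then have "\<forall>\<^sub>F j in sequentially. C * \<theta> ^ j / (1 - \<theta>) < \<eta>" using \<eta> by (auto dest: order_tendstoD(2))
      moreover have "(\<lambda>j. \<psi> ^ j) \<longlonglongrightarrow> 0" using \<psi> by (intro LIMSEQ_power_zero) auto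
      then have "\<forall>\<^sub>F j in sequentially. \<psi> ^ j < \<delta>" using \<delta> by (rule order_tendstoD(2))
      ultimately have "\<forall>\<^sub>F j in sequentially. C * \<theta> ^ j / (1 - \<theta>) < \<eta> \<and> \<psi> ^ j < \<delta>" by (rule eventually_conj)
      then obtain j where "C * \<theta> ^ j / (1 - \<theta>) < \<eta> \<and> \<psi> ^ j < \<delta>" using eventually_happens trivial_limit_sequentially by blast
      then show thesis using that by blast
    qed
    \<comment> \<open>Only levels from \<open>j0\<close> on are used. Positions without a selected
      interval hold the empty set, of diameter zero, and add nothing to the sum.\<close>
    define U where "U = (\<lambda>(j, i). if i \<in> b (j0 + j) then {real i / real (m (j0 + j))..(real i + 1) / real (m (j0 + j))} else {})"
    have small: "1 / real (m (j0 + j)) \<le> \<delta>" for j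
    proof -
      have "(2 ^ (j0 + j) :: real) powr (- D) = \<psi> ^ (j0 + j)"
        by (simp add: \<psi>_def powr_powr mult.commute flip: powr_realpow)
      also have "\<dots> \<le> \<psi> ^ j0" using \<psi> by (intro power_decreasing) auto
      finally show ?thesis using b(3)[of "j0 + j"] j0(2) by linarith
    qed
    have diam: "diameter (U (j, i)) \<le> (if i \<in> b (j0 + j) then 1 / real (m (j0 + j)) else 0)" for j i
    proof (cases "i \<in> b (j0 + j)")
      case True
      have "diameter {real i / real (m (j0 + j))..(real i + 1) / real (m (j0 + j))} \<le> 1 / real (m (j0 + j))"
        by (rule diameter_le) (auto simp: add_divide_distrib)
      then show ?thesis using True by (simp add: U_def)
    qed (simp add: U_def)
    have bnd: "bounded (U z)" for z by (auto simp: U_def split: prod.splits)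
    have "large_sums (pseq f) \<alpha> \<subseteq> (\<Union>z. U z)"
    proof
      fix x assume "x \<in> large_sums (pseq f) \<alpha>"
      then obtain j where j: "j \<ge> j0" "x \<in> large_at (pseq f) \<alpha> j" using large_sums_subset by blast
      then obtain i where i: "i \<in> b j" "x \<in> {real i / real (m j)..(real i + 1) / real (m j)}" using b(2)[of j] by blast
      then have "x \<in> U (j - j0, i)" using j by (simp add: U_def)
      then show "x \<in> (\<Union>z. U z)" by blast
    qed
    moreover have "diameter (U z) \<le> \<delta>" for z
      using diam[of "fst z" "snd z"] small[of "fst z"] \<delta> by (cases z) (auto split: if_splits intro: order_trans)
    moreover have "(\<Sum>j. \<Sum>i. ennreal (diameter (U (j, i)) powr \<sigma>)) \<le> ennreal \<eta>"
    proof -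
      have inner: "(\<Sum>i. ennreal (diameter (U (j, i)) powr \<sigma>)) \<le> ennreal (C * \<theta> ^ j0 * \<theta> ^ j)" for j
      proof -
        have "(\<Sum>i. ennreal (diameter (U (j, i)) powr \<sigma>)) = (\<Sum>i\<in>b (j0 + j). ennreal (diameter (U (j, i)) powr \<sigma>))"
          using b(1) by (intro suminf_finite) (auto simp: U_def)
        also have "\<dots> \<le> (\<Sum>i\<in>b (j0 + j). ennreal ((1 / real (m (j0 + j))) powr \<sigma>))"
        proof (intro sum_mono ennreal_leI)
          fix i assume "i \<in> b (j0 + j)"
          then have "diameter (U (j, i)) \<le> 1 / real (m (j0 + j))" using diam[of j i] by simp
          then show "diameter (U (j, i)) powr \<sigma> \<le> (1 / real (m (j0 + j))) powr \<sigma>"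
            using \<sigma> diameter_ge_0[OF bnd] by (intro powr_mono2) auto
        qed
        also have "\<dots> = ennreal (\<Sum>i\<in>b (j0 + j). (1 / real (m (j0 + j))) powr \<sigma>)" by (intro sum_ennreal) auto
        also have "\<dots> = ennreal (real (card (b (j0 + j))) * (1 / real (m (j0 + j))) powr \<sigma>)" by simp
        also have "\<dots> \<le> ennreal (C * \<theta> ^ (j0 + j))" by (intro ennreal_leI level)
        finally show ?thesis by (simp add: power_add mult.assoc)
      qed
      have "(\<Sum>j. \<Sum>i. ennreal (diameter (U (j, i)) powr \<sigma>)) \<le> (\<Sum>j. ennreal (C * \<theta> ^ j0 * \<theta> ^ j))"
        using inner by (intro suminf_le) auto
      also have "\<dots> = ennreal (\<Sum>j. C * \<theta> ^ j0 * \<theta> ^ j)"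
        using C \<theta> by (intro suminf_ennreal2 summable_mult summable_geometric) auto
      also have "(\<Sum>j. C * \<theta> ^ j0 * \<theta> ^ j) = C * \<theta> ^ j0 / (1 - \<theta>)"
        using \<theta> by (simp add: suminf_mult summable_geometric suminf_geometric)
      also have "ennreal \<dots> \<le> ennreal \<eta>" using j0(1) by (intro ennreal_leI) simp
      finally show ?thesis .
    qed
    ultimately show "\<exists>U :: nat \<times> nat \<Rightarrow> real set. large_sums (pseq f) \<alpha> \<subseteq> (\<Union>z. U z) \<and> (\<forall>z. bounded (U z) \<and> diameter (U z) \<le> \<delta>) \<and>
      (\<Sum>j. \<Sum>i. ennreal (diameter (U (j, i)) powr \<sigma>)) \<le> ennreal \<eta>" using bnd by blast
  qed
  show ?thesis
    unfolding \<beta>_def[symmetric]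
  proof (rule ereal_le_epsilon2)
    fix \<tau> :: real assume \<tau>: "\<tau> > 0"
    have "\<beta> / D \<ge> 0" using nonneg D by (simp add: \<beta>_def)
    then have "hausdorff_measure (\<beta> / D + \<tau>) (large_sums (pseq f) \<alpha>) = 0" "\<beta> / D + \<tau> > 0" using \<tau> by (auto intro!: zero)
    then have "hausdorff_dim (large_sums (pseq f) \<alpha>) \<le> ereal (\<beta> / D + \<tau>)"
      unfolding hausdorff_dim_def by (intro INF_lower) simp
    then show "hausdorff_dim (large_sums (pseq f) \<alpha>) \<le> ereal (\<beta> / D) + ereal \<tau>" by simp
  qed
qed

text \<open>With \<open>\<rho> = 2s - r\<close> the numerator \<open>D + \<rho> - 2s\<alpha>\<close>
  becomes \<open>D + 2s(1 - \<alpha>) - r\<close>. The terms of \<open>U1\<close> arise for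
  \<open>2s = 2^r\<close> and those of \<open>U2\<close> for \<open>2s = r(r+1)\<close>; they are
  nonnegative because \<open>r \<le> d\<close>.\<close>

theorem theorem3p1:
  fixes f :: "int poly" and d :: nat and \<alpha> :: real
  assumes "degree f = d" and "d \<ge> 2"
    and "1 / 2 < \<alpha>" and "\<alpha> < 1"
  shows "hausdorff_dim (large_sums (\<lambda>n. real_of_int (poly f (int n))) \<alpha>)
           \<le> ereal (min (U1 d \<alpha>) (U2 d \<alpha>))"
proof -
  let ?F = "large_sums (\<lambda>n. real_of_int (poly f (int n))) \<alpha>"
  have \<alpha>: "0 < \<alpha>" "\<alpha> < 1" using assms by auto
  have pos: "0 \<le> real d + 1 - \<alpha> + x * (1 - \<alpha>) - real r" if "r \<in> {1..d}" "x \<ge> 0" for r x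
  proof -
    have "real r \<le> real d" using that by simp
    moreover have "x * (1 - \<alpha>) \<ge> 0" using that \<alpha> by simp
    ultimately show ?thesis using \<alpha> by linarith
  qed
  have hua: "hausdorff_dim ?F \<le> ereal ((real d + 1 - \<alpha> + 2 ^ r * (1 - \<alpha>) - real r) / (real d + 1 - \<alpha>))"
    if r: "r \<in> {1..d}" for r
  proof -
    obtain j where j: "r = Suc j" using r by (cases r) auto
    have r2: "r < 2 ^ r" by (rule less_exp)
    then have \<rho>: "real (2 ^ r - r) = 2 ^ r - real r" by (simp add: of_nat_diff less_imp_le)
    have s: "2 * real (2 ^ j) = 2 ^ r" by (simp add: j)
    have mv: "mean_value_bound (2 ^ j) (real (2 ^ r - r)) f"
      unfolding j using assms(1) r j by (intro hua_lemma) simp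
    have eq: "real d + 1 - \<alpha> + real (2 ^ r - r) - 2 * real (2 ^ j) * \<alpha> = real d + 1 - \<alpha> + 2 ^ r * (1 - \<alpha>) - real r"
      unfolding \<rho> s by (simp add: algebra_simps)
    have "1 \<le> 2 ^ r - r" using r2 by linarith
    then have "real 1 \<le> real (2 ^ r - r)" by (simp only: of_nat_le_iff)
    then have \<rho>1: "1 \<le> real (2 ^ r - r)" by (simp only: of_nat_1)
    show ?thesis
      by (rule hausdorff_dim_large_sums[OF mv _ \<rho>1 \<alpha>, unfolded assms(1) eq]) (use pos[OF r, of "2 ^ r"] in auto)
  qed
  have "U1 d \<alpha> \<in> (\<lambda>r. (real d + 1 - \<alpha> + 2 ^ r * (1 - \<alpha>) - real r) / (real d + 1 - \<alpha>)) ` {1..d}"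
    unfolding U1_def using assms(2) by (intro Min_in) auto
  then obtain r where "U1 d \<alpha> = (real d + 1 - \<alpha> + 2 ^ r * (1 - \<alpha>) - real r) / (real d + 1 - \<alpha>)" "r \<in> {1..d}"
    by (rule imageE)
  then have 1: "hausdorff_dim ?F \<le> ereal (U1 d \<alpha>)" using hua by simp
  have vinogradov: "hausdorff_dim ?F \<le> ereal ((real d + 1 - \<alpha> + real r * (real r + 1) * (1 - \<alpha>) - real r) / (real d + 1 - \<alpha>))"
    if r: "r \<in> {1..d}" for r
  proof -
    have s: "2 * real (tri r) = real r * (real r + 1)"
      using arg_cong[OF tri_2[of r], of real] by (simp add: algebra_simps)
    have mv: "mean_value_bound (tri r) (real (2 * tri r) - real r) f"
      using assms(1) r by (intro mean_value_vinogradov) auto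
    have eq: "real d + 1 - \<alpha> + (real (2 * tri r) - real r) - 2 * real (tri r) * \<alpha>
        = real d + 1 - \<alpha> + real r * (real r + 1) * (1 - \<alpha>) - real r"
      unfolding of_nat_mult of_nat_numeral s by (simp add: algebra_simps)
    have "real (2 * tri r) - real r = real r * real r" unfolding of_nat_mult of_nat_numeral s by (simp add: algebra_simps)
    moreover have "1 \<le> real r * real r" using r by (intro mult_ge1_I) auto
    ultimately have \<rho>1: "1 \<le> real (2 * tri r) - real r" by simp
    show ?thesis
      by (rule hausdorff_dim_large_sums[OF mv tri_pos \<rho>1 \<alpha>, unfolded assms(1) eq])
         (use r pos[OF r, of "real r * (real r + 1)"] in auto)
  qed
  have "U2 d \<alpha> \<in> (\<lambda>r. (real d + 1 - \<alpha> + real r * (real r + 1) * (1 - \<alpha>) - real r) / (real d + 1 - \<alpha>)) ` {1..d}"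
    unfolding U2_def using assms(2) by (intro Min_in) auto
  then obtain r where "U2 d \<alpha> = (real d + 1 - \<alpha> + real r * (real r + 1) * (1 - \<alpha>) - real r) / (real d + 1 - \<alpha>)" "r \<in> {1..d}"
    by (rule imageE)
  then have 2: "hausdorff_dim ?F \<le> ereal (U2 d \<alpha>)" using vinogradov by simp
  show ?thesis using 1 2 by (simp add: min_def)
qed

end
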